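(* Let $\alpha$ be a number such that the First-Fit Decreasing bin-packing algorithm uses at most $\alpha\cdot OPT$ bins on every bin-packing instance with bin capacity $B$, where $OPT$ is the optimum number of bins. Then for every instance of DDP-NC with charging stations, AlgoFor-DDP-NC (described in the context) runs in $\mathcal O(n\log n+r)$ time, assigns every delivery to exactly one drone, every drone's assignment is feasible, and it uses at most $\alpha\cdot OPT_{NC}+2$ drones.
   Context: Model: $n$ deliveries; delivery $j$ has closed delivery time interval $I_j=[t_j^L,t_j^R]$ and cost $cost(I_j)\in(0,B]$, $B>0$ being the battery capacity of identical drones. In DDP-NC the delivery intervals are pairwise disjoint. There are $r$ charging stations with waiting intervals $I_\ell^c=[t_\ell^A,t_\ell^D]$, $\ell=1,\dots,r$, where $t_1^A<t_1^D<t_2^A<\dots<t_r^A<t_r^D$; no delivery interval is contained in a waiting interval and none intersects two waiting intervals. A drone may charge at station $\ell$ during a chosen subinterval $[t',t'']\subseteq I_\ell^c$; its battery then goes from its current value $rem$ to $Ch_\ell([t',t''],rem)\le B$, where $Ch_\ell(I_\ell^c,rem)=B$ for all $rem$, and while charging it cannot serve a delivery whose interval intersects $[t',t'']$. Several drones may charge simultaneously. A drone starts with battery $B$; a feasible assignment is a set of delivery intervals and charging subintervals, pairwise disjoint, such that in time order each delivery's cost is at most the drone's remaining battery when it is taken (battery decreasing by that cost). $OPT_{NC}$ is the minimum number of drones such that every delivery is assigned to exactly one drone and all assignments are feasible. A block is a set of delivery intervals of total cost at most $B$. First-Fit Decreasing (FFD) on a set $X$: sort $X$ in non-increasing cost,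 and place each interval into the lowest-indexed existing block into which it fits (total cost stays $\le B$), opening a new block if none fits. AlgoFor-DDP-NC: (1) let $\mathcal I_1=\{I_j: t_j^L<t_1^A\}$, $\mathcal I_\ell=\{I_j: t_{\ell-1}^A\le t_j^L<t_\ell^A\}$ for $2\le\ell\le r$, $\mathcal I_{r+1}=\{I_j: t_j^L\ge t_r^A\}$; for $\ell\ge2$ let $I_\ell^{first}$ be the interval of $\mathcal I_\ell$ containing $t_{\ell-1}^D$ (if any) and for $\ell\le r$ let $I_\ell^{last}$ be the interval of $\mathcal I_\ell$ containing $t_\ell^A$ (if any). (2) Partition each $\mathcal I_\ell$ into $m_\ell$ blocks by FFD; $S_\ell^{first}$, $S_\ell^{last}$ denote the blocks containing $I_\ell^{first}$, $I_\ell^{last}$. (3) Let $m_{max}=\max_\ell m_\ell$ and open $m_{max}+2$ drones. (4) Assign the blocks of $\mathcal I_1$ to distinct drones. For $\ell=2,\dots,r+1$: assign $S_\ell^{first}$ to a drone that is neither the drone $D_{\ell-2}^{last}$ assigned to $S_{\ell-2}^{last}$ nor any drone assigned to a block of $\mathcal I_{\ell-1}$ (call it $D_\ell^{first}$); assign the other blocks of $\mathcal I_\ell$ to distinct drones other than $D_{\ell-1}^{last}$ and $D_\ell^{first}$. After processing $\mathcal I_\ell$ with $\ell\le r$, every used drone with battery below $B$, except $D_\ell^{last}$, charges over the whole interval $I_\ell^c$. (Nonexistent objects, and $D_0^{last},D_{-1}^{last},\mathcal I_0$, are empty.) *)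

theory Defs
  imports Complex_Main
begin

section \<open>Instances of DDP-NC with charging stations\<close>

text \<open>
  Deliveries are numbered 1, ..., \<open>num_del\<close> and stations 1, ..., \<open>num_st\<close>; the values of the
  component functions at other indices are irrelevant. \<open>charge_to I l t' t'' rem\<close> is the battery
  level after charging at station \<open>l\<close> during \<open>[t', t'']\<close> from level \<open>rem\<close>.
\<close>

record instance_nc =
  cap :: real
  num_del :: nat
  del_start :: "nat \<Rightarrow> real"
  del_end :: "nat \<Rightarrow> real"
  del_cost :: "nat \<Rightarrow> real"
  num_st :: nat
  st_start :: "nat \<Rightarrow> real"
  st_end :: "nat \<Rightarrow> real"
  charge_to :: "nat \<Rightarrow> real \<Rightarrow> real \<Rightarrow> real \<Rightarrow> real"

definition del_interval :: "instance_nc \<Rightarrow> nat \<Rightarrow> real set" where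
  "del_interval I j = {del_start I j .. del_end I j}"

definition wait_interval :: "instance_nc \<Rightarrow> nat \<Rightarrow> real set" where
  "wait_interval I l = {st_start I l .. st_end I l}"

text \<open>
  Full charging is only required to give level \<open>cap\<close> from levels in \<open>[0, cap]\<close>, and the upper
  bound only from levels at most \<open>cap\<close>. Neither nonnegativity nor monotonicity of the charging
  function is assumed.
\<close>

definition ddp_nc :: "instance_nc \<Rightarrow> bool" where
  "ddp_nc I \<longleftrightarrow>
     0 < cap I \<and>
     (\<forall>j\<in>{1..num_del I}. del_start I j \<le> del_end I j \<and> 0 < del_cost I j \<and> del_cost I j \<le> cap I) \<and>
     (\<forall>i\<in>{1..num_del I}. \<forall>j\<in>{1..num_del I}. i \<noteq> j \<longrightarrow> disjnt (del_interval I i) (del_interval I j)) \<and>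
     (\<forall>l\<in>{1..num_st I}. st_start I l < st_end I l) \<and>
     (\<forall>l\<in>{1..<num_st I}. st_end I l < st_start I (Suc l)) \<and>
     (\<forall>j\<in>{1..num_del I}. \<forall>l\<in>{1..num_st I}. \<not> del_interval I j \<subseteq> wait_interval I l) \<and>
     (\<forall>j\<in>{1..num_del I}. \<forall>k\<in>{1..num_st I}. \<forall>l\<in>{1..num_st I}. k \<noteq> l \<longrightarrow>
        disjnt (del_interval I j) (wait_interval I k) \<or> disjnt (del_interval I j) (wait_interval I l)) \<and>
     (\<forall>l\<in>{1..num_st I}. \<forall>t' t'' rem. st_start I l \<le> t' \<and> t' \<le> t'' \<and> t'' \<le> st_end I l \<and> rem \<le> cap I \<longrightarrow>
        charge_to I l t' t'' rem \<le> cap I) \<and>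
     (\<forall>l\<in>{1..num_st I}. \<forall>rem. 0 \<le> rem \<and> rem \<le> cap I \<longrightarrow>
        charge_to I l (st_start I l) (st_end I l) rem = cap I)"


section \<open>Feasible assignments and the optimum\<close>

datatype event = Deliver nat | Charge nat real real

fun valid_event :: "instance_nc \<Rightarrow> event \<Rightarrow> bool" where
  "valid_event I (Deliver j) \<longleftrightarrow> j \<in> {1..num_del I}"
| "valid_event I (Charge l t' t'') \<longleftrightarrow>
     l \<in> {1..num_st I} \<and> st_start I l \<le> t' \<and> t' \<le> t'' \<and> t'' \<le> st_end I l"

fun event_start :: "instance_nc \<Rightarrow> event \<Rightarrow> real" where
  "event_start I (Deliver j) = del_start I j"
| "event_start I (Charge l t' t'') = t'"

fun event_interval :: "instance_nc \<Rightarrow> event \<Rightarrow> real set" where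
  "event_interval I (Deliver j) = del_interval I j"
| "event_interval I (Charge l t' t'') = {t'..t''}"

fun battery_ok :: "instance_nc \<Rightarrow> real \<Rightarrow> event list \<Rightarrow> bool" where
  "battery_ok I b [] \<longleftrightarrow> True"
| "battery_ok I b (Deliver j # es) \<longleftrightarrow> del_cost I j \<le> b \<and> battery_ok I (b - del_cost I j) es"
| "battery_ok I b (Charge l t' t'' # es) \<longleftrightarrow> battery_ok I (charge_to I l t' t'' b) es"

text \<open>
  The enumeration \<open>es\<close> in time order is unique, since the intervals are nonempty and disjoint.
\<close>

definition feasible :: "instance_nc \<Rightarrow> event set \<Rightarrow> bool" where
  "feasible I S \<longleftrightarrow>
     finite S \<and> (\<forall>e\<in>S. valid_event I e) \<and>
     (\<forall>e\<in>S. \<forall>e'\<in>S. e \<noteq> e' \<longrightarrow> disjnt (event_interval I e) (event_interval I e')) \<and>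
     (\<exists>es. set es = S \<and> distinct es \<and> sorted (map (event_start I) es) \<and> battery_ok I (cap I) es)"

definition opt_nc :: "instance_nc \<Rightarrow> nat" where
  "opt_nc I = (LEAST k. \<exists>S. (\<forall>d<k. feasible I (S d)) \<and>
     (\<forall>j\<in>{1..num_del I}. \<exists>!d. d < k \<and> Deliver j \<in> S d))"


section \<open>Bin packing and First-Fit Decreasing\<close>

definition opt_bins :: "real \<Rightarrow> (nat \<Rightarrow> real) \<Rightarrow> nat set \<Rightarrow> nat" where
  "opt_bins B c X = (LEAST k. \<exists>f::nat \<Rightarrow> nat. (\<forall>x\<in>X. f x < k) \<and> (\<forall>i<k. sum c {x\<in>X. f x = i} \<le> B))"

fun place :: "real \<Rightarrow> (nat \<Rightarrow> real) \<Rightarrow> nat \<Rightarrow> nat set list \<Rightarrow> nat set list" where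
  "place B c x [] = [{x}]"
| "place B c x (b # bs) = (if sum c b + c x \<le> B then insert x b # bs else b # place B c x bs)"

text \<open>\<open>ffd B c X bs\<close>: some way of breaking ties in the sorting step yields the blocks \<open>bs\<close>.\<close>

definition ffd :: "real \<Rightarrow> (nat \<Rightarrow> real) \<Rightarrow> nat set \<Rightarrow> nat set list \<Rightarrow> bool" where
  "ffd B c X bs \<longleftrightarrow>
     (\<exists>xs. set xs = X \<and> distinct xs \<and> sorted_wrt (\<lambda>x y. c x \<ge> c y) xs \<and> bs = fold (place B c) xs [])"

definition ffd_ratio :: "real \<Rightarrow> real \<Rightarrow> bool" where
  "ffd_ratio B \<alpha> \<longleftrightarrow>
     (\<forall>X c bs. finite X \<and> (\<forall>x\<in>X. 0 < c x \<and> c x \<le> B) \<and> ffd B c X bs \<longrightarrow>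
        real (length bs) \<le> \<alpha> * real (opt_bins B c X))"


section \<open>The algorithm\<close>

text \<open>
  For \<open>l\<close> outside \<open>{1..num_st I + 1}\<close> the group is empty, so that all first and last blocks (and
  drones) with such an index do not exist. Without stations there is a single group.
\<close>

definition group_nc :: "instance_nc \<Rightarrow> nat \<Rightarrow> nat set" where
  "group_nc I l = {j\<in>{1..num_del I}. l \<in> {1..num_st I + 1} \<and>
     (2 \<le> l \<longrightarrow> st_start I (l - 1) \<le> del_start I j) \<and>
     (l \<le> num_st I \<longrightarrow> del_start I j < st_start I l)}"

definition first_dels :: "instance_nc \<Rightarrow> nat \<Rightarrow> nat set" where
  "first_dels I l = {j\<in>group_nc I l. 2 \<le> l \<and> st_end I (l - 1) \<in> del_interval I j}"

definition last_dels :: "instance_nc \<Rightarrow> nat \<Rightarrow> nat set" where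
  "last_dels I l = {j\<in>group_nc I l. l \<le> num_st I \<and> st_start I l \<in> del_interval I j}"

text \<open>
  \<open>P l\<close> is the list of blocks of group \<open>l\<close>, and \<open>D l i\<close> is the drone (a number below
  \<open>num_drones I P\<close>) to which the block \<open>P l ! i\<close> is assigned. The sets of first and last block
  indices and drones have at most one element.
\<close>

definition first_blocks :: "instance_nc \<Rightarrow> (nat \<Rightarrow> nat set list) \<Rightarrow> nat \<Rightarrow> nat set" where
  "first_blocks I P l = {i. i < length (P l) \<and> P l ! i \<inter> first_dels I l \<noteq> {}}"

definition last_blocks :: "instance_nc \<Rightarrow> (nat \<Rightarrow> nat set list) \<Rightarrow> nat \<Rightarrow> nat set" where
  "last_blocks I P l = {i. i < length (P l) \<and> P l ! i \<inter> last_dels I l \<noteq> {}}"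

definition first_drone :: "instance_nc \<Rightarrow> (nat \<Rightarrow> nat set list) \<Rightarrow> (nat \<Rightarrow> nat \<Rightarrow> nat) \<Rightarrow> nat \<Rightarrow> nat set" where
  "first_drone I P D l = D l ` first_blocks I P l"

definition last_drone :: "instance_nc \<Rightarrow> (nat \<Rightarrow> nat set list) \<Rightarrow> (nat \<Rightarrow> nat \<Rightarrow> nat) \<Rightarrow> nat \<Rightarrow> nat set" where
  "last_drone I P D l = D l ` last_blocks I P l"

definition ffd_partition :: "instance_nc \<Rightarrow> (nat \<Rightarrow> nat set list) \<Rightarrow> bool" where
  "ffd_partition I P \<longleftrightarrow> (\<forall>l\<in>{1..num_st I + 1}. ffd (cap I) (del_cost I) (group_nc I l) (P l))"

definition num_drones :: "instance_nc \<Rightarrow> (nat \<Rightarrow> nat set list) \<Rightarrow> nat" where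
  "num_drones I P = Max ((\<lambda>l. length (P l)) ` {1..num_st I + 1}) + 2"

text \<open>
  The requirements on the drones chosen for group \<open>l\<close>. They refer only to the choices for the
  groups \<open>l - 2\<close>, \<open>l - 1\<close> and \<open>l\<close>. For \<open>l = 1\<close> there are no first blocks and no earlier last
  drones, so only distinctness is required.
\<close>

definition stage :: "instance_nc \<Rightarrow> (nat \<Rightarrow> nat set list) \<Rightarrow> (nat \<Rightarrow> nat \<Rightarrow> nat) \<Rightarrow> nat \<Rightarrow> bool" where
  "stage I P D l \<longleftrightarrow>
     (\<forall>i<length (P l). D l i < num_drones I P) \<and>
     (\<forall>i\<in>first_blocks I P l. D l i \<notin> last_drone I P D (l - 2) \<and> D l i \<notin> D (l - 1) ` {..<length (P (l - 1))}) \<and>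
     (\<forall>i\<in>{..<length (P l)} - first_blocks I P l.
        D l i \<notin> last_drone I P D (l - 1) \<and> D l i \<notin> first_drone I P D l) \<and>
     inj_on (D l) ({..<length (P l)} - first_blocks I P l)"

definition algo_run :: "instance_nc \<Rightarrow> (nat \<Rightarrow> nat set list) \<Rightarrow> (nat \<Rightarrow> nat \<Rightarrow> nat) \<Rightarrow> bool" where
  "algo_run I P D \<longleftrightarrow> ffd_partition I P \<and> (\<forall>l\<in>{1..num_st I + 1}. stage I P D l)"

definition served :: "(nat \<Rightarrow> nat set list) \<Rightarrow> (nat \<Rightarrow> nat \<Rightarrow> nat) \<Rightarrow> nat \<Rightarrow> nat \<Rightarrow> nat set" where
  "served P D l d = (\<Union>i\<in>{i. i < length (P l) \<and> D l i = d}. P l ! i)"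

definition used_by :: "(nat \<Rightarrow> nat set list) \<Rightarrow> (nat \<Rightarrow> nat \<Rightarrow> nat) \<Rightarrow> nat \<Rightarrow> nat \<Rightarrow> bool" where
  "used_by P D l d \<longleftrightarrow> (\<exists>k\<in>{1..l}. \<exists>i<length (P k). D k i = d)"

text \<open>\<open>charges I P D l d b\<close>: does drone \<open>d\<close>, having level \<open>b\<close> after group \<open>l\<close>, charge at station \<open>l\<close>?\<close>

definition charges :: "instance_nc \<Rightarrow> (nat \<Rightarrow> nat set list) \<Rightarrow> (nat \<Rightarrow> nat \<Rightarrow> nat) \<Rightarrow> nat \<Rightarrow> nat \<Rightarrow> real \<Rightarrow> bool" where
  "charges I P D l d b \<longleftrightarrow>
     l \<in> {1..num_st I} \<and> used_by P D l d \<and> b < cap I \<and> d \<notin> last_drone I P D l"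

text \<open>The battery level of drone \<open>d\<close> after it has served group \<open>l\<close>, before it may charge at station \<open>l\<close>.\<close>

primrec level :: "instance_nc \<Rightarrow> (nat \<Rightarrow> nat set list) \<Rightarrow> (nat \<Rightarrow> nat \<Rightarrow> nat) \<Rightarrow> nat \<Rightarrow> nat \<Rightarrow> real" where
  "level I P D 0 d = cap I"
| "level I P D (Suc l) d =
     (if charges I P D l d (level I P D l d)
      then charge_to I l (st_start I l) (st_end I l) (level I P D l d)
      else level I P D l d)
     - sum (del_cost I) (served P D (Suc l) d)"

definition charging :: "instance_nc \<Rightarrow> (nat \<Rightarrow> nat set list) \<Rightarrow> (nat \<Rightarrow> nat \<Rightarrow> nat) \<Rightarrow> nat \<Rightarrow> nat set" where
  "charging I P D l = {d. charges I P D l d (level I P D l d)}"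

definition schedule :: "instance_nc \<Rightarrow> (nat \<Rightarrow> nat set list) \<Rightarrow> (nat \<Rightarrow> nat \<Rightarrow> nat) \<Rightarrow> nat \<Rightarrow> event set" where
  "schedule I P D d =
     {Deliver j | j. \<exists>l\<in>{1..num_st I + 1}. j \<in> served P D l d} \<union>
     {Charge l (st_start I l) (st_end I l) | l. l \<in> {1..num_st I} \<and> d \<in> charging I P D l}"


section \<open>Running time\<close>

text \<open>
  The machine model: a first-order functional language on binary trees whose leaves carry real
  numbers. The only arithmetic is addition, subtraction and comparison of reals, the only
  numerical constants are 0 and 1, and there are no higher-order features. A program consists of
  a list of function bodies, which may be mutually recursive, and a main expression.

  Variables are de Bruijn indices into the environment. The body of a called function is
  evaluated in the environment that consists of the argument only, so the length of every
  environment is bounded by a constant that depends on the program. Each rule costs one unit and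
  can be simulated in constant time on a real RAM.
\<close>

datatype val = VNil | VNum real | VPair val val

datatype expr =
    Var nat
  | Nil_E
  | Zero_E
  | One_E
  | Add_E expr expr
  | Sub_E expr expr
  | IfLe_E expr expr expr expr
  | Pair_E expr expr
  | Case_E expr expr expr
  | Let_E expr expr
  | Call_E nat expr

text \<open>
  \<open>evaluates fs env e v t\<close>: the expression \<open>e\<close> evaluates to \<open>v\<close> in \<open>t\<close> steps. The rules are
  deterministic; \<open>Case_E e e1 e2\<close> branches on \<open>e\<close> being nil or a pair.
\<close>

inductive evaluates :: "expr list \<Rightarrow> val list \<Rightarrow> expr \<Rightarrow> val \<Rightarrow> nat \<Rightarrow> bool" for fs where
  ev_var: "i < length env \<Longrightarrow> evaluates fs env (Var i) (env ! i) 1"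
| ev_nil: "evaluates fs env Nil_E VNil 1"
| ev_zero: "evaluates fs env Zero_E (VNum 0) 1"
| ev_one: "evaluates fs env One_E (VNum 1) 1"
| ev_add: "evaluates fs env e1 (VNum x) t1 \<Longrightarrow> evaluates fs env e2 (VNum y) t2 \<Longrightarrow>
    evaluates fs env (Add_E e1 e2) (VNum (x + y)) (t1 + t2 + 1)"
| ev_sub: "evaluates fs env e1 (VNum x) t1 \<Longrightarrow> evaluates fs env e2 (VNum y) t2 \<Longrightarrow>
    evaluates fs env (Sub_E e1 e2) (VNum (x - y)) (t1 + t2 + 1)"
| ev_le: "evaluates fs env e1 (VNum x) t1 \<Longrightarrow> evaluates fs env e2 (VNum y) t2 \<Longrightarrow> x \<le> y \<Longrightarrow>
    evaluates fs env e3 v t3 \<Longrightarrow> evaluates fs env (IfLe_E e1 e2 e3 e4) v (t1 + t2 + t3 + 1)"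
| ev_gt: "evaluates fs env e1 (VNum x) t1 \<Longrightarrow> evaluates fs env e2 (VNum y) t2 \<Longrightarrow> \<not> x \<le> y \<Longrightarrow>
    evaluates fs env e4 v t4 \<Longrightarrow> evaluates fs env (IfLe_E e1 e2 e3 e4) v (t1 + t2 + t4 + 1)"
| ev_pair: "evaluates fs env e1 v1 t1 \<Longrightarrow> evaluates fs env e2 v2 t2 \<Longrightarrow>
    evaluates fs env (Pair_E e1 e2) (VPair v1 v2) (t1 + t2 + 1)"
| ev_case_nil: "evaluates fs env e VNil t \<Longrightarrow> evaluates fs env e1 v t1 \<Longrightarrow>
    evaluates fs env (Case_E e e1 e2) v (t + t1 + 1)"
| ev_case_pair: "evaluates fs env e (VPair v1 v2) t \<Longrightarrow> evaluates fs (v1 # v2 # env) e2 v t2 \<Longrightarrow>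
    evaluates fs env (Case_E e e1 e2) v (t + t2 + 1)"
| ev_let: "evaluates fs env e1 v1 t1 \<Longrightarrow> evaluates fs (v1 # env) e2 v t2 \<Longrightarrow>
    evaluates fs env (Let_E e1 e2) v (t1 + t2 + 1)"
| ev_call: "f < length fs \<Longrightarrow> evaluates fs env e v1 t1 \<Longrightarrow> evaluates fs [v1] (fs ! f) v t2 \<Longrightarrow>
    evaluates fs env (Call_E f e) v (t1 + t2 + 1)"

definition val_list :: "val list \<Rightarrow> val" where
  "val_list vs = foldr VPair vs VNil"

text \<open>The deliveries are given in arbitrary order, the stations in their order of time.\<close>

definition input_val :: "instance_nc \<Rightarrow> val" where
  "input_val I =
     VPair (VNum (cap I))
      (VPair
        (val_list (map (\<lambda>j. VPair (VNum (del_start I j)) (VPair (VNum (del_end I j)) (VNum (del_cost I j))))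
          [1..<num_del I + 1]))
        (val_list (map (\<lambda>l. VPair (VNum (st_start I l)) (VNum (st_end I l))) [1..<num_st I + 1])))"

text \<open>
  The output consists of the number of drones, a list of all (delivery, drone) pairs of the
  assignment, and, for every station, a list of the drones charging there.
\<close>

definition output_val :: "instance_nc \<Rightarrow> (nat \<Rightarrow> nat set list) \<Rightarrow> (nat \<Rightarrow> nat \<Rightarrow> nat) \<Rightarrow> val \<Rightarrow> bool" where
  "output_val I P D v \<longleftrightarrow>
     (\<exists>ps cs. distinct ps \<and> set ps = {(j, d). Deliver j \<in> schedule I P D d} \<and>
        length cs = num_st I \<and> (\<forall>l\<in>{1..num_st I}. distinct (cs ! (l - 1)) \<and> set (cs ! (l - 1)) = charging I P D l) \<and>
        v = VPair (VNum (real (num_drones I P)))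
             (VPair (val_list (map (\<lambda>(j, d). VPair (VNum (real j)) (VNum (real d))) ps))
               (val_list (map (\<lambda>ds. val_list (map (\<lambda>d. VNum (real d)) ds)) cs))))"

text \<open>
  One program and one constant serve all instances. The instances with at most one delivery and
  no station are excluded from the time bound because there \<open>n log n + r = 0\<close>.
\<close>

definition algo_in_time_n_log_n_plus_r :: bool where
  "algo_in_time_n_log_n_plus_r \<longleftrightarrow>
     (\<exists>fs e. \<exists>C::real. \<forall>I. ddp_nc I \<longrightarrow>
        (\<exists>P D v t. algo_run I P D \<and> output_val I P D v \<and> evaluates fs [input_val I] e v t \<and>
           (2 \<le> num_del I \<or> 1 \<le> num_st I \<longrightarrow>
              real t \<le> C * (real (num_del I) * log 2 (real (num_del I)) + real (num_st I)))))"

end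

theory Submission
  imports Defs "HOL-Library.Monad_Syntax" "HOL-Library.Multiset"
begin

text \<open>
  Feasibility: a drone that is not the last drone of group \<open>l\<close> is full when group \<open>l + 1\<close> starts, and a
  last drone rests during group \<open>l + 1\<close> and charges afterwards. A delivery meets the waiting interval
  of station \<open>l\<close> only if it is the last one of group \<open>l\<close> or the first one of group \<open>l + 1\<close>; the former
  stops its drone from charging, and the latter is given to a drone that is already full.

  Approximation: no drone of an optimal solution can charge between two deliveries of one group, so
  that its deliveries in the group form a block, and every group needs at most \<open>opt_nc\<close> blocks.

  Running time: first fit descends a tournament tree over the residual capacities. The drones of
  group \<open>l\<close> are the numbers \<open>0, 1, 2, ...\<close> without the last drone \<open>a\<close> of group \<open>l - 1\<close> and the drone
  \<open>f\<close> reserved for the first block of group \<open>l\<close>. If that block exists, the number that it would have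
  received is reserved for the first block of group \<open>l + 1\<close>; otherwise \<open>f\<close> stays reserved. Battery
  levels need not be computed: the drones that charge at station \<open>l\<close> are those of group \<open>l\<close> and the
  last drone of group \<open>l - 1\<close>, except for the last drone of group \<open>l\<close>.
\<close>

section \<open>An interpreter for the machine model\<close>

text \<open>The machine has no arrays, so neither first fit nor the choice of drones can afford a
  search per block. For the drones, at most two numbers are forbidden to the blocks of a group other
  than the first one, so that block number \<open>i\<close> (from 0) receives a number at most
  \<open>i + 2\<close>; this matches the two drones beyond the maximal number of blocks. The drone
  of a first block has to avoid a whole group of drones as well as an earlier last drone, and
  finding one by counting would be too slow, which is why it is prepared one group ahead. Sorting
  once by start time makes each group a prefix of the remaining deliveries, so that the costs of the
  groups add up. Feasibility and the ratio are shown for all runs, with arbitrary tie-breaking and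
  drone choices; only the time bound fixes one run.\<close>

fun num_of :: "val \<Rightarrow> real option" where
  "num_of (VNum x) = Some x"
| "num_of _ = None"

lemma num_of_eq_Some: "num_of v = Some x \<longleftrightarrow> v = VNum x"
  by (cases v) auto

lemma case_val_eq_Some:
  "(case v of VNil \<Rightarrow> a | VNum x \<Rightarrow> None | VPair x y \<Rightarrow> b x y) = Some r \<longleftrightarrow>
     v = VNil \<and> a = Some r \<or> (\<exists>x y. v = VPair x y \<and> b x y = Some r)"
  by (cases v) auto

text \<open>An executable counterpart of \<open>evaluates\<close>, with which the simplifier can
  compute values and step counts. Programs may diverge, hence the fixpoint in the option
  type.\<close>

partial_function (option) run :: "expr list \<Rightarrow> val list \<Rightarrow> expr \<Rightarrow> (val \<times> nat) option" where
  "run fs env e = (case e of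
     Var i \<Rightarrow> if i < length env then Some (env ! i, 1) else None
   | Nil_E \<Rightarrow> Some (VNil, 1)
   | Zero_E \<Rightarrow> Some (VNum 0, 1)
   | One_E \<Rightarrow> Some (VNum 1, 1)
   | Add_E a b \<Rightarrow> do {(v, t) \<leftarrow> run fs env a; (w, u) \<leftarrow> run fs env b;
       x \<leftarrow> num_of v; y \<leftarrow> num_of w; Some (VNum (x + y), t + u + 1)}
   | Sub_E a b \<Rightarrow> do {(v, t) \<leftarrow> run fs env a; (w, u) \<leftarrow> run fs env b;
       x \<leftarrow> num_of v; y \<leftarrow> num_of w; Some (VNum (x - y), t + u + 1)}
   | IfLe_E a b c d \<Rightarrow> do {(v, t) \<leftarrow> run fs env a; (w, u) \<leftarrow> run fs env b;
       x \<leftarrow> num_of v; y \<leftarrow> num_of w;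
       (z, s) \<leftarrow> (if x \<le> y then run fs env c else run fs env d); Some (z, t + u + s + 1)}
   | Pair_E a b \<Rightarrow> do {(v, t) \<leftarrow> run fs env a; (w, u) \<leftarrow> run fs env b; Some (VPair v w, t + u + 1)}
   | Case_E a b c \<Rightarrow> do {(v, t) \<leftarrow> run fs env a;
       (z, s) \<leftarrow> (case v of VNil \<Rightarrow> run fs env b | VPair x y \<Rightarrow> run fs (x # y # env) c | _ \<Rightarrow> None);
       Some (z, t + s + 1)}
   | Let_E a b \<Rightarrow> do {(v, t) \<leftarrow> run fs env a; (w, u) \<leftarrow> run fs (v # env) b; Some (w, t + u + 1)}
   | Call_E f a \<Rightarrow> if f < length fs
       then do {(v, t) \<leftarrow> run fs env a; (w, u) \<leftarrow> run fs [v] (fs ! f); Some (w, t + u + 1)}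
       else None)"

text \<open>Only soundness is shown, since evaluations are always exhibited and never analysed. The
  fixpoint induction replaces \<open>run\<close> by an arbitrary function for which recursive calls
  are sound.\<close>

lemma evaluates_if_run:
  assumes "run fs env e = Some p"
  shows "evaluates fs env e (fst p) (snd p)"
  using assms
proof (rule run.raw_induct[of "\<lambda>fs env e p. evaluates fs env e (fst p) (snd p)", rotated])
  fix run :: "expr list \<Rightarrow> val list \<Rightarrow> expr \<Rightarrow> (val \<times> nat) option" and fs env e p
  assume IH: "\<And>fs env e p. run fs env e = Some p \<Longrightarrow> evaluates fs env e (fst p) (snd p)"
  have IH': "run fs env e = Some (v, t) \<Longrightarrow> evaluates fs env e v t" for fs env e v t
    using IH[of fs env e "(v, t)"] by simp
  \<comment> \<open>Simplification turns the costs \<open>t + u + 1\<close> into successors; the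
    rules are brought into the same form.\<close>
  note intros = evaluates.intros[unfolded One_nat_def add_Suc_right add_0_right]
  show "(case e of
     Var i \<Rightarrow> if i < length env then Some (env ! i, 1) else None
   | Nil_E \<Rightarrow> Some (VNil, 1)
   | Zero_E \<Rightarrow> Some (VNum 0, 1)
   | One_E \<Rightarrow> Some (VNum 1, 1)
   | Add_E a b \<Rightarrow> do {(v, t) \<leftarrow> run fs env a; (w, u) \<leftarrow> run fs env b;
       x \<leftarrow> num_of v; y \<leftarrow> num_of w; Some (VNum (x + y), t + u + 1)}
   | Sub_E a b \<Rightarrow> do {(v, t) \<leftarrow> run fs env a; (w, u) \<leftarrow> run fs env b;
       x \<leftarrow> num_of v; y \<leftarrow> num_of w; Some (VNum (x - y), t + u + 1)}
   | IfLe_E a b c d \<Rightarrow> do {(v, t) \<leftarrow> run fs env a; (w, u) \<leftarrow> run fs env b;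
       x \<leftarrow> num_of v; y \<leftarrow> num_of w;
       (z, s) \<leftarrow> (if x \<le> y then run fs env c else run fs env d); Some (z, t + u + s + 1)}
   | Pair_E a b \<Rightarrow> do {(v, t) \<leftarrow> run fs env a; (w, u) \<leftarrow> run fs env b; Some (VPair v w, t + u + 1)}
   | Case_E a b c \<Rightarrow> do {(v, t) \<leftarrow> run fs env a;
       (z, s) \<leftarrow> (case v of VNil \<Rightarrow> run fs env b | VPair x y \<Rightarrow> run fs (x # y # env) c | _ \<Rightarrow> None);
       Some (z, t + s + 1)}
   | Let_E a b \<Rightarrow> do {(v, t) \<leftarrow> run fs env a; (w, u) \<leftarrow> run fs (v # env) b; Some (w, t + u + 1)}
   | Call_E f a \<Rightarrow> if f < length fs
       then do {(v, t) \<leftarrow> run fs env a; (w, u) \<leftarrow> run fs [v] (fs ! f); Some (w, t + u + 1)}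
       else None) = Some p \<Longrightarrow> evaluates fs env e (fst p) (snd p)"
    by (cases e; auto simp: Option.bind_eq_Some_conv num_of_eq_Some case_val_eq_Some
        split: if_splits intro: intros dest!: IH'; metis intros(7,8))
qed

section \<open>The program\<close>

text \<open>
  Code is given the current length of the environment, so that machine variables can be bound by HOL
  abstractions: the variable that was pushed onto an environment of length \<open>m\<close> has index
  \<open>k - (m + 1)\<close> in an environment of length \<open>k\<close>.
\<close>

type_synonym code = "nat \<Rightarrow> expr"

text \<open>The pair branch runs in \<open>v1 # v2 # env\<close>, so the first component counts as
  the one pushed last and gets the offset \<open>d + 2\<close>.\<close>

definition case_c :: "code \<Rightarrow> code \<Rightarrow> (code \<Rightarrow> code \<Rightarrow> code) \<Rightarrow> code" where
  "case_c e e1 f = (\<lambda>d. Case_E (e d) (e1 d) (f (\<lambda>k. Var (k - (d + 2))) (\<lambda>k. Var (k - (d + 1))) (d + 2)))"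

definition let_c :: "code \<Rightarrow> (code \<Rightarrow> code) \<Rightarrow> code" where
  "let_c e f = (\<lambda>d. Let_E (e d) (f (\<lambda>k. Var (k - (d + 1))) (d + 1)))"

definition nil_c :: code where
  "nil_c = (\<lambda>d. Nil_E)"

definition zero_c :: code where
  "zero_c = (\<lambda>d. Zero_E)"

definition one_c :: code where
  "one_c = (\<lambda>d. One_E)"

definition add_c :: "code \<Rightarrow> code \<Rightarrow> code" where
  "add_c a b = (\<lambda>d. Add_E (a d) (b d))"

definition sub_c :: "code \<Rightarrow> code \<Rightarrow> code" where
  "sub_c a b = (\<lambda>d. Sub_E (a d) (b d))"

definition le_c :: "code \<Rightarrow> code \<Rightarrow> code \<Rightarrow> code \<Rightarrow> code" where
  "le_c a b e1 e2 = (\<lambda>d. IfLe_E (a d) (b d) (e1 d) (e2 d))"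

definition pair_c :: "code \<Rightarrow> code \<Rightarrow> code" where
  "pair_c a b = (\<lambda>d. Pair_E (a d) (b d))"

definition call_c :: "nat \<Rightarrow> code \<Rightarrow> code" where
  "call_c f a = (\<lambda>d. Call_E f (a d))"

definition fun_c :: "(code \<Rightarrow> code) \<Rightarrow> expr" where
  "fun_c f = f (\<lambda>k. Var (k - 1)) 1"

lemmas code_defs = case_c_def let_c_def nil_c_def zero_c_def one_c_def add_c_def sub_c_def
  le_c_def pair_c_def call_c_def fun_c_def

text \<open>Only used on pairs: the nil branch is never taken.\<close>

abbreviation fields :: "code \<Rightarrow> (code \<Rightarrow> code \<Rightarrow> code) \<Rightarrow> code" where
  "fields e f \<equiv> case_c e nil_c f"

abbreviation eq_c :: "code \<Rightarrow> code \<Rightarrow> code \<Rightarrow> code \<Rightarrow> code" where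
  "eq_c a b e1 e2 \<equiv> le_c a b (le_c b a e1 e2) e2"

abbreviation split_c :: "code \<Rightarrow> code" where
  "split_c \<equiv> call_c 0"

abbreviation merge_c :: "code \<Rightarrow> code" where
  "merge_c \<equiv> call_c 1"

abbreviation sort_c :: "code \<Rightarrow> code" where
  "sort_c \<equiv> call_c 2"

abbreviation number_c :: "code \<Rightarrow> code" where
  "number_c \<equiv> call_c 3"

abbreviation past_c :: "code \<Rightarrow> code" where
  "past_c \<equiv> call_c 4"

abbreviation early_c :: "code \<Rightarrow> code" where
  "early_c \<equiv> call_c 5"

abbreviation take_c :: "code \<Rightarrow> code" where
  "take_c \<equiv> call_c 6"

abbreviation length_c :: "code \<Rightarrow> code" where
  "length_c \<equiv> call_c 7"

abbreviation grow_c :: "code \<Rightarrow> code" where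
  "grow_c \<equiv> call_c 8"

abbreviation insert_c :: "code \<Rightarrow> code" where
  "insert_c \<equiv> call_c 9"

abbreviation node_c :: "code \<Rightarrow> code" where
  "node_c \<equiv> call_c 10"

abbreviation pack_c :: "code \<Rightarrow> code" where
  "pack_c \<equiv> call_c 11"

abbreviation flat_c :: "code \<Rightarrow> code" where
  "flat_c \<equiv> call_c 12"

abbreviation emit_c :: "code \<Rightarrow> code" where
  "emit_c \<equiv> call_c 13"

abbreviation step_c :: "code \<Rightarrow> code" where
  "step_c \<equiv> call_c 14"

abbreviation assign_c :: "code \<Rightarrow> code" where
  "assign_c \<equiv> call_c 15"

abbreviation group_c :: "code \<Rightarrow> code" where
  "group_c \<equiv> call_c 16"

abbreviation stations_c :: "code \<Rightarrow> code" where
  "stations_c \<equiv> call_c 17"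

text \<open>
  Data layout. Truth values: nil is false and a pair is true. Item of group \<open>l\<close>: (negated cost,
  (delivery, (is it in \<open>first_dels\<close>?, is it in \<open>last_dels\<close>?))). Block: (has a first delivery?, (has
  a last delivery?, deliveries)). Tree: (largest residual capacity, (nil, block)) or (largest residual
  capacity, ((left, right), nil)). State of \<open>assign_e\<close>: (drone reserved for the next group, (last
  drones, (charging drones, output pairs))). Argument of \<open>stations_e\<close>: (capacity, (remaining
  deliveries, (remaining stations, (end of the previous station, (reserved drone, (last drones of the
  previous group, (maximal number of blocks, output pairs))))))).
\<close>

definition split_e :: expr where
  "split_e = fun_c (\<lambda>xs. case_c xs (pair_c nil_c nil_c) (\<lambda>x xs'. fields (split_c xs') (\<lambda>a b. pair_c (pair_c x b) a)))"

definition merge_e :: expr where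
  "merge_e = fun_c (\<lambda>z. fields z (\<lambda>xs ys. case_c xs ys (\<lambda>x xs'. case_c ys xs (\<lambda>y ys'.
      fields x (\<lambda>k _. fields y (\<lambda>l _. le_c k l
        (pair_c x (merge_c (pair_c xs' ys)))
        (pair_c y (merge_c (pair_c xs ys')))))))))"

definition sort_e :: expr where
  "sort_e = fun_c (\<lambda>xs. case_c xs nil_c (\<lambda>_ r. case_c r xs (\<lambda>_ _.
      fields (split_c xs) (\<lambda>a b. merge_c (pair_c (sort_c a) (sort_c b))))))"

definition number_e :: expr where
  "number_e = fun_c (\<lambda>z. fields z (\<lambda>xs j. case_c xs nil_c (\<lambda>x xs'. fields x (\<lambda>s q.
      pair_c (pair_c s (pair_c j q)) (number_c (pair_c xs' (add_c j one_c)))))))"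

definition past_e :: expr where
  "past_e = fun_c (\<lambda>z. fields z (\<lambda>sts x. case_c sts nil_c (\<lambda>s _. fields s (\<lambda>a _.
      le_c a x (pair_c nil_c nil_c) nil_c))))"

definition early_e :: expr where
  "early_e = fun_c (\<lambda>z. fields z (\<lambda>prev x. case_c prev nil_c (\<lambda>e _.
      le_c x e (pair_c nil_c nil_c) nil_c)))"

definition take_e :: expr where
  "take_e = fun_c (\<lambda>z. fields z (\<lambda>xs q. case_c xs (pair_c nil_c nil_c) (\<lambda>x xs'.
      fields q (\<lambda>sts prev. fields x (\<lambda>s p. fields p (\<lambda>j ec. fields ec (\<lambda>e c.
      case_c (past_c (pair_c sts s))
        (fields (take_c (pair_c xs' q)) (\<lambda>g rest. pair_c
          (pair_c (pair_c (sub_c zero_c c) (pair_c j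
            (pair_c (early_c (pair_c prev s)) (past_c (pair_c sts e))))) g) rest))
        (\<lambda>_ _. pair_c nil_c xs))))))))"

definition length_e :: expr where
  "length_e = fun_c (\<lambda>xs. case_c xs zero_c (\<lambda>_ xs'. add_c one_c (length_c xs')))"

text \<open>Both children of a new root are the same value. By this sharing a complete tree of
  height h costs O(h) steps and not O(2^h).\<close>

definition grow_e :: expr where
  "grow_e = fun_c (\<lambda>z. fields z (\<lambda>n q. fields q (\<lambda>c t. le_c n c t
      (grow_c (pair_c n (pair_c (add_c c c) (node_c (pair_c t t))))))))"

text \<open>Going left whenever the largest residual capacity on the left suffices leads to the
  leftmost block that fits. The key \<open>k\<close> is the negated cost, so adding it to the
  capacity \<open>m\<close> charges the item.\<close>

definition insert_e :: expr where
  "insert_e = fun_c (\<lambda>z. fields z (\<lambda>x t. fields t (\<lambda>m b. fields b (\<lambda>lr content. fields x (\<lambda>k p.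
      case_c lr
        (fields p (\<lambda>j fl. fields fl (\<lambda>f l. fields content (\<lambda>cf cr. fields cr (\<lambda>cl js.
          pair_c (add_c m k) (pair_c nil_c
            (pair_c (case_c cf f (\<lambda>_ _. cf)) (pair_c (case_c cl l (\<lambda>_ _. cl)) (pair_c j js)))))))))
        (\<lambda>l r. fields l (\<lambda>ml _. le_c (sub_c zero_c k) ml
          (node_c (pair_c (insert_c (pair_c x l)) r))
          (node_c (pair_c l (insert_c (pair_c x r)))))))))))"

definition node_e :: expr where
  "node_e = fun_c (\<lambda>z. fields z (\<lambda>l r. fields l (\<lambda>ml _. fields r (\<lambda>mr _. le_c ml mr
      (pair_c mr (pair_c z nil_c)) (pair_c ml (pair_c z nil_c))))))"

definition pack_e :: expr where
  "pack_e = fun_c (\<lambda>z. fields z (\<lambda>xs t. case_c xs t (\<lambda>x xs'. pack_c (pair_c xs' (insert_c (pair_c x t))))))"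

definition flat_e :: expr where
  "flat_e = fun_c (\<lambda>z. fields z (\<lambda>t acc. fields t (\<lambda>_ b. fields b (\<lambda>lr content. case_c lr
      (fields content (\<lambda>_ cr. fields cr (\<lambda>_ js. case_c js acc (\<lambda>_ _. pair_c content acc))))
      (\<lambda>l r. flat_c (pair_c l (flat_c (pair_c r acc))))))))"

definition emit_e :: expr where
  "emit_e = fun_c (\<lambda>z. fields z (\<lambda>js q. fields q (\<lambda>d ps. case_c js ps (\<lambda>j js'.
      emit_c (pair_c js' (pair_c d (pair_c (pair_c j d) ps)))))))"

definition step_e :: expr where
  "step_e = fun_c (\<lambda>z. fields z (\<lambda>k q. fields q (\<lambda>a f.
      eq_c k a (add_c k one_c) (eq_c k f (add_c k one_c) k))))"

definition assign_e :: expr where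
  "assign_e = fun_c (\<lambda>z. fields z (\<lambda>bins z1. fields z1 (\<lambda>k z2. fields z2 (\<lambda>af st. case_c bins st (\<lambda>b bs.
      fields b (\<lambda>cf cr. fields cr (\<lambda>cl js. fields af (\<lambda>_ f.
      let_c (step_c (pair_c (step_c (pair_c k af)) af)) (\<lambda>q.
      let_c (case_c cf q (\<lambda>_ _. f)) (\<lambda>d.
      fields st (\<lambda>g s1. fields s1 (\<lambda>la s2. fields s2 (\<lambda>ch ps.
      assign_c (pair_c bs (pair_c (add_c q one_c) (pair_c af (pair_c (case_c cf g (\<lambda>_ _. q))
        (case_c cl
          (pair_c la (pair_c (pair_c d ch) (emit_c (pair_c js (pair_c d ps)))))
          (\<lambda>_ _. pair_c (pair_c d la) (pair_c ch (emit_c (pair_c js (pair_c d ps)))))))))))))))))))))))"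

definition group_e :: expr where
  "group_e = fun_c (\<lambda>z. fields z (\<lambda>cp z1. fields z1 (\<lambda>xs z2. fields z2 (\<lambda>f z3. fields z3 (\<lambda>la ps.
      let_c (flat_c (pair_c
        (pack_c (pair_c (sort_c xs) (grow_c (pair_c (length_c xs) (pair_c one_c
          (pair_c cp (pair_c nil_c (pair_c nil_c (pair_c nil_c nil_c)))))))))
        nil_c)) (\<lambda>bins.
      pair_c (length_c bins) (assign_c (pair_c bins (pair_c zero_c
        (pair_c (pair_c (case_c la f (\<lambda>d _. d)) f) (pair_c f (pair_c nil_c (pair_c la ps)))))))))))))"

definition stations_e :: expr where
  "stations_e = fun_c (\<lambda>z. fields z (\<lambda>cp z1. fields z1 (\<lambda>dels z2. fields z2 (\<lambda>sts z3. fields z3 (\<lambda>prev z4.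
      fields z4 (\<lambda>f z5. fields z5 (\<lambda>la z6. fields z6 (\<lambda>m ps.
      fields (take_c (pair_c dels (pair_c sts prev))) (\<lambda>xs rest.
      fields (group_c (pair_c cp (pair_c xs (pair_c f (pair_c la ps))))) (\<lambda>m' s.
      fields s (\<lambda>f' s1. fields s1 (\<lambda>la' s2. fields s2 (\<lambda>ch ps'.
      let_c (le_c m m' m' m) (\<lambda>m''.
      case_c sts (pair_c m'' (pair_c ps' nil_c)) (\<lambda>st sts'. fields st (\<lambda>_ e.
      fields (stations_c (pair_c cp (pair_c rest (pair_c sts' (pair_c (pair_c e nil_c)
          (pair_c f' (pair_c la' (pair_c m'' ps'))))))))
        (\<lambda>mx w. fields w (\<lambda>ps'' cs. pair_c mx (pair_c ps'' (pair_c ch cs))))))))))))))))))))"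

definition program :: "expr list" where
  "program = [split_e, merge_e, sort_e, number_e, past_e, early_e, take_e, length_e, grow_e,
    insert_e, node_e, pack_e, flat_e, emit_e, step_e, assign_e, group_e, stations_e]"

definition main_e :: expr where
  "main_e = fun_c (\<lambda>z. fields z (\<lambda>cp z1. fields z1 (\<lambda>dels sts.
      fields (stations_c (pair_c cp (pair_c (sort_c (number_c (pair_c dels one_c))) (pair_c sts
          (pair_c nil_c (pair_c zero_c (pair_c nil_c (pair_c zero_c nil_c))))))))
        (\<lambda>m q. pair_c (add_c m (add_c one_c one_c)) q))))"

text \<open>Calls are hidden behind a constant, so that the simplifier does not unfold the recursive ones.\<close>

definition app :: "nat \<Rightarrow> val \<Rightarrow> (val \<times> nat) option" where
  "app f v = run program [v] (program ! f)"

lemma run_Var: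
  "run fs (v # env) (Var 0) = Some (v, 1)"
  "run fs (v # env) (Var 1) = run fs env (Var 0)"
  "run fs (v # env) (Var (Suc i)) = run fs env (Var i)"
  "run fs (v # env) (Var (numeral n)) = run fs env (Var (pred_numeral n))"
  by (simp_all add: run.simps numeral_eq_Suc)

lemma run_Call:
  "f < length program \<Longrightarrow> run program env (Call_E f a) =
    do {(v, t) \<leftarrow> run program env a; (w, u) \<leftarrow> app f v; Some (w, t + u + 1)}"
  by (subst run.simps) (simp add: app_def)

lemma length_program: "length program = 18"
  by (simp add: program_def)

lemmas run_simps = run_Var
  run_Call[of 0, unfolded length_program, simplified]
  run_Call[of 1, unfolded length_program, simplified]
  run_Call[of "Suc 0", unfolded length_program, simplified]
  run_Call[of "numeral n" for n, unfolded length_program]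
  run.simps[of _ _ Nil_E, simplified]
  run.simps[of _ _ Zero_E, simplified]
  run.simps[of _ _ One_E, simplified]
  run.simps[of _ _ "Add_E a b" for a b, simplified]
  run.simps[of _ _ "Sub_E a b" for a b, simplified]
  run.simps[of _ _ "IfLe_E a b c d" for a b c d, simplified]
  run.simps[of _ _ "Pair_E a b" for a b, simplified]
  run.simps[of _ _ "Case_E a b c" for a b c, simplified]
  run.simps[of _ _ "Let_E a b" for a b, simplified]

text \<open>Keeps the simplifier from evaluating a continuation before its argument is known.\<close>

lemma bind_weak_cong: "m = m' \<Longrightarrow> Option.bind m f = Option.bind m' f"
  by simp

lemma app_simps:
  "app 0 v = run program [v] split_e"
  "app 1 v = run program [v] merge_e"
  "app 2 v = run program [v] sort_e"
  "app 3 v = run program [v] number_e"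
  "app 4 v = run program [v] past_e"
  "app 5 v = run program [v] early_e"
  "app 6 v = run program [v] take_e"
  "app 7 v = run program [v] length_e"
  "app 8 v = run program [v] grow_e"
  "app 9 v = run program [v] insert_e"
  "app 10 v = run program [v] node_e"
  "app 11 v = run program [v] pack_e"
  "app 12 v = run program [v] flat_e"
  "app 13 v = run program [v] emit_e"
  "app 14 v = run program [v] step_e"
  "app 15 v = run program [v] assign_e"
  "app 16 v = run program [v] group_e"
  "app 17 v = run program [v] stations_e"
  by (simp_all add: app_def, simp_all add: program_def)

section \<open>Cost of the program\<close>

lemma val_list_simps [simp]:
  "val_list [] = VNil"
  "val_list (x # xs) = VPair x (val_list xs)"
  by (simp_all add: val_list_def)

text \<open>Results are tracked exactly, step counts only from above, so that different branches of
  a body can share one bound.\<close>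

definition calls :: "nat \<Rightarrow> val \<Rightarrow> val \<Rightarrow> nat \<Rightarrow> bool" where
  "calls f v w b \<longleftrightarrow> (\<exists>t\<le>b. app f v = Some (w, t))"

lemma callsE:
  assumes "calls f v w b"
  obtains t where "t \<le> b" "app f v = Some (w, t)"
  using assms by (auto simp: calls_def)

lemma calls_mono: "calls f v w b \<Longrightarrow> b \<le> b' \<Longrightarrow> calls f v w b'"
  by (auto simp: calls_def)

lemmas exec = code_defs run_simps

section \<open>Merge sort\<close>

fun split_list :: "'a list \<Rightarrow> 'a list \<times> 'a list" where
  "split_list [] = ([], [])"
| "split_list (x # xs) = (x # snd (split_list xs), fst (split_list xs))"

text \<open>The two halves exchange their roles at every element, which keeps them balanced; the
  first one gets the odd element.\<close>

lemma length_split_list: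
  "length (fst (split_list xs)) = (length xs + 1) div 2"
  "length (snd (split_list xs)) = length xs div 2"
  by (induction xs) auto

lemma mset_split_list: "mset (fst (split_list xs)) + mset (snd (split_list xs)) = mset xs"
  by (induction xs) (auto simp: add.commute)

fun merge_by :: "('a \<Rightarrow> real) \<Rightarrow> 'a list \<Rightarrow> 'a list \<Rightarrow> 'a list" where
  "merge_by k [] ys = ys"
| "merge_by k xs [] = xs"
| "merge_by k (x # xs) (y # ys) =
     (if k x \<le> k y then x # merge_by k xs (y # ys) else y # merge_by k (x # xs) ys)"

lemma mset_merge_by [simp]: "mset (merge_by k xs ys) = mset xs + mset ys"
  by (induction k xs ys rule: merge_by.induct) auto

lemma set_merge_by [simp]: "set (merge_by k xs ys) = set xs \<union> set ys"
  by (induction k xs ys rule: merge_by.induct) auto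

lemma sorted_merge_by:
  assumes "sorted (map k xs)" "sorted (map k ys)"
  shows "sorted (map k (merge_by k xs ys))"
  using assms by (induction k xs ys rule: merge_by.induct) auto

function sort_by :: "('a \<Rightarrow> real) \<Rightarrow> 'a list \<Rightarrow> 'a list" where
  "sort_by k xs = (if length xs \<le> 1 then xs
     else merge_by k (sort_by k (fst (split_list xs))) (sort_by k (snd (split_list xs))))"
  by auto
termination by (relation "measure (\<lambda>(k, xs). length xs)") (auto simp: length_split_list)

declare sort_by.simps [simp del]

lemma mset_sort_by [simp]: "mset (sort_by k xs) = mset xs"
proof (induction k xs rule: sort_by.induct)
  case (1 k xs)
  then show ?case
    by (subst sort_by.simps) (simp add: mset_split_list)
qed

lemma sorted_sort_by: "sorted (map k (sort_by k xs))"
proof (induction k xs rule: sort_by.induct)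
  case (1 k xs)
  then show ?case
    by (subst sort_by.simps) (auto intro: sorted_merge_by simp: sorted01)
qed

lemma set_sort_by [simp]: "set (sort_by k xs) = set xs"
  by (metis mset_sort_by mset_eq_setD)

lemma length_sort_by [simp]: "length (sort_by k xs) = length xs"
  by (metis mset_sort_by size_mset)

lemma distinct_sort_by [simp]: "distinct (sort_by k xs) \<longleftrightarrow> distinct xs"
  by (metis mset_sort_by mset_eq_imp_distinct_iff)

lemma calls_split:
  "calls 0 (val_list xs) (VPair (val_list (fst (split_list xs))) (val_list (snd (split_list xs))))
     (20 * length xs + 20)"
proof (induction xs)
  case Nil
  show ?case
    unfolding calls_def app_simps by (simp add: split_e_def exec cong: bind_weak_cong)
next
  case (Cons x xs)
  then show ?case
    by (elim callsE, subst calls_def, subst app_simps)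
      (simp add: split_e_def exec cong: bind_weak_cong)
qed

definition keyed :: "('a \<Rightarrow> real) \<Rightarrow> ('a \<Rightarrow> val) \<Rightarrow> 'a \<Rightarrow> val" where
  "keyed k p x = VPair (VNum (k x)) (p x)"

lemma calls_merge:
  "calls 1 (VPair (val_list (map (keyed k p) xs)) (val_list (map (keyed k p) ys)))
     (val_list (map (keyed k p) (merge_by k xs ys))) (40 * (length xs + length ys) + 20)"
proof (induction k xs ys rule: merge_by.induct)
  case (1 k ys)
  show ?case
    unfolding calls_def app_simps by (simp add: merge_e_def exec keyed_def[abs_def] cong: bind_weak_cong)
next
  case (2 k x xs)
  show ?case
    unfolding calls_def app_simps by (simp add: merge_e_def exec keyed_def[abs_def] cong: bind_weak_cong)
next
  case (3 k x xs y ys)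
  show ?case
  proof (cases "k x \<le> k y")
    case True
    from "3.IH"(1)[OF this] show ?thesis using True
      by (elim callsE, subst calls_def, subst app_simps)
        (simp add: merge_e_def exec keyed_def[abs_def] cong: bind_weak_cong)
  next
    case False
    from "3.IH"(2)[OF this] show ?thesis using False
      by (elim callsE, subst calls_def, subst app_simps)
        (simp add: merge_e_def exec keyed_def[abs_def] cong: bind_weak_cong)
  qed
qed

lemma calls_sort:
  fixes k :: "'a \<Rightarrow> real" and p :: "'a \<Rightarrow> val"
  defines "enc \<equiv> keyed k p"
  assumes "length xs \<le> 2 ^ h"
  shows "calls 2 (val_list (map enc xs)) (val_list (map enc (sort_by k xs)))
     (60 * length xs * h + 120 * length xs + 20)"
proof -
  have main: "\<exists>t. app 2 (val_list (map enc xs)) = Some (val_list (map enc (sort_by k xs)), t) \<and>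
      t + 100 \<le> 60 * length xs * h + 120 * length xs" if "xs \<noteq> []" "length xs \<le> 2 ^ h" for xs
    using that
  proof (induction h arbitrary: xs)
    case 0
    then obtain x where "xs = [x]" by (cases xs) auto
    then show ?case
      unfolding app_simps by (simp add: sort_e_def exec sort_by.simps cong: bind_weak_cong)
  next
    case (Suc h)
    show ?case
    proof (cases "length xs \<le> 1")
      case True
      with Suc obtain x where "xs = [x]" by (cases xs) auto
      then show ?thesis
        unfolding app_simps by (simp add: sort_e_def exec sort_by.simps cong: bind_weak_cong)
    next
      case False
      then obtain x y zs where xs: "xs = x # y # zs"
        by (cases xs; cases "tl xs") auto
      define as bs where "as = fst (split_list xs)" and "bs = snd (split_list xs)"
      have len: "length as + length bs = length xs"
        by (simp add: as_def bs_def length_split_list)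
      have "as \<noteq> []" "bs \<noteq> []" "length as \<le> 2 ^ h" "length bs \<le> 2 ^ h"
        using False Suc.prems by (auto simp: as_def bs_def xs length_split_list
            simp flip: length_greater_0_conv)
      from Suc.IH[OF this(1,3)] Suc.IH[OF this(2,4)] obtain ta tb where
        a: "app 2 (val_list (map enc as)) = Some (val_list (map enc (sort_by k as)), ta)"
          "ta + 100 \<le> 60 * length as * h + 120 * length as" and
        b: "app 2 (val_list (map enc bs)) = Some (val_list (map enc (sort_by k bs)), tb)"
          "tb + 100 \<le> 60 * length bs * h + 120 * length bs" by blast
      have split_map: "split_list (map enc xs) = (map enc (fst (split_list xs)), map enc (snd (split_list xs)))" for xs
        by (induction xs) auto
      obtain ts where s: "ts \<le> 20 * length xs + 20"
        "app 0 (val_list (map enc xs)) = Some (VPair (val_list (map enc as)) (val_list (map enc bs)), ts)"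
        using calls_split[of "map enc xs"] unfolding split_map by (auto elim!: callsE simp: as_def bs_def)
      have sorted: "sort_by k xs = merge_by k (sort_by k as) (sort_by k bs)"
        using False by (simp add: sort_by.simps[of k xs] as_def bs_def)
      obtain tm where m: "tm \<le> 40 * length xs + 20"
        "app 1 (VPair (val_list (map enc (sort_by k as))) (val_list (map enc (sort_by k bs)))) =
          Some (val_list (map enc (sort_by k xs)), tm)"
        using calls_merge[of k p "sort_by k as" "sort_by k bs"]
        by (auto elim!: callsE simp: enc_def sorted len)
      \<comment> \<open>One level of the recursion costs 20 per element for splitting and 40 for
        merging, which is the factor 60.\<close>
      have "60 * length xs * Suc h = 60 * length as * h + 60 * length bs * h + 60 * length xs"
        by (simp add: len[symmetric] algebra_simps)
      then show ?thesis
        using a(2) b(2) s(1) m(1) len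
          s(2)[unfolded xs list.map val_list_simps] a(1) b(1) m(2)
        by (subst app_simps) (simp add: xs sort_e_def exec cong: bind_weak_cong)
    qed
  qed
  show ?thesis
  proof (cases "xs = []")
    case True
    then show ?thesis
      unfolding calls_def app_simps by (simp add: sort_e_def exec sort_by.simps cong: bind_weak_cong)
  next
    case False
    from main[OF this assms(2)] show ?thesis
      by (auto simp: calls_def)
  qed
qed

section \<open>Encodings, and cutting off one group\<close>

definition bool_val :: "bool \<Rightarrow> val" where
  "bool_val b = (if b then VPair VNil VNil else VNil)"

definition num_vals :: "nat list \<Rightarrow> val" where
  "num_vals ns = val_list (map (\<lambda>n. VNum (real n)) ns)"

lemma num_vals_simps [simp]:
  "num_vals [] = VNil"
  "num_vals (n # ns) = VPair (VNum (real n)) (num_vals ns)"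
  by (simp_all add: num_vals_def)

definition del_val :: "instance_nc \<Rightarrow> nat \<Rightarrow> val" where
  "del_val I j = VPair (VNum (del_start I j))
     (VPair (VNum (real j)) (VPair (VNum (del_end I j)) (VNum (del_cost I j))))"

definition sts_val :: "instance_nc \<Rightarrow> nat \<Rightarrow> val" where
  "sts_val I l = val_list (map (\<lambda>l. VPair (VNum (st_start I l)) (VNum (st_end I l))) [l..<num_st I + 1])"

definition prev_val :: "instance_nc \<Rightarrow> nat \<Rightarrow> val" where
  "prev_val I l = (if 2 \<le> l then VPair (VNum (st_end I (l - 1))) VNil else VNil)"

text \<open>Serves two tests: applied to the start of a delivery it tells where group
  \<open>l\<close> ends, applied to the end of a delivery of the group it recognizes the last
  one.\<close>

definition past :: "instance_nc \<Rightarrow> nat \<Rightarrow> real \<Rightarrow> bool" where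
  "past I l x \<longleftrightarrow> l \<le> num_st I \<and> st_start I l \<le> x"

definition early :: "instance_nc \<Rightarrow> nat \<Rightarrow> real \<Rightarrow> bool" where
  "early I l x \<longleftrightarrow> 2 \<le> l \<and> x \<le> st_end I (l - 1)"

definition item_val :: "instance_nc \<Rightarrow> nat \<Rightarrow> nat \<Rightarrow> val" where
  "item_val I l j = VPair (VNum (- del_cost I j)) (VPair (VNum (real j))
     (VPair (bool_val (early I l (del_start I j))) (bool_val (past I l (del_end I j)))))"

lemma sts_val_Cons: "l \<le> num_st I \<Longrightarrow> sts_val I l = VPair (VPair (VNum (st_start I l)) (VNum (st_end I l))) (sts_val I (Suc l))"
  by (simp add: sts_val_def upt_conv_Cons del: upt_Suc)

lemma sts_val_Nil: "\<not> l \<le> num_st I \<Longrightarrow> sts_val I l = VNil"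
  by (simp add: sts_val_def)

lemma calls_number:
  assumes "m \<le> n"
  shows "calls 3 (VPair (val_list (map (\<lambda>j. VPair (VNum (del_start I j)) (VPair (VNum (del_end I j)) (VNum (del_cost I j)))) [m..<n])) (VNum (real m)))
    (val_list (map (del_val I) [m..<n])) (40 * length [m..<n] + 40)"
  using assms
proof (induction rule: inc_induct)
  case base
  show ?case
    unfolding calls_def app_simps by (simp add: number_e_def exec cong: bind_weak_cong)
next
  case (step m)
  then show ?case
    by (elim callsE, subst calls_def, subst app_simps)
      (simp add: number_e_def exec upt_conv_Cons del_val_def[abs_def] add.commute cong: bind_weak_cong)
qed

lemma calls_past: "calls 4 (VPair (sts_val I l) (VNum x)) (bool_val (past I l x)) 20"
  unfolding calls_def app_simps
  by (cases "l \<le> num_st I")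
    (simp_all add: past_e_def exec sts_val_Cons sts_val_Nil past_def bool_val_def cong: bind_weak_cong)

lemma calls_early: "calls 5 (VPair (prev_val I l) (VNum x)) (bool_val (early I l x)) 20"
  unfolding calls_def app_simps
  by (cases "2 \<le> l")
    (simp_all add: early_e_def exec prev_val_def early_def bool_val_def cong: bind_weak_cong)

text \<open>The cost depends only on the prefix that is cut off, because the remaining list is
  handed on unread except for its head. This is what makes the total over all groups linear.\<close>

lemma calls_take:
  fixes I l
  defines "P \<equiv> \<lambda>j. \<not> past I l (del_start I j)"
  shows "calls 6 (VPair (val_list (map (del_val I) js)) (VPair (sts_val I l) (prev_val I l)))
    (VPair (val_list (map (item_val I l) (takeWhile P js))) (val_list (map (del_val I) (dropWhile P js))))
    (200 * length (takeWhile P js) + 100)"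
proof (induction js)
  case Nil
  show ?case
    unfolding calls_def app_simps by (simp add: take_e_def exec cong: bind_weak_cong)
next
  case (Cons j js)
  note calls = calls_past[of I l "del_start I j"] calls_past[of I l "del_end I j"]
    calls_early[of I l "del_start I j"]
  show ?case
  proof (cases "P j")
    case True
    then have "\<not> past I l (del_start I j)" by (simp add: P_def)
    with Cons calls True show ?thesis
      by (elim callsE, subst calls_def, subst app_simps)
        (simp add: take_e_def exec del_val_def[abs_def] item_val_def[abs_def] bool_val_def[of False] cong: bind_weak_cong)
  next
    case False
    then have "past I l (del_start I j)" by (simp add: P_def)
    with calls False show ?thesis
      by (elim callsE, subst calls_def, subst app_simps)
        (simp add: take_e_def exec del_val_def[abs_def] bool_val_def[of True] cong: bind_weak_cong)
  qed
qed

lemma calls_length: "calls 7 (val_list vs) (VNum (real (length vs))) (10 * length vs + 10)"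
proof (induction vs)
  case Nil
  show ?case
    unfolding calls_def app_simps by (simp add: length_e_def exec cong: bind_weak_cong)
next
  case (Cons v vs)
  then show ?case
    by (elim callsE, subst calls_def, subst app_simps)
      (simp add: length_e_def exec cong: bind_weak_cong)
qed

section \<open>First fit by a tournament tree\<close>

datatype tree = Leaf "nat list" | Node tree tree

fun room :: "real \<Rightarrow> (nat \<Rightarrow> real) \<Rightarrow> tree \<Rightarrow> real" where
  "room B c (Leaf js) = B - sum_list (map c js)"
| "room B c (Node a b) = max (room B c a) (room B c b)"

fun insert_tree :: "real \<Rightarrow> (nat \<Rightarrow> real) \<Rightarrow> nat \<Rightarrow> tree \<Rightarrow> tree" where
  "insert_tree B c j (Leaf js) = Leaf (j # js)"
| "insert_tree B c j (Node a b) =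
     (if c j \<le> room B c a then Node (insert_tree B c j a) b else Node a (insert_tree B c j b))"

fun leaves :: "tree \<Rightarrow> nat list list" where
  "leaves (Leaf js) = [js]"
| "leaves (Node a b) = leaves a @ leaves b"

fun depth :: "tree \<Rightarrow> nat" where
  "depth (Leaf js) = 0"
| "depth (Node a b) = Suc (max (depth a) (depth b))"

fun empty_tree :: "nat \<Rightarrow> tree" where
  "empty_tree 0 = Leaf []"
| "empty_tree (Suc h) = Node (empty_tree h) (empty_tree h)"

lemma leaves_empty_tree: "leaves (empty_tree h) = replicate (2 ^ h) []"
  by (induction h) (simp_all add: mult_2 replicate_add)

lemma depth_empty_tree [simp]: "depth (empty_tree h) = h"
  by (induction h) auto

lemma depth_insert_tree [simp]: "depth (insert_tree B c j t) = depth t"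
  by (induction t) auto

lemma depth_fold_insert_tree [simp]: "depth (fold (insert_tree B c) js t) = depth t"
  by (induction js arbitrary: t) auto

fun put :: "real \<Rightarrow> (nat \<Rightarrow> real) \<Rightarrow> nat \<Rightarrow> nat list list \<Rightarrow> nat list list" where
  "put B c j [] = [[j]]"
| "put B c j (b # bs) = (if sum_list (map c b) + c j \<le> B then (j # b) # bs else b # put B c j bs)"

lemma le_room_iff: "x \<le> room B c t \<longleftrightarrow> (\<exists>b\<in>set (leaves t). sum_list (map c b) + x \<le> B)"
  by (induction t) (auto simp: le_max_iff_disj algebra_simps)

lemma put_append:
  "put B c j (as @ bs) =
     (if \<exists>b\<in>set as. sum_list (map c b) + c j \<le> B then put B c j as @ bs else as @ put B c j bs)"
  by (induction as) auto

text \<open>The condition is essential: an item that fits nowhere would be forced into the rightmost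
  leaf, whereas \<open>put\<close> would open a block.\<close>

lemma leaves_insert_tree:
  "c j \<le> room B c t \<Longrightarrow> leaves (insert_tree B c j t) = put B c j (leaves t)"
proof (induction t)
  case (Node a b)
  show ?case
  proof (cases "c j \<le> room B c a")
    case True
    with Node show ?thesis by (simp add: put_append flip: le_room_iff)
  next
    case False
    with Node.prems have "c j \<le> room B c b" by simp
    with Node False show ?thesis by (simp add: put_append flip: le_room_iff)
  qed
qed auto

lemma length_put: "length (put B c j bs) \<le> Suc (length bs)"
  by (induction bs) auto

text \<open>Opening a block is the same as filling the first padding leaf, which accepts every item
  of cost at most \<open>B\<close>.\<close>

lemma put_replicate:
  assumes "c j \<le> B" "length bs < n"
  shows "put B c j (bs @ replicate (n - length bs) []) =
    put B c j bs @ replicate (n - length (put B c j bs)) []"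
proof (cases "\<exists>b\<in>set bs. sum_list (map c b) + c j \<le> B")
  case True
  then have "length (put B c j bs) = length bs"
    by (induction bs) auto
  with True show ?thesis by (simp add: put_append)
next
  case False
  then have "put B c j bs = bs @ [[j]]"
    by (induction bs) auto
  moreover have "replicate (n - length bs) ([] :: nat list) = [] # replicate (n - Suc (length bs)) []"
    using assms(2) by (metis Suc_diff_Suc replicate_Suc)
  ultimately show ?thesis using False assms(1) by (simp add: put_append)
qed

text \<open>Each item opens at most one block, so as long as an item is waiting there is still an
  empty leaf.\<close>

lemma leaves_fold_insert_tree:
  assumes "\<And>j. j \<in> set js \<Longrightarrow> c j \<le> B" "leaves t = bs @ replicate (n - length bs) []"
    "length bs + length js \<le> n"
  shows "leaves (fold (insert_tree B c) js t) =
    fold (put B c) js bs @ replicate (n - length (fold (put B c) js bs)) []"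
  using assms
proof (induction js arbitrary: t bs)
  case (Cons j js)
  have "[] \<in> set (leaves t)"
    using Cons.prems(2,3) by simp
  then have "c j \<le> room B c t"
    using Cons.prems(1)[of j] by (force simp: le_room_iff)
  then have "leaves (insert_tree B c j t) = put B c j bs @ replicate (n - length (put B c j bs)) []"
    using Cons.prems put_replicate[of c j B bs n] by (simp add: leaves_insert_tree)
  moreover have "length (put B c j bs) + length js \<le> n"
    using Cons.prems(3) length_put[of B c j bs] by simp
  ultimately show ?case
    using Cons.IH[of "insert_tree B c j t" "put B c j bs"] Cons.prems(1) by simp
qed simp

lemma Nil_notin_put: "[] \<notin> set bs \<Longrightarrow> [] \<notin> set (put B c j bs)"
  by (induction bs) auto

lemma Nil_notin_fold_put: "[] \<notin> set bs \<Longrightarrow> [] \<notin> set (fold (put B c) js bs)"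
  by (induction js arbitrary: bs) (auto simp: Nil_notin_put)

lemma mset_concat_put: "mset (concat (put B c j bs)) = add_mset j (mset (concat bs))"
  by (induction bs) auto

lemma mset_concat_fold_put: "mset (concat (fold (put B c) js bs)) = mset js + mset (concat bs)"
  by (induction js arbitrary: bs) (auto simp: mset_concat_put)

lemma map_set_put:
  "\<forall>b\<in>set bs. distinct b \<Longrightarrow> map set (put B c j bs) = place B c j (map set bs)"
  by (induction bs) (auto simp: sum_list_distinct_conv_sum_set)

lemma distinct_concatD: "distinct (concat bs) \<Longrightarrow> b \<in> set bs \<Longrightarrow> distinct b"
  by (induction bs) auto

text \<open>Passes from lists to the sets of \<open>place\<close>; without repetitions, the sum over
  a block as a list is the sum over it as a set.\<close>

lemma map_set_fold_put:
  assumes "distinct (concat bs @ js)"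
  shows "map set (fold (put B c) js bs) = fold (place B c) js (map set bs)"
  using assms
proof (induction js arbitrary: bs)
  case (Cons j js)
  have "distinct (concat (put B c j bs) @ js)"
    using Cons.prems mset_eq_imp_distinct_iff[of "concat (put B c j bs) @ js" "concat bs @ j # js"]
    by (simp add: mset_concat_put)
  moreover have "map set (put B c j bs) = place B c j (map set bs)"
    using Cons.prems by (intro map_set_put) (auto intro: distinct_concatD)
  ultimately show ?case
    using Cons.IH[of "put B c j bs"] by simp
qed simp

definition bin_val :: "instance_nc \<Rightarrow> nat \<Rightarrow> nat list \<Rightarrow> val" where
  "bin_val I l js = VPair (bool_val (\<exists>j\<in>set js. early I l (del_start I j)))
     (VPair (bool_val (\<exists>j\<in>set js. past I l (del_end I j))) (num_vals js))"

fun tree_val :: "instance_nc \<Rightarrow> nat \<Rightarrow> tree \<Rightarrow> val" where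
  "tree_val I l (Leaf js) =
     VPair (VNum (room (cap I) (del_cost I) (Leaf js))) (VPair VNil (bin_val I l js))"
| "tree_val I l (Node a b) =
     VPair (VNum (room (cap I) (del_cost I) (Node a b))) (VPair (VPair (tree_val I l a) (tree_val I l b)) VNil)"

lemma tree_val_room:
  obtains v where "tree_val I l t = VPair (VNum (room (cap I) (del_cost I) t)) v"
  by (cases t) auto

lemma calls_node: "calls 10 (VPair (tree_val I l a) (tree_val I l b)) (tree_val I l (Node a b)) 30"
proof -
  obtain v w where "tree_val I l a = VPair (VNum (room (cap I) (del_cost I) a)) v"
    "tree_val I l b = VPair (VNum (room (cap I) (del_cost I) b)) w"
    by (metis tree_val_room)
  then show ?thesis
    by (subst calls_def, subst app_simps)
      (simp add: node_e_def exec max_def cong: bind_weak_cong)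
qed

text \<open>The number \<open>k\<close> only bounds the doublings still to come. The final
  disjunction says that the tree has at most twice as many leaves as needed, so that flattening it
  stays linear.\<close>

lemma calls_grow:
  assumes "n \<le> 2 ^ (h + k)"
  shows "\<exists>h'. calls 8 (VPair (VNum (real n)) (VPair (VNum (2 ^ h)) (tree_val I l (empty_tree h))))
      (tree_val I l (empty_tree h')) (60 * (h' - h) + 60) \<and>
    h \<le> h' \<and> h' \<le> h + k \<and> n \<le> 2 ^ h' \<and> (h' = h \<or> 2 ^ h' \<le> 2 * n)"
  using assms
proof (induction k arbitrary: h)
  case 0
  then have "real n \<le> 2 ^ h" by (simp flip: of_nat_le_iff)
  with 0 show ?case
    by (intro exI[of _ h] conjI; (subst calls_def, subst app_simps)?)
      (simp_all add: grow_e_def exec cong: bind_weak_cong)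
next
  case (Suc k)
  show ?case
  proof (cases "n \<le> 2 ^ h")
    case True
    then have "real n \<le> 2 ^ h" by (simp flip: of_nat_le_iff)
    with True show ?thesis
      by (intro exI[of _ h] conjI; (subst calls_def, subst app_simps)?)
        (simp_all add: grow_e_def exec cong: bind_weak_cong)
  next
    case False
    then have gt: "\<not> real n \<le> 2 ^ h"
      by (metis of_nat_le_iff of_nat_numeral of_nat_power)
    from Suc.IH[of "Suc h"] Suc.prems obtain h' where h':
      "calls 8 (VPair (VNum (real n)) (VPair (VNum (2 ^ Suc h)) (tree_val I l (empty_tree (Suc h)))))
        (tree_val I l (empty_tree h')) (60 * (h' - Suc h) + 60)"
      "Suc h \<le> h'" "h' \<le> Suc h + k" "n \<le> 2 ^ h'" "h' = Suc h \<or> 2 ^ h' \<le> 2 * n" by auto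
    have "calls 8 (VPair (VNum (real n)) (VPair (VNum (2 ^ h)) (tree_val I l (empty_tree h))))
      (tree_val I l (empty_tree h')) (60 * (h' - h) + 60)"
      using calls_node[of I l "empty_tree h" "empty_tree h"] h'(1,2) gt
      by (elim callsE, subst calls_def, subst app_simps)
        (simp add: grow_e_def exec cong: bind_weak_cong)
    with h' False show ?thesis
      by (intro exI[of _ h']) auto
  qed
qed

text \<open>Each level costs one comparison on the way down and one call of \<open>node_c\<close> on
  the way up, which refreshes the stored maximum.\<close>

lemma calls_insert:
  "calls 9 (VPair (item_val I l j) (tree_val I l t))
    (tree_val I l (insert_tree (cap I) (del_cost I) j t)) (100 * depth t + 100)"
proof (induction t)
  case (Leaf js)
  show ?case
    by (subst calls_def, subst app_simps)
      (simp add: insert_e_def exec item_val_def bin_val_def bool_val_def algebra_simps cong: bind_weak_cong)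
next
  case (Node a b)
  obtain v where v: "tree_val I l a = VPair (VNum (room (cap I) (del_cost I) a)) v"
    by (metis tree_val_room)
  note node = calls_node[of I l "insert_tree (cap I) (del_cost I) j a" b]
    calls_node[of I l a "insert_tree (cap I) (del_cost I) j b"]
  show ?case
  proof (cases "del_cost I j \<le> room (cap I) (del_cost I) a")
    case True
    with Node node v show ?thesis
      by (elim callsE, subst calls_def, subst app_simps)
        (simp add: insert_e_def exec item_val_def cong: bind_weak_cong)
  next
    case False
    with Node node v show ?thesis
      by (elim callsE, subst calls_def, subst app_simps)
        (simp add: insert_e_def exec item_val_def cong: bind_weak_cong)
  qed
qed

lemma calls_pack:
  "calls 11 (VPair (val_list (map (item_val I l) js)) (tree_val I l t))
    (tree_val I l (fold (insert_tree (cap I) (del_cost I)) js t)) (length js * (100 * depth t + 150) + 20)"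
proof (induction js arbitrary: t)
  case Nil
  show ?case
    by (subst calls_def, subst app_simps) (simp add: pack_e_def exec cong: bind_weak_cong)
next
  case (Cons j js)
  from Cons[of "insert_tree (cap I) (del_cost I) j t"] calls_insert[of I l j t] show ?case
    by (elim callsE, subst calls_def, subst app_simps)
      (simp add: pack_e_def exec cong: bind_weak_cong)
qed

text \<open>There is one inner node less than there are leaves: the two subtrees contribute -30
  twice, and one of these pays for the root.\<close>

lemma calls_flat:
  "calls 12 (VPair (tree_val I l t) (val_list vs))
    (val_list (map (bin_val I l) (filter (\<lambda>js. js \<noteq> []) (leaves t)) @ vs)) (70 * length (leaves t) - 30)"
proof (induction t arbitrary: vs)
  case (Leaf js)
  show ?case
    by (cases js; subst calls_def, subst app_simps)
      (simp_all add: flat_e_def exec bin_val_def cong: bind_weak_cong)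
next
  case (Node a b)
  \<comment> \<open>Keeps the subtraction of 30 on natural numbers from being truncated.\<close>
  have "\<exists>n. length (leaves t) = Suc n" for t by (induction t) auto
  then obtain m n where "length (leaves a) = Suc m" "length (leaves b) = Suc n" by blast
  with Node(2)[of vs]
    Node(1)[of "map (bin_val I l) (filter (\<lambda>js. js \<noteq> []) (leaves b)) @ vs"] show ?case
    by (elim callsE, subst calls_def, subst app_simps)
      (simp add: flat_e_def exec cong: bind_weak_cong)
qed

section \<open>Assigning the blocks of a group to drones\<close>

definition pair_val :: "nat \<times> nat \<Rightarrow> val" where
  "pair_val p = VPair (VNum (real (fst p))) (VNum (real (snd p)))"

lemma calls_emit:
  "calls 13 (VPair (num_vals js) (VPair (VNum (real d)) (val_list (map pair_val ps))))
    (val_list (map pair_val (rev (map (\<lambda>j. (j, d)) js) @ ps))) (40 * length js + 20)"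
proof (induction js arbitrary: ps)
  case Nil
  show ?case
    by (subst calls_def, subst app_simps) (simp add: emit_e_def exec cong: bind_weak_cong)
next
  case (Cons j js)
  from Cons[of "(j, d) # ps"] show ?case
    by (elim callsE, subst calls_def, subst app_simps)
      (simp add: emit_e_def exec pair_val_def[of "(j, d)"] cong: bind_weak_cong)
qed

definition step_drone :: "nat \<Rightarrow> nat \<Rightarrow> nat \<Rightarrow> nat" where
  "step_drone a f k = (if k = a \<or> k = f then Suc k else k)"

lemma calls_step:
  "calls 14 (VPair (VNum (real k)) (VPair (VNum (real a)) (VNum (real f))))
    (VNum (real (step_drone a f k))) 20"
  by (subst calls_def, subst app_simps)
    (auto simp add: step_e_def exec step_drone_def cong: bind_weak_cong)

text \<open>The least number from \<open>k\<close> on outside \<open>{a, f}\<close>. Leaving one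
  forbidden number may run into the other, hence two rounds.\<close>

definition skip :: "nat \<Rightarrow> nat \<Rightarrow> nat \<Rightarrow> nat" where
  "skip a f k = step_drone a f (step_drone a f k)"

fun drones :: "('b \<Rightarrow> bool) \<Rightarrow> nat \<Rightarrow> nat \<Rightarrow> nat \<Rightarrow> 'b list \<Rightarrow> nat list" where
  "drones F a f k [] = []"
| "drones F a f k (b # bs) = (if F b then f else skip a f k) # drones F a f (Suc (skip a f k)) bs"

fun next_first :: "('b \<Rightarrow> bool) \<Rightarrow> nat \<Rightarrow> nat \<Rightarrow> nat \<Rightarrow> nat \<Rightarrow> 'b list \<Rightarrow> nat" where
  "next_first F a f k g [] = g"
| "next_first F a f k g (b # bs) =
     next_first F a f (Suc (skip a f k)) (if F b then skip a f k else g) bs"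

fun emitted :: "(nat list \<times> nat) list \<Rightarrow> (nat \<times> nat) list" where
  "emitted [] = []"
| "emitted ((js, d) # zs) = emitted zs @ rev (map (\<lambda>j. (j, d)) js)"

lemma calls_assign:
  fixes I l a f
  defines "F \<equiv> \<lambda>js. \<exists>j\<in>set js. early I l (del_start I j)"
  defines "L \<equiv> \<lambda>js. \<exists>j\<in>set js. past I l (del_end I j)"
  defines "zs k bs \<equiv> zip bs (drones F a f k bs)"
  shows "calls 15 (VPair (val_list (map (bin_val I l) bs)) (VPair (VNum (real k))
      (VPair (VPair (VNum (real a)) (VNum (real f))) (VPair (VNum (real g))
        (VPair (num_vals la) (VPair (num_vals ch) (val_list (map pair_val ps))))))))
    (VPair (VNum (real (next_first F a f k g bs)))
      (VPair (num_vals (rev (map snd (filter (\<lambda>z. L (fst z)) (zs k bs))) @ la))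
        (VPair (num_vals (rev (map snd (filter (\<lambda>z. \<not> L (fst z)) (zs k bs))) @ ch))
          (val_list (map pair_val (emitted (zs k bs) @ ps))))))
    (300 * length bs + 40 * length (concat bs) + 20)"
proof (induction bs arbitrary: k g la ch ps)
  case Nil
  show ?case
    by (subst calls_def, subst app_simps) (simp add: assign_e_def exec zs_def cong: bind_weak_cong)
next
  case (Cons b bs)
  define q where "q = skip a f k"
  define d where "d = (if F b then f else q)"
  \<comment> \<open>The induction hypothesis with the counter in the form \<open>real q + 1\<close>
    that the machine computes.\<close>
  have assign: "calls 15 (VPair (val_list (map (bin_val I l) bs)) (VPair (VNum (real q + 1))
      (VPair (VPair (VNum (real a)) (VNum (real f))) (VPair (VNum (real (if F b then q else g)))
        (VPair (num_vals la') (VPair (num_vals ch') (val_list (map pair_val ps'))))))))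
    (VPair (VNum (real (next_first F a f (Suc q) (if F b then q else g) bs)))
      (VPair (num_vals (rev (map snd (filter (\<lambda>z. L (fst z)) (zs (Suc q) bs))) @ la'))
        (VPair (num_vals (rev (map snd (filter (\<lambda>z. \<not> L (fst z)) (zs (Suc q) bs))) @ ch'))
          (val_list (map pair_val (emitted (zs (Suc q) bs) @ ps'))))))
    (300 * length bs + 40 * length (concat bs) + 20)" for la' ch' ps'
    using Cons[of "Suc q" "if F b then q else g" la' ch' ps'] by (simp only: of_nat_Suc add.commute)
  note emit = calls_emit[of b d ps]
  have q: "step_drone a f (step_drone a f k) = q" by (simp add: q_def skip_def)
  have zs: "zs k (b # bs) = (b, d) # zs (Suc q) bs"
    by (simp add: zs_def q_def d_def)
  have nf: "next_first F a f k g (b # bs) = next_first F a f (Suc q) (if F b then q else g) bs"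
    by (simp add: q_def)
  have bin: "bin_val I l b = VPair (bool_val (F b)) (VPair (bool_val (L b)) (num_vals b))"
    by (simp add: bin_val_def F_def L_def)
  note steps = calls_step[of k a f] calls_step[of "step_drone a f k" a f, unfolded q]
  show ?case
  proof (cases "L b")
    case True
    with assign[of "d # la" ch "rev (map (\<lambda>j. (j, d)) b) @ ps"] emit steps show ?thesis
      unfolding zs nf list.map bin val_list_simps
      by (elim callsE, cases "F b"; subst calls_def, subst app_simps)
        (simp_all add: assign_e_def exec d_def bool_val_def cong: bind_weak_cong)
  next
    case False
    with assign[of la "d # ch" "rev (map (\<lambda>j. (j, d)) b) @ ps"] emit steps show ?thesis
      unfolding zs nf list.map bin val_list_simps
      by (elim callsE, cases "F b"; subst calls_def, subst app_simps)
        (simp_all add: assign_e_def exec d_def bool_val_def cong: bind_weak_cong)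
  qed
qed

definition first_bin :: "instance_nc \<Rightarrow> nat \<Rightarrow> nat list \<Rightarrow> bool" where
  "first_bin I l js \<longleftrightarrow> (\<exists>j\<in>set js. early I l (del_start I j))"

definition last_bin :: "instance_nc \<Rightarrow> nat \<Rightarrow> nat list \<Rightarrow> bool" where
  "last_bin I l js \<longleftrightarrow> (\<exists>j\<in>set js. past I l (del_end I j))"

definition pack :: "instance_nc \<Rightarrow> nat list \<Rightarrow> nat list list" where
  "pack I js = fold (put (cap I) (del_cost I)) (sort_by (\<lambda>j. - del_cost I j) js) []"

text \<open>Without a last drone, \<open>a\<close> defaults to the reserved drone \<open>f\<close>,
  so that \<open>{a, f}\<close> forbids nothing more than \<open>f\<close>.\<close>

definition head_or :: "nat \<Rightarrow> nat list \<Rightarrow> nat" where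
  "head_or f la = (case la of [] \<Rightarrow> f | d # _ \<Rightarrow> d)"

lemma mset_concat_pack: "mset (concat (pack I js)) = mset js"
  by (simp add: pack_def mset_concat_fold_put)

lemma Nil_notin_pack: "[] \<notin> set (pack I js)"
  by (simp add: pack_def Nil_notin_fold_put)

lemma length_pack: "length (pack I js) \<le> length js"
proof -
  have "length bs \<le> length (concat bs)" if "[] \<notin> set bs" for bs :: "nat list list"
    using that
  proof (induction bs)
    case (Cons b bs)
    then show ?case by (cases b) auto
  qed simp
  from this[OF Nil_notin_pack] show ?thesis
    by (metis mset_concat_pack size_mset)
qed

lemma calls_group:
  fixes I :: instance_nc and l f :: nat and la :: "nat list"
  assumes "length js \<le> 2 ^ K" and cost: "\<forall>j\<in>set js. del_cost I j \<le> cap I"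
  defines "bs \<equiv> pack I js"
  defines "zs \<equiv> zip bs (drones (first_bin I l) (head_or f la) f 0 bs)"
  shows "calls 16 (VPair (VNum (cap I)) (VPair (val_list (map (item_val I l) js))
      (VPair (VNum (real f)) (VPair (num_vals la) (val_list (map pair_val ps))))))
    (VPair (VNum (real (length bs)))
      (VPair (VNum (real (next_first (first_bin I l) (head_or f la) f 0 f bs)))
        (VPair (num_vals (rev (map snd (filter (\<lambda>z. last_bin I l (fst z)) zs))))
          (VPair (num_vals (rev (map snd (filter (\<lambda>z. \<not> last_bin I l (fst z)) zs)) @ la))
            (val_list (map pair_val (emitted zs @ ps)))))))
    (160 * length js * K + 900 * length js + 500)"
proof -
  define n where "n = length js"
  define ys where "ys = sort_by (\<lambda>j. - del_cost I j) js"
  define enc where "enc = item_val I l"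
  have n: "length (sort_by (\<lambda>j. - del_cost I j) js) = n" "length js = n" by (simp_all add: n_def)
  have keyed: "item_val I l = keyed (\<lambda>j. - del_cost I j) (\<lambda>j. VPair (VNum (real j))
     (VPair (bool_val (early I l (del_start I j))) (bool_val (past I l (del_end I j)))))"
    by (auto simp: item_val_def keyed_def)
  obtain t1 where t1: "t1 \<le> 60 * n * K + 120 * n + 20"
    "app 2 (val_list (map enc js)) = Some (val_list (map enc ys), t1)"
    using calls_sort[OF assms(1), of "\<lambda>j. - del_cost I j"] unfolding enc_def keyed ys_def n
    by (blast elim: callsE)
  obtain t2 where t2: "t2 \<le> 10 * n + 10" "app 7 (val_list (map enc js)) = Some (VNum (real n), t2)"
    using calls_length[of "map enc js"] by (auto elim!: callsE simp: n_def)
  obtain h where h: "calls 8 (VPair (VNum (real n)) (VPair (VNum 1) (tree_val I l (empty_tree 0))))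
      (tree_val I l (empty_tree h)) (60 * h + 60)"
    "h \<le> K" "n \<le> 2 ^ h" "h = 0 \<or> 2 ^ h \<le> 2 * n"
    using calls_grow[of n 0 K I l] assms(1) by (auto simp: n_def)
  have empty: "tree_val I l (empty_tree 0) =
      VPair (VNum (cap I)) (VPair VNil (VPair VNil (VPair VNil VNil)))"
    by (simp add: bin_val_def bool_val_def)
  obtain t3 where t3: "t3 \<le> 60 * h + 60" "app 8 (VPair (VNum (real n)) (VPair (VNum 1)
      (VPair (VNum (cap I)) (VPair VNil (VPair VNil (VPair VNil VNil)))))) = Some (tree_val I l (empty_tree h), t3)"
    using h(1) unfolding empty by (blast elim: callsE)
  define t where "t = fold (insert_tree (cap I) (del_cost I)) ys (empty_tree h)"
  obtain t4 where t4: "t4 \<le> n * (100 * h + 150) + 20"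
    "app 11 (VPair (val_list (map enc ys)) (tree_val I l (empty_tree h))) = Some (tree_val I l t, t4)"
    using calls_pack[of I l ys "empty_tree h"] unfolding enc_def ys_def n t_def depth_empty_tree
    by (blast elim: callsE)
  have "bs = fold (put (cap I) (del_cost I)) ys []"
    by (simp add: bs_def pack_def ys_def)
  then have leaves: "leaves t = bs @ replicate (2 ^ h - length bs) []"
    using leaves_fold_insert_tree[of ys "del_cost I" "cap I" "empty_tree h" "[]" "2 ^ h"] cost h(3)
    by (simp add: t_def leaves_empty_tree ys_def n)
  have len: "length bs \<le> n" "length (concat bs) = n"
    using length_pack[of I js] mset_concat_pack[of I js] by (auto simp: bs_def n_def dest: mset_eq_length)
  have "length (leaves t) = 2 ^ h"
    using len(1) h(3) by (simp add: leaves)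
  moreover have "filter (\<lambda>js. js \<noteq> []) (leaves t) = bs"
    using Nil_notin_pack[of I js] by (auto simp: leaves bs_def intro!: filter_True)
  ultimately obtain t5 where t5: "t5 \<le> 70 * 2 ^ h"
    "app 12 (VPair (tree_val I l t) VNil) = Some (val_list (map (bin_val I l) bs), t5)"
    using calls_mono[OF calls_flat[of I l t "[]"], of "70 * 2 ^ h"] by (auto elim!: callsE)
  obtain t6 where t6: "t6 \<le> 10 * n + 10"
    "app 7 (val_list (map (bin_val I l) bs)) = Some (VNum (real (length bs)), t6)"
    using calls_length[of "map (bin_val I l) bs"] len(1) by (auto elim!: callsE)
  obtain t7 where t7: "t7 \<le> 340 * n + 20"
    "app 15 (VPair (val_list (map (bin_val I l) bs)) (VPair (VNum 0)
      (VPair (VPair (VNum (real (head_or f la))) (VNum (real f))) (VPair (VNum (real f))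
        (VPair VNil (VPair (num_vals la) (val_list (map pair_val ps)))))))) =
    Some (VPair (VNum (real (next_first (first_bin I l) (head_or f la) f 0 f bs)))
        (VPair (num_vals (rev (map snd (filter (\<lambda>z. last_bin I l (fst z)) zs))))
          (VPair (num_vals (rev (map snd (filter (\<lambda>z. \<not> last_bin I l (fst z)) zs)) @ la))
            (val_list (map pair_val (emitted zs @ ps))))), t7)"
    using calls_assign[of I l bs 0 "head_or f la" f f "[]" la ps] len
    by (auto elim!: callsE simp: zs_def first_bin_def[abs_def] last_bin_def[abs_def])
  \<comment> \<open>The summand 1 covers an empty group, whose tree is a single leaf. Sorting (60)
    and insertion (100) give the 160 in front of \<open>n * K\<close>; growing and flattening the
    tree are linear.\<close>
  have "n * h \<le> n * K" "2 ^ h \<le> 2 * n + 1" "h < 2 ^ h"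
    using h(2,4) by auto
  moreover have "t1 \<le> 60 * (n * K) + 120 * n + 20" "t4 \<le> 100 * (n * h) + 150 * n + 20"
    using t1(1) t4(1) by (simp_all add: algebra_simps)
  ultimately have "t1 + t2 + t3 + t4 + t5 + t6 + t7 + 100 \<le> 160 * (n * K) + 900 * n + 500"
    using t2(1) t3(1) t5(1) t6(1) t7(1) by linarith
  then have bound: "t1 + t2 + t3 + t4 + t5 + t6 + t7 + 100 \<le> 160 * n * K + 900 * n + 500"
    by (simp only: mult.assoc)
  show ?thesis
    using t1(2) t2(2) t3(2) t4(2) t5(2) t6(2) t7(2) bound unfolding n enc_def
    by (cases la; subst calls_def, subst app_simps)
      (simp_all add: group_e_def exec head_or_def cong: bind_weak_cong)
qed

section \<open>The loop over the groups\<close>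

definition sorted_dels :: "instance_nc \<Rightarrow> nat list" where
  "sorted_dels I = sort_by (del_start I) [1..<num_del I + 1]"

definition rest :: "instance_nc \<Rightarrow> nat \<Rightarrow> nat list" where
  "rest I l = filter (\<lambda>j. 2 \<le> l \<longrightarrow> st_start I (l - 1) \<le> del_start I j) (sorted_dels I)"

definition group_list :: "instance_nc \<Rightarrow> nat \<Rightarrow> nat list" where
  "group_list I l = filter (\<lambda>j. j \<in> group_nc I l) (sorted_dels I)"

definition bins :: "instance_nc \<Rightarrow> nat \<Rightarrow> nat list list" where
  "bins I l = pack I (group_list I l)"

lemma set_sorted_dels [simp]: "set (sorted_dels I) = {1..num_del I}"
  by (auto simp: sorted_dels_def)

lemma takeWhile_sorted:
  "sorted (map f xs) \<Longrightarrow> takeWhile (\<lambda>x. \<not> a \<le> f x) xs = filter (\<lambda>x. \<not> a \<le> f x) xs"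
  for f :: "'a \<Rightarrow> real"
  by (induction xs) (auto simp: filter_empty_conv dest: order_trans intro!: filter_False[symmetric])

lemma dropWhile_sorted:
  "sorted (map f xs) \<Longrightarrow> dropWhile (\<lambda>x. \<not> a \<le> f x) xs = filter (\<lambda>x. a \<le> f x) xs"
  for f :: "'a \<Rightarrow> real"
proof (induction xs)
  case (Cons x xs)
  then show ?case
    by (auto simp: filter_id_conv) (metis order_trans filter_True)
qed simp

lemma sorted_rest: "sorted (map (del_start I) (rest I l))"
  unfolding rest_def sorted_dels_def by (intro sorted_filter sorted_sort_by)

lemma st_start_mono:
  assumes "ddp_nc I" "1 \<le> k" "k \<le> l" "l \<le> num_st I"
  shows "st_start I k \<le> st_start I l"
  using assms(3,4)
proof (induction rule: dec_induct)
  case (step l)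
  then have "st_start I l < st_end I l" "st_end I l < st_start I (Suc l)"
    using assms(1,2) by (auto simp: ddp_nc_def)
  with step show ?case by simp
qed simp

lemma rest_Suc:
  assumes "ddp_nc I" "1 \<le> l" "l \<le> num_st I"
  shows "dropWhile (\<lambda>j. \<not> past I l (del_start I j)) (rest I l) = rest I (Suc l)"
proof -
  have "dropWhile (\<lambda>j. \<not> past I l (del_start I j)) (rest I l) =
      filter (\<lambda>j. st_start I l \<le> del_start I j) (rest I l)"
    using assms dropWhile_sorted[OF sorted_rest[of I l]] by (simp add: past_def)
  also have "\<dots> = rest I (Suc l)"
    using assms st_start_mono[OF assms(1), of "l - 1" l]
    by (fastforce simp: rest_def intro!: filter_cong)
  finally show ?thesis .
qed

lemma takeWhile_rest:
  assumes "1 \<le> l" "l \<le> num_st I + 1"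
  shows "takeWhile (\<lambda>j. \<not> past I l (del_start I j)) (rest I l) = group_list I l"
proof -
  have "takeWhile (\<lambda>j. \<not> past I l (del_start I j)) (rest I l) =
      filter (\<lambda>j. \<not> past I l (del_start I j)) (rest I l)"
    using takeWhile_sorted[OF sorted_rest[of I l]] by (cases "l \<le> num_st I") (simp_all add: past_def)
  also have "\<dots> = group_list I l"
    using assms by (auto simp: rest_def group_list_def group_nc_def past_def intro!: filter_cong)
  finally show ?thesis .
qed

text \<open>
  \<open>state I l\<close>: the drone reserved for the first block of group \<open>l + 1\<close>, and the last drones of
  group \<open>l\<close>.
\<close>

primrec state :: "instance_nc \<Rightarrow> nat \<Rightarrow> nat \<times> nat list" where
  "state I 0 = (0, [])"
| "state I (Suc l) = (let (f, la) = state I l; bs = bins I (Suc l); a = head_or f la in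
     (next_first (first_bin I (Suc l)) a f 0 f bs,
      rev (map snd (filter (\<lambda>z. last_bin I (Suc l) (fst z))
        (zip bs (drones (first_bin I (Suc l)) a f 0 bs))))))"

text \<open>Indexed by the group that starts with this value, hence the shift against
  \<open>state\<close>.\<close>

definition spare :: "instance_nc \<Rightarrow> nat \<Rightarrow> nat" where
  "spare I l = fst (state I (l - 1))"

definition prev_last :: "instance_nc \<Rightarrow> nat \<Rightarrow> nat list" where
  "prev_last I l = snd (state I (l - 1))"

definition drone_list :: "instance_nc \<Rightarrow> nat \<Rightarrow> nat list" where
  "drone_list I l = drones (first_bin I l) (head_or (spare I l) (prev_last I l)) (spare I l) 0 (bins I l)"

definition charge_list :: "instance_nc \<Rightarrow> nat \<Rightarrow> nat list" where
  "charge_list I l = rev (map snd (filter (\<lambda>z. \<not> last_bin I l (fst z)) (zip (bins I l) (drone_list I l))))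
     @ prev_last I l"

definition emitted_from :: "instance_nc \<Rightarrow> nat \<Rightarrow> (nat \<times> nat) list" where
  "emitted_from I l = concat (map (\<lambda>k. emitted (zip (bins I k) (drone_list I k))) (rev [l..<num_st I + 2]))"

lemma emitted_from_Suc:
  "l \<le> num_st I + 1 \<Longrightarrow> emitted_from I l = emitted_from I (Suc l) @ emitted (zip (bins I l) (drone_list I l))"
  by (simp add: emitted_from_def upt_conv_Cons del: upt_Suc)

lemma emitted_from_Nil: "emitted_from I (num_st I + 2) = []"
  by (simp add: emitted_from_def)

lemma state_step:
  assumes "1 \<le> l"
  shows "spare I (Suc l) = next_first (first_bin I l) (head_or (spare I l) (prev_last I l)) (spare I l) 0 (spare I l) (bins I l)"
    and "prev_last I (Suc l) = rev (map snd (filter (\<lambda>z. last_bin I l (fst z)) (zip (bins I l) (drone_list I l))))"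
  using assms by (cases l; simp add: spare_def prev_last_def drone_list_def Let_def case_prod_beta)+

text \<open>The induction descends from the last group, where the recursion stops. The running
  maximum \<open>m\<close> and the collected pairs \<open>ps\<close> are accumulators and stay
  arbitrary. The 800 per group also pay for groups without deliveries.\<close>

lemma calls_stations:
  assumes ddp: "ddp_nc I" and K: "num_del I \<le> 2 ^ K" and l: "1 \<le> l" "l \<le> num_st I + 1"
  shows "calls 17 (VPair (VNum (cap I)) (VPair (val_list (map (del_val I) (rest I l)))
      (VPair (sts_val I l) (VPair (prev_val I l) (VPair (VNum (real (spare I l)))
        (VPair (num_vals (prev_last I l)) (VPair (VNum (real m)) (val_list (map pair_val ps)))))))))
    (VPair (VNum (real (Max (insert m ((\<lambda>k. length (bins I k)) ` {l..num_st I + 1})))))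
      (VPair (val_list (map pair_val (emitted_from I l @ ps)))
        (val_list (map (\<lambda>k. num_vals (charge_list I k)) [l..<num_st I + 1]))))
    (160 * K * length (rest I l) + 1100 * length (rest I l) + 800 * (num_st I + 2 - l))"
proof -
  \<comment> \<open>One group: per delivery, 200 for cutting it off and 900 for packing and
    assigning it. The exponent \<open>K\<close> for all deliveries is used in every group.\<close>
  have group: "\<exists>t u. app 6 (VPair (val_list (map (del_val I) (rest I l))) (VPair (sts_val I l) (prev_val I l))) =
      Some (VPair (val_list (map (item_val I l) (group_list I l)))
        (val_list (map (del_val I) (dropWhile (\<lambda>j. \<not> past I l (del_start I j)) (rest I l)))), t) \<and>
    app 16 (VPair (VNum (cap I)) (VPair (val_list (map (item_val I l) (group_list I l)))
      (VPair (VNum (real (spare I l))) (VPair (num_vals (prev_last I l)) (val_list (map pair_val ps)))))) =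
    Some (VPair (VNum (real (length (bins I l)))) (VPair (VNum (real (spare I (Suc l))))
        (VPair (num_vals (prev_last I (Suc l))) (VPair (num_vals (charge_list I l))
          (val_list (map pair_val (emitted (zip (bins I l) (drone_list I l)) @ ps)))))), u) \<and>
    t + u \<le> 160 * K * length (group_list I l) + 1100 * length (group_list I l) + 600"
    if l: "1 \<le> l" "l \<le> num_st I + 1" for l ps
  proof -
    have "length (group_list I l) \<le> length (sorted_dels I)"
      by (simp add: group_list_def)
    also have "\<dots> \<le> 2 ^ K"
      using K by (simp add: sorted_dels_def)
    finally have len: "length (group_list I l) \<le> 2 ^ K" .
    have cost: "\<forall>j\<in>set (group_list I l). del_cost I j \<le> cap I"
      using ddp by (auto simp: group_list_def ddp_nc_def)
    show ?thesis
      using calls_take[where I = I and l = l and js = "rest I l"] calls_group[OF len cost, where l = l and f = "spare I l" and la = "prev_last I l" and ps = ps]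
      unfolding takeWhile_rest[OF l] bins_def[symmetric] drone_list_def[symmetric] charge_list_def[symmetric]
        state_step[OF l(1), symmetric]
      by (elim callsE) (simp add: algebra_simps)
  qed
  have Max2: "Max (insert m (insert b S)) = Max (insert (max m b) S)" if "finite S" for m b :: nat and S
    using that by (cases "S = {}") (simp_all add: max.assoc)
  show ?thesis
    using l(2,1)
  proof (induction arbitrary: m ps rule: inc_induct)
    case base
    let ?l = "num_st I + 1"
    from group[of ?l ps] obtain t u where tu:
      "app 6 (VPair (val_list (map (del_val I) (rest I ?l))) (VPair (sts_val I ?l) (prev_val I ?l))) =
        Some (VPair (val_list (map (item_val I ?l) (group_list I ?l)))
          (val_list (map (del_val I) (dropWhile (\<lambda>j. \<not> past I ?l (del_start I j)) (rest I ?l)))), t)"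
      "app 16 (VPair (VNum (cap I)) (VPair (val_list (map (item_val I ?l) (group_list I ?l)))
        (VPair (VNum (real (spare I ?l))) (VPair (num_vals (prev_last I ?l)) (val_list (map pair_val ps)))))) =
        Some (VPair (VNum (real (length (bins I ?l)))) (VPair (VNum (real (spare I (Suc ?l))))
          (VPair (num_vals (prev_last I (Suc ?l))) (VPair (num_vals (charge_list I ?l))
            (val_list (map pair_val (emitted (zip (bins I ?l) (drone_list I ?l)) @ ps)))))), u)"
      "t + u \<le> 160 * K * length (group_list I ?l) + 1100 * length (group_list I ?l) + 600"
      by auto
    have "length (group_list I ?l) \<le> length (rest I ?l)"
      using takeWhile_rest[of ?l I] length_takeWhile_le[of "\<lambda>j. \<not> past I ?l (del_start I j)" "rest I ?l"] by simp
    then have "160 * K * length (group_list I ?l) + 1100 * length (group_list I ?l) \<le>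
        160 * K * length (rest I ?l) + 1100 * length (rest I ?l)"
      by (intro add_mono mult_le_mono2)
    with tu have "t + u \<le> 160 * K * length (rest I ?l) + 1100 * length (rest I ?l) + 600"
      by linarith
    with tu(1,2) show ?case
      by (cases "real m \<le> real (length (bins I ?l))"; subst calls_def, subst app_simps)
        (simp_all add: stations_e_def exec sts_val_Nil emitted_from_Suc emitted_from_Nil[simplified]
          cong: bind_weak_cong)
  next
    case (step l)
    then have l: "1 \<le> l" "l \<le> num_st I + 1" "l \<le> num_st I" by auto
    from group[of l ps] l obtain t u where tu:
      "app 6 (VPair (val_list (map (del_val I) (rest I l))) (VPair (sts_val I l) (prev_val I l))) =
        Some (VPair (val_list (map (item_val I l) (group_list I l))) (val_list (map (del_val I) (rest I (Suc l)))), t)"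
      "app 16 (VPair (VNum (cap I)) (VPair (val_list (map (item_val I l) (group_list I l)))
        (VPair (VNum (real (spare I l))) (VPair (num_vals (prev_last I l)) (val_list (map pair_val ps)))))) =
        Some (VPair (VNum (real (length (bins I l)))) (VPair (VNum (real (spare I (Suc l))))
          (VPair (num_vals (prev_last I (Suc l))) (VPair (num_vals (charge_list I l))
            (val_list (map pair_val (emitted (zip (bins I l) (drone_list I l)) @ ps)))))), u)"
      "t + u \<le> 160 * K * length (group_list I l) + 1100 * length (group_list I l) + 600"
      unfolding rest_Suc[OF ddp l(1,3)] by blast
    obtain v where v: "v \<le> 160 * K * length (rest I (Suc l)) + 1100 * length (rest I (Suc l)) + 800 * (num_st I + 2 - Suc l)"
      "app 17 (VPair (VNum (cap I)) (VPair (val_list (map (del_val I) (rest I (Suc l))))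
        (VPair (sts_val I (Suc l)) (VPair (prev_val I (Suc l)) (VPair (VNum (real (spare I (Suc l))))
          (VPair (num_vals (prev_last I (Suc l))) (VPair (VNum (real (max m (length (bins I l)))))
            (val_list (map pair_val (emitted (zip (bins I l) (drone_list I l)) @ ps)))))))))) =
       Some (VPair (VNum (real (Max (insert (max m (length (bins I l))) ((\<lambda>k. length (bins I k)) ` {Suc l..num_st I + 1})))))
        (VPair (val_list (map pair_val (emitted_from I (Suc l) @ emitted (zip (bins I l) (drone_list I l)) @ ps)))
          (val_list (map (\<lambda>k. num_vals (charge_list I k)) [Suc l..<num_st I + 1]))), v)"
      by (rule callsE[OF step.IH[of "max m (length (bins I l))" "emitted (zip (bins I l) (drone_list I l)) @ ps"]])
        (simp, rule that)
    have prev: "prev_val I (Suc l) = VPair (VNum (st_end I l)) VNil"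
      using l by (simp add: prev_val_def)
    \<comment> \<open>The bounds telescope: every delivery is paid for in its own group and in no
      other.\<close>
    have "length (rest I l) = length (group_list I l) + length (rest I (Suc l))"
      unfolding rest_Suc[OF ddp l(1,3), symmetric] takeWhile_rest[OF l(1,2), symmetric]
      by (metis length_append takeWhile_dropWhile_id)
    then have "160 * K * length (rest I l) = 160 * K * length (group_list I l) + 160 * K * length (rest I (Suc l))"
      "1100 * length (rest I l) = 1100 * length (group_list I l) + 1100 * length (rest I (Suc l))"
      by (simp_all only: distrib_left)
    moreover have "num_st I + 2 - l = Suc (num_st I + 2 - Suc l)"
      using l by simp
    ultimately have bound: "t + u + v + 200 \<le> 160 * K * length (rest I l) + 1100 * length (rest I l) + 800 * (num_st I + 2 - l)"
      using tu(3) v(1) by linarith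
    have range: "{l..num_st I + 1} = insert l {Suc l..num_st I + 1}"
      using l by auto
    have Max: "Max (insert m ((\<lambda>k. length (bins I k)) ` {l..num_st I + 1})) =
      Max (insert (max m (length (bins I l))) ((\<lambda>k. length (bins I k)) ` {Suc l..num_st I + 1}))"
      unfolding range image_insert by (rule Max2) simp
    have upt: "[l..<num_st I + 1] = l # [Suc l..<num_st I + 1]"
      using l by (simp add: upt_conv_Cons del: upt_Suc)
    have max: "VNum (real (max m (length (bins I l)))) =
        (if real m \<le> real (length (bins I l)) then VNum (real (length (bins I l))) else VNum (real m))"
      by auto
    show ?case
      using tu(1,2) v(2) bound l
      unfolding Max upt prev max emitted_from_Suc[OF l(2)]
      by (cases "real m \<le> real (length (bins I l))"; subst calls_def, subst app_simps)
        (simp_all add: stations_e_def exec sts_val_Cons del: upt_Suc cong: bind_weak_cong)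
  qed
qed

section \<open>The whole program and its time bound\<close>

lemma run_main:
  assumes "ddp_nc I" "num_del I \<le> 2 ^ K"
  obtains t where "run program [input_val I] main_e = Some
      (VPair (VNum (real (Max ((\<lambda>l. length (bins I l)) ` {1..num_st I + 1}) + 2)))
        (VPair (val_list (map pair_val (emitted_from I 1)))
          (val_list (map (\<lambda>l. num_vals (charge_list I l)) [1..<num_st I + 1]))), t)"
    "t \<le> 220 * num_del I * K + 1300 * num_del I + 800 * num_st I + 1000"
proof -
  let ?n = "num_del I"
  have del_val: "del_val I = keyed (del_start I) (\<lambda>j. VPair (VNum (real j)) (VPair (VNum (del_end I j)) (VNum (del_cost I j))))"
    by (auto simp: del_val_def keyed_def)
  obtain t1 where t1: "t1 \<le> 40 * ?n + 40" "app 3 (VPair (val_list (map (\<lambda>j. VPair (VNum (del_start I j))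
      (VPair (VNum (del_end I j)) (VNum (del_cost I j)))) [1..<?n + 1])) (VNum 1)) =
      Some (val_list (map (del_val I) [1..<?n + 1]), t1)"
    using calls_number[of 1 "?n + 1" I] by (auto elim!: callsE simp del: upt_Suc)
  obtain t2 where t2: "t2 \<le> 60 * ?n * K + 120 * ?n + 20"
    "app 2 (val_list (map (del_val I) [1..<?n + 1])) = Some (val_list (map (del_val I) (sorted_dels I)), t2)"
    using calls_sort[of "[1..<?n + 1]" K "del_start I"] assms(2) unfolding del_val sorted_dels_def
    by (auto elim!: callsE simp del: upt_Suc)
  have len: "length (sorted_dels I) = ?n"
    by (simp add: sorted_dels_def)
  have rest: "rest I 1 = sorted_dels I"
    by (simp add: rest_def)
  have Max0: "Max (insert 0 ((\<lambda>l. length (bins I l)) ` {1..num_st I + 1})) =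
      Max ((\<lambda>l. length (bins I l)) ` {1..num_st I + 1})"
    by (subst Max_insert) auto
  obtain t3 where t3: "t3 \<le> 160 * K * ?n + 1100 * ?n + 800 * (num_st I + 1)"
    "app 17 (VPair (VNum (cap I)) (VPair (val_list (map (del_val I) (sorted_dels I)))
      (VPair (sts_val I 1) (VPair VNil (VPair (VNum 0) (VPair VNil (VPair (VNum 0) VNil))))))) =
    Some (VPair (VNum (real (Max ((\<lambda>l. length (bins I l)) ` {1..num_st I + 1}))))
      (VPair (val_list (map pair_val (emitted_from I 1)))
        (val_list (map (\<lambda>l. num_vals (charge_list I l)) [1..<num_st I + 1]))), t3)"
    using calls_stations[OF assms, of 1 0 "[]"] unfolding rest Max0 len
    by (auto elim!: callsE simp: prev_val_def spare_def prev_last_def simp del: upt_Suc)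
  have "\<exists>t \<le> t1 + t2 + t3 + 100. run program [input_val I] main_e = Some
      (VPair (VNum (real (Max ((\<lambda>l. length (bins I l)) ` {1..num_st I + 1}) + 2)))
        (VPair (val_list (map pair_val (emitted_from I 1)))
          (val_list (map (\<lambda>l. num_vals (charge_list I l)) [1..<num_st I + 1]))), t)"
    using t1(2) t2(2) t3(2) unfolding input_val_def sts_val_def
    by (simp add: main_e_def exec del: upt_Suc cong: bind_weak_cong)
  moreover have "t1 + t2 + t3 + 100 \<le> 220 * ?n * K + 1300 * ?n + 800 * num_st I + 1000"
    using t1(1) t2(1) t3(1) by (simp add: algebra_simps)
  ultimately show thesis using that by (meson order_trans)
qed

text \<open>For n \<ge> 2, K is the logarithm rounded up, hence at most twice the logarithm, and n
  log n \<ge> 2 absorbs the additive constant.\<close>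

lemma time_bound:
  fixes n r t :: nat
  assumes bound: "\<And>K. n \<le> 2 ^ K \<Longrightarrow> t \<le> 220 * n * K + 1300 * n + 800 * r + 1000"
    and "2 \<le> n \<or> 1 \<le> r"
  shows "real t \<le> 4000 * (real n * log 2 (real n) + real r)"
proof (cases "2 \<le> n")
  case True
  define K where "K = nat \<lceil>log 2 (real n)\<rceil>"
  have log: "1 \<le> log 2 (real n)"
    using True by simp
  have "log 2 (real n) \<le> real K"
    unfolding K_def by linarith
  then have "real n \<le> 2 powr real K"
    using True by (simp add: log_le_iff)
  then have "n \<le> 2 ^ K"
    by (simp add: powr_realpow flip: of_nat_le_iff)
  then have "t \<le> 220 * n * K + 1300 * n + 800 * r + 1000"
    by (rule bound)
  then have "real t \<le> real (220 * n * K + 1300 * n + 800 * r + 1000)"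
    by (rule of_nat_mono)
  also have "\<dots> = 220 * (real n * real K) + 1300 * real n + 800 * real r + 1000"
    by simp
  also have "\<dots> \<le> 220 * (real n * (2 * log 2 (real n))) + 1300 * (real n * log 2 (real n)) + 800 * real r
      + 500 * (real n * log 2 (real n))"
  proof -
    have "real K \<le> 2 * log 2 (real n)"
      unfolding K_def using log by linarith
    then have "real n * real K \<le> real n * (2 * log 2 (real n))"
      by (intro mult_left_mono) auto
    moreover have nlog: "real n * 1 \<le> real n * log 2 (real n)"
      using log by (intro mult_left_mono) auto
    moreover have "2 \<le> real n * log 2 (real n)"
      using True nlog by linarith
    ultimately show ?thesis by linarith
  qed
  also have "\<dots> \<le> 4000 * (real n * log 2 (real n) + real r)"
  proof -
    have "0 \<le> real n * log 2 (real n)" using log by simp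
    then show ?thesis by (simp add: algebra_simps)
  qed
  finally show ?thesis .
next
  case False
  with assms(2) have r: "1 \<le> r" by auto
  have "n = 0 \<or> n = 1" using False by auto
  then have log: "real n * log 2 (real n) = 0" by auto
  \<comment> \<open>With at most one delivery the exponent 0 is admissible, and r \<ge> 1 pays for
    everything.\<close>
  have "t \<le> 1300 * n + 800 * r + 1000"
    using bound[of 0] False by simp
  then have "t \<le> 3100 * r" using False r by linarith
  then have "real t \<le> real (3100 * r)"
    by (rule of_nat_mono)
  then show ?thesis unfolding log by simp
qed

section \<open>Feasibility\<close>

lemma Union_place: "\<Union> (set (place B c x bs)) = insert x (\<Union> (set bs))"
  by (induction bs) auto

lemma Union_fold_place: "\<Union> (set (fold (place B c) xs bs)) = set xs \<union> \<Union> (set bs)"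
  by (induction xs arbitrary: bs) (auto simp: Union_place)

text \<open>Blocks must be nonempty because a drone charges only when its level is strictly below
  \<open>cap I\<close>.\<close>

definition packing :: "real \<Rightarrow> (nat \<Rightarrow> real) \<Rightarrow> nat set list \<Rightarrow> bool" where
  "packing B c bs \<longleftrightarrow>
     (\<forall>b\<in>set bs. finite b \<and> b \<noteq> {} \<and> sum c b \<le> B) \<and> sorted_wrt disjnt bs"

lemma packing_Cons:
  "packing B c (b # bs) \<longleftrightarrow>
     finite b \<and> b \<noteq> {} \<and> sum c b \<le> B \<and> disjnt b (\<Union> (set bs)) \<and> packing B c bs"
  by (auto simp: packing_def disjnt_Union2)

lemma packing_place:
  assumes "packing B c bs" "x \<notin> \<Union> (set bs)" "c x \<le> B"
  shows "packing B c (place B c x bs)"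
  using assms
proof (induction bs)
  case Nil
  then show ?case by (simp add: packing_def)
next
  case (Cons b bs)
  then show ?case
    by (auto simp: packing_Cons Union_place disjnt_insert1 disjnt_insert2 add.commute)
qed

lemma packing_fold_place:
  assumes "packing B c bs" "distinct xs" "set xs \<inter> \<Union> (set bs) = {}" "\<And>x. x \<in> set xs \<Longrightarrow> c x \<le> B"
  shows "packing B c (fold (place B c) xs bs)"
  using assms
proof (induction xs arbitrary: bs)
  case (Cons x xs)
  then show ?case
    using packing_place[of B c bs x] by (auto simp: Union_place)
qed simp

lemma ffd_packing:
  assumes "ffd B c X bs" "\<And>x. x \<in> X \<Longrightarrow> c x \<le> B"
  shows "packing B c bs" "\<Union> (set bs) = X"
proof -
  obtain xs where xs: "set xs = X" "distinct xs" "bs = fold (place B c) xs []"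
    using assms(1) by (auto simp: ffd_def)
  then show "packing B c bs"
    using assms(2) packing_fold_place[of B c "[]" xs] by (auto simp: packing_def)
  show "\<Union> (set bs) = X"
    using xs Union_fold_place[of B c xs "[]"] by simp
qed

lemma packing_nth:
  assumes "packing B c bs" "i < length bs"
  shows "finite (bs ! i)" "bs ! i \<noteq> {}" "sum c (bs ! i) \<le> B"
  using assms by (auto simp: packing_def)

lemma packing_unique:
  assumes "packing B c bs" "i < length bs" "j < length bs" "x \<in> bs ! i" "x \<in> bs ! j"
  shows "i = j"
proof (rule linorder_cases[of i j])
  assume "i < j"
  then have "disjnt (bs ! i) (bs ! j)"
    using assms by (auto simp: packing_def sorted_wrt_iff_nth_less)
  with assms show ?thesis by (auto simp: disjnt_iff)
next
  assume "j < i"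
  then have "disjnt (bs ! j) (bs ! i)"
    using assms by (auto simp: packing_def sorted_wrt_iff_nth_less)
  with assms show ?thesis by (auto simp: disjnt_iff)
qed

section \<open>Deliveries, groups and waiting intervals in time\<close>

lemma ddp_ncD:
  assumes "ddp_nc I"
  shows "0 < cap I"
    and "j \<in> {1..num_del I} \<Longrightarrow> del_start I j \<le> del_end I j"
    and "j \<in> {1..num_del I} \<Longrightarrow> 0 < del_cost I j"
    and "j \<in> {1..num_del I} \<Longrightarrow> del_cost I j \<le> cap I"
    and "i \<in> {1..num_del I} \<Longrightarrow> j \<in> {1..num_del I} \<Longrightarrow> i \<noteq> j \<Longrightarrow>
      disjnt (del_interval I i) (del_interval I j)"
    and "l \<in> {1..num_st I} \<Longrightarrow> st_start I l < st_end I l"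
    and "l \<in> {1..<num_st I} \<Longrightarrow> st_end I l < st_start I (Suc l)"
    and "j \<in> {1..num_del I} \<Longrightarrow> l \<in> {1..num_st I} \<Longrightarrow> \<not> del_interval I j \<subseteq> wait_interval I l"
    and "j \<in> {1..num_del I} \<Longrightarrow> k \<in> {1..num_st I} \<Longrightarrow> l \<in> {1..num_st I} \<Longrightarrow> k \<noteq> l \<Longrightarrow>
      disjnt (del_interval I j) (wait_interval I k) \<or> disjnt (del_interval I j) (wait_interval I l)"
    and "l \<in> {1..num_st I} \<Longrightarrow> st_start I l \<le> t' \<Longrightarrow> t' \<le> t'' \<Longrightarrow> t'' \<le> st_end I l \<Longrightarrow> b \<le> cap I \<Longrightarrow>
      charge_to I l t' t'' b \<le> cap I"
    and "l \<in> {1..num_st I} \<Longrightarrow> 0 \<le> b \<Longrightarrow> b \<le> cap I \<Longrightarrow> charge_to I l (st_start I l) (st_end I l) b = cap I"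
  using assms unfolding ddp_nc_def by blast+

lemma st_end_less:
  assumes "ddp_nc I" "1 \<le> k" "k < l" "l \<le> num_st I"
  shows "st_end I k < st_start I l"
proof -
  have "st_end I k < st_start I (Suc k)"
    using assms by (auto simp: ddp_nc_def)
  also have "\<dots> \<le> st_start I l"
    using assms by (intro st_start_mono) auto
  finally show ?thesis .
qed

lemma st_less:
  assumes "ddp_nc I" "1 \<le> l" "l \<le> num_st I"
  shows "st_start I l < st_end I l"
  using assms by (auto simp: ddp_nc_def)

lemma group_exists:
  assumes "j \<in> {1..num_del I}"
  shows "\<exists>l\<in>{1..num_st I + 1}. j \<in> group_nc I l"
proof -
  \<comment> \<open>The group is the least index satisfying the upper bound; minimality gives the
    lower bound at the preceding station.\<close>
  define Q where "Q l \<longleftrightarrow> 1 \<le> l \<and> (l \<le> num_st I \<longrightarrow> del_start I j < st_start I l)" for l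
  define l where "l = (LEAST l. Q l)"
  have top: "Q (num_st I + 1)" by (simp add: Q_def)
  then have l: "Q l" unfolding l_def by (rule LeastI)
  moreover have "l \<le> num_st I + 1"
    unfolding l_def using top by (rule Least_le)
  moreover have "\<not> Q (l - 1)" if "2 \<le> l"
    using that not_less_Least[of "l - 1" Q] by (simp add: l_def)
  ultimately show ?thesis
    using assms by (intro bexI[of _ l]) (auto simp: group_nc_def Q_def)
qed

lemma group_bound: "j \<in> group_nc I l \<Longrightarrow> 1 \<le> l \<and> l \<le> num_st I + 1 \<and> j \<in> {1..num_del I}"
  by (auto simp: group_nc_def)

lemma group_less:
  assumes "ddp_nc I" "j \<in> group_nc I k" "k < l" "l \<le> num_st I + 1"
  shows "del_start I j < st_start I (l - 1)"
proof -
  have "del_start I j < st_start I k"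
    using assms by (auto simp: group_nc_def)
  also have "\<dots> \<le> st_start I (l - 1)"
    using assms group_bound[OF assms(2)] by (intro st_start_mono) auto
  finally show ?thesis .
qed

lemma group_unique:
  assumes "ddp_nc I" "j \<in> group_nc I k" "j \<in> group_nc I l"
  shows "k = l"
proof -
  have False if "j \<in> group_nc I k" "j \<in> group_nc I l" "k < l" for k l
    using group_less[OF assms(1) that(1,3)] group_bound[OF that(1)] group_bound[OF that(2)] that(2,3)
    by (auto simp: group_nc_def)
  with assms show ?thesis by (metis linorder_neqE_nat)
qed

text \<open>The delivery starts within the waiting interval of station \<open>l\<close> or at its
  border, and it is not contained in it, so it must cover \<open>st_end I l\<close>.\<close>

lemma first_dels_if_meets:
  assumes "ddp_nc I" "j \<in> group_nc I (Suc l)" "1 \<le> l"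
    "del_start I j \<le> st_end I l"
  shows "j \<in> first_dels I (Suc l)"
proof -
  have "\<not> del_interval I j \<subseteq> wait_interval I l" "st_start I l \<le> del_start I j"
    using assms group_bound[OF assms(2)] by (auto simp: ddp_nc_def group_nc_def)
  with assms show ?thesis
    by (auto simp: first_dels_def del_interval_def wait_interval_def)
qed

lemma last_dels_if_meets:
  assumes "j \<in> group_nc I l" "l \<le> num_st I" "st_start I l \<le> del_end I j"
  shows "j \<in> last_dels I l"
  using assms by (auto simp: last_dels_def del_interval_def group_nc_def)

text \<open>Justifies the test made by the program, which looks only at the start of the
  delivery.\<close>

lemma first_dels_iff_early:
  assumes "ddp_nc I" "j \<in> group_nc I l"
  shows "j \<in> first_dels I l \<longleftrightarrow> early I l (del_start I j)"
  using assms group_bound[OF assms(2)] first_dels_if_meets[OF assms(1), of j "l - 1"]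
  by (auto simp: first_dels_def early_def del_interval_def)

lemma last_dels_iff_past:
  assumes "j \<in> group_nc I l"
  shows "j \<in> last_dels I l \<longleftrightarrow> past I l (del_end I j)"
  using assms last_dels_if_meets[OF assms]
  by (auto simp: last_dels_def past_def del_interval_def)

lemma del_unique:
  assumes "ddp_nc I" "i \<in> {1..num_del I}" "j \<in> {1..num_del I}" "x \<in> del_interval I i" "x \<in> del_interval I j"
  shows "i = j"
  using ddp_ncD(5)[OF assms(1-3)] assms(4,5) by (auto simp: disjnt_iff)

lemma first_dels_unique:
  assumes "ddp_nc I" "i \<in> first_dels I l" "j \<in> first_dels I l"
  shows "i = j"
  using assms del_unique[OF assms(1), of i j] group_bound[of i I l] group_bound[of j I l]
  by (auto simp: first_dels_def)

lemma last_dels_unique: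
  assumes "ddp_nc I" "i \<in> last_dels I l" "j \<in> last_dels I l"
  shows "i = j"
  using assms del_unique[OF assms(1), of i j] group_bound[of i I l] group_bound[of j I l]
  by (auto simp: last_dels_def)

lemma last_dels_0: "last_dels I 0 = {}"
  by (auto simp: last_dels_def group_nc_def)

lemma last_blocks_0: "last_blocks I P 0 = {}"
  by (simp add: last_blocks_def last_dels_0)

lemma first_blocks_1: "l \<le> 1 \<Longrightarrow> first_blocks I P l = {}"
  by (auto simp: first_blocks_def first_dels_def)

text \<open>Compare \<open>k\<close> with \<open>l\<close>. If \<open>l < k\<close>, the delivery
  starts before station \<open>l\<close> and reaches station \<open>k\<close>, so it meets two
  waiting intervals. If \<open>Suc k < l\<close>, station \<open>k\<close> has closed before the
  delivery starts. Only the two neighbouring stations remain.\<close>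

lemma meets_once:
  assumes ddp: "ddp_nc I" and j: "j \<in> group_nc I l" and k: "k \<in> {1..num_st I}"
    and meets: "\<not> disjnt (del_interval I j) (wait_interval I k)"
  shows "k = l \<and> j \<in> last_dels I l \<or> l = Suc k \<and> j \<in> first_dels I l"
proof -
  note b = group_bound[OF j]
  have ends: "del_start I j \<le> st_end I k" "st_start I k \<le> del_end I j"
    using meets by (force simp: disjnt_iff del_interval_def wait_interval_def)+
  consider "l < k" | "l = k" | "l = Suc k" | "Suc k < l" by linarith
  then show ?thesis
  proof cases
    case 1
    have start: "del_start I j < st_start I l" "st_start I l < st_end I l" "st_end I l < st_start I k"
      using j b k 1 ddp st_end_less[of I l k] st_less[of I l] by (auto simp: group_nc_def)
    then have "st_start I l \<in> del_interval I j" "st_start I l \<in> wait_interval I l"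
      using ends by (auto simp: del_interval_def wait_interval_def)
    then have "\<not> disjnt (del_interval I j) (wait_interval I l)"
      by (auto simp: disjnt_iff)
    moreover have "disjnt (del_interval I j) (wait_interval I k) \<or> disjnt (del_interval I j) (wait_interval I l)"
      using ddp_ncD(9)[OF ddp, of j k l] b k 1 by auto
    ultimately show ?thesis using meets by blast
  next
    case 2
    with j k ends show ?thesis using last_dels_if_meets[OF j] by auto
  next
    case 3
    with j k ends show ?thesis using first_dels_if_meets[OF ddp, of j k] by auto
  next
    case 4
    then have "st_end I k < st_start I (l - 1)"
      using k b by (intro st_end_less[OF ddp]) auto
    also have "\<dots> \<le> del_start I j"
      using j 4 by (auto simp: group_nc_def)
    finally show ?thesis using ends by simp
  qed
qed

section \<open>Blocks and drones of one group\<close>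

lemma ffd_group:
  assumes "ddp_nc I" "ffd_partition I P" "l \<in> {1..num_st I + 1}"
  shows "packing (cap I) (del_cost I) (P l)" "\<Union> (set (P l)) = group_nc I l"
proof -
  have "ffd (cap I) (del_cost I) (group_nc I l) (P l)"
    using assms by (auto simp: ffd_partition_def)
  moreover have "del_cost I x \<le> cap I" if "x \<in> group_nc I l" for x
    using that assms(1) by (auto simp: ddp_nc_def group_nc_def)
  ultimately show "packing (cap I) (del_cost I) (P l)" "\<Union> (set (P l)) = group_nc I l"
    using ffd_packing by blast+
qed

lemma first_blocks_unique:
  assumes "ddp_nc I" "ffd_partition I P" "l \<in> {1..num_st I + 1}"
    "i \<in> first_blocks I P l" "j \<in> first_blocks I P l"
  shows "i = j"
proof -
  obtain x y where "x \<in> P l ! i" "x \<in> first_dels I l" "y \<in> P l ! j" "y \<in> first_dels I l"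
    "i < length (P l)" "j < length (P l)"
    using assms(4,5) by (auto simp: first_blocks_def)
  moreover from this have "x = y" using first_dels_unique[OF assms(1)] by blast
  ultimately show ?thesis
    using packing_unique[OF ffd_group(1)[OF assms(1-3)]] by blast
qed

lemma last_blocks_unique:
  assumes "ddp_nc I" "ffd_partition I P" "i \<in> last_blocks I P l" "j \<in> last_blocks I P l"
  shows "i = j"
proof -
  obtain x y where xy: "x \<in> P l ! i" "x \<in> last_dels I l" "y \<in> P l ! j" "y \<in> last_dels I l"
    "i < length (P l)" "j < length (P l)"
    using assms(3,4) by (auto simp: last_blocks_def)
  moreover from this have "x = y" using last_dels_unique[OF assms(1)] by blast
  moreover have "l \<in> {1..num_st I + 1}"
    using xy by (auto simp: last_dels_def dest: group_bound)
  ultimately show ?thesis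
    using packing_unique[OF ffd_group(1)[OF assms(1,2)]] by blast
qed

lemma last_drone_subset: "last_drone I P D l \<subseteq> D l ` {..<length (P l)}"
  by (auto simp: last_drone_def last_blocks_def)

text \<open>The fourth fact has two reasons: a first block avoids all drones of the previous group,
  and any other block avoids its last drone by requirement.\<close>

lemma stageD:
  assumes "stage I P D l" "i < length (P l)"
  shows "D l i < num_drones I P"
    and "i \<in> first_blocks I P l \<Longrightarrow> D l i \<notin> last_drone I P D (l - 2)"
    and "i \<in> first_blocks I P l \<Longrightarrow> D l i \<notin> D (l - 1) ` {..<length (P (l - 1))}"
    and "D l i \<notin> last_drone I P D (l - 1)"
proof -
  show "D l i < num_drones I P"
    "i \<in> first_blocks I P l \<Longrightarrow> D l i \<notin> last_drone I P D (l - 2)"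
    and first: "i \<in> first_blocks I P l \<Longrightarrow> D l i \<notin> D (l - 1) ` {..<length (P (l - 1))}"
    using assms by (auto simp: stage_def)
  show "D l i \<notin> last_drone I P D (l - 1)"
  proof (cases "i \<in> first_blocks I P l")
    case True
    with first last_drone_subset show ?thesis by blast
  next
    case False
    with assms show ?thesis by (auto simp: stage_def)
  qed
qed

text \<open>\<open>stage\<close> asks for injectivity only outside the first block. There is at most
  one first block, and the others must avoid its drone.\<close>

lemma stage_inj:
  assumes "ddp_nc I" "ffd_partition I P" "stage I P D l" "l \<in> {1..num_st I + 1}"
    "i < length (P l)" "j < length (P l)" "D l i = D l j"
  shows "i = j"
proof -
  have "D l i \<noteq> D l j" if "i \<in> first_blocks I P l" "j \<notin> first_blocks I P l" "j < length (P l)" for i j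
  proof -
    have "D l j \<notin> D l ` first_blocks I P l"
      using assms(3) that by (auto simp: stage_def first_drone_def)
    with that(1) show ?thesis by (metis imageI)
  qed
  from this[of i j] this[of j i] assms(5-7) have "i \<in> first_blocks I P l \<longleftrightarrow> j \<in> first_blocks I P l"
    by auto
  then show ?thesis
    using assms first_blocks_unique[OF assms(1,2,4)] by (auto simp: stage_def inj_on_def)
qed

lemma num_drones_le:
  assumes "l \<in> {1..num_st I + 1}"
  shows "length (P l) + 2 \<le> num_drones I P"
  using assms unfolding num_drones_def by (intro add_right_mono Max_ge) auto

context
  fixes I :: instance_nc and P :: "nat \<Rightarrow> nat set list" and D :: "nat \<Rightarrow> nat \<Rightarrow> nat"
  assumes ddp: "ddp_nc I" and algo: "algo_run I P D"
begin

lemma ffdP: "ffd_partition I P"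
  using algo by (simp add: algo_run_def)

lemma stageP: "l \<in> {1..num_st I + 1} \<Longrightarrow> stage I P D l"
  using algo by (simp add: algo_run_def)

lemmas cost_pos = ddp_ncD(3)[OF ddp]

lemma served_cases:
  assumes "l \<in> {1..num_st I + 1}"
  obtains "served P D l d = {}" "\<And>i. i < length (P l) \<Longrightarrow> D l i \<noteq> d"
  | i where "i < length (P l)" "D l i = d" "served P D l d = P l ! i"
proof (cases "\<exists>i<length (P l). D l i = d")
  case True
  then obtain i where "i < length (P l)" "D l i = d" by blast
  moreover from this have "{i. i < length (P l) \<and> D l i = d} = {i}"
    using stage_inj[OF ddp ffdP stageP[OF assms] assms] by auto
  ultimately show ?thesis using that(2) by (simp add: served_def)
next
  case False
  with that(1) show ?thesis by (auto simp: served_def)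
qed

lemma served_subset:
  assumes "l \<in> {1..num_st I + 1}"
  shows "served P D l d \<subseteq> group_nc I l"
  using ffd_group(2)[OF ddp ffdP assms] by (auto simp: served_def)

lemma served_bound: "l \<in> {1..num_st I + 1} \<Longrightarrow> served P D l d \<subseteq> {1..num_del I}"
  using served_subset[of l d] by (auto simp: group_nc_def)

lemma finite_served: "l \<in> {1..num_st I + 1} \<Longrightarrow> finite (served P D l d)"
  by (rule finite_subset[OF served_subset]) (auto simp: group_nc_def)

lemma sum_served:
  assumes "l \<in> {1..num_st I + 1}"
  shows "0 \<le> sum (del_cost I) (served P D l d)" "sum (del_cost I) (served P D l d) \<le> cap I"
proof -
  show "0 \<le> sum (del_cost I) (served P D l d)"
    using served_bound[OF assms] by (intro sum_nonneg less_imp_le cost_pos) blast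
  show "sum (del_cost I) (served P D l d) \<le> cap I"
    using assms
  proof (cases rule: served_cases[of l d])
    case 1
    then show ?thesis using ddp by (simp add: ddp_nc_def)
  next
    case (2 i)
    then show ?thesis using packing_nth[OF ffd_group(1)[OF ddp ffdP assms]] by simp
  qed
qed

lemma served_pos:
  assumes "l \<in> {1..num_st I + 1}" "i < length (P l)"
  shows "0 < sum (del_cost I) (served P D l (D l i))"
proof -
  from assms have "served P D l (D l i) \<noteq> {}"
    using packing_nth(2)[OF ffd_group(1)[OF ddp ffdP assms(1)]] by (force simp: served_def)
  then show ?thesis
    using served_bound[OF assms(1)] finite_served[OF assms(1)]
    by (intro sum_pos cost_pos) blast+
qed

section \<open>Battery levels and charging drones\<close>

definition refilled :: "nat \<Rightarrow> nat \<Rightarrow> real" where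
  "refilled l d = (if charges I P D l d (level I P D l d)
     then charge_to I l (st_start I l) (st_end I l) (level I P D l d) else level I P D l d)"

lemma level_Suc: "level I P D (Suc l) d = refilled l d - sum (del_cost I) (served P D (Suc l) d)"
  by (simp add: refilled_def)

lemma last_drone_idle:
  assumes "l \<le> num_st I" "d \<in> last_drone I P D l"
  shows "served P D (Suc l) d = {}"
proof -
  have "Suc l \<in> {1..num_st I + 1}" using assms by simp
  from stageD(4)[OF stageP[OF this]] assms(2) show ?thesis
    by (auto simp: served_def)
qed

text \<open>A last drone is idle in the next group and keeps its level; any other drone enters that
  group full, and its block costs at most \<open>cap I\<close>. The third invariant is for the
  drones that have not worked yet, which the rule does not let charge.\<close>

lemma level_bounds:
  assumes "l \<le> num_st I + 1"
  shows "0 \<le> level I P D l d" "level I P D l d \<le> cap I"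
    and "\<not> used_by P D l d \<Longrightarrow> level I P D l d = cap I"
    and "l \<le> num_st I \<Longrightarrow> d \<notin> last_drone I P D l \<Longrightarrow> refilled l d = cap I"
proof -
  have refilled: "refilled l d = cap I"
    if "0 \<le> level I P D l d" "level I P D l d \<le> cap I" "\<not> used_by P D l d \<longrightarrow> level I P D l d = cap I"
      "l \<le> num_st I" "d \<notin> last_drone I P D l" for l
  proof (cases "level I P D l d = cap I")
    case True
    then show ?thesis by (simp add: refilled_def charges_def)
  next
    case False
    with that have "used_by P D l d" "level I P D l d < cap I" by auto
    moreover from this(1) have "1 \<le> l" by (auto simp: used_by_def)
    ultimately have "charges I P D l d (level I P D l d)"
      using that by (simp add: charges_def)
    then show ?thesis
      using that ddp_ncD(11)[OF ddp, of l] by (auto simp: refilled_def charges_def)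
  qed
  have "0 \<le> level I P D l d \<and> level I P D l d \<le> cap I \<and> (\<not> used_by P D l d \<longrightarrow> level I P D l d = cap I)"
    using assms
  proof (induction l)
    case 0
    then show ?case using ddp by (simp add: ddp_nc_def)
  next
    case (Suc l)
    then have l: "Suc l \<in> {1..num_st I + 1}" by simp
    show ?case
    proof (cases "d \<in> last_drone I P D l")
      case True
      with last_drone_idle[of l d] Suc have "level I P D (Suc l) d = level I P D l d"
        by (simp add: charges_def)
      moreover have "used_by P D l d"
        using True Suc.prems last_blocks_0[of I P]
        by (cases "l = 0") (auto simp: used_by_def last_drone_def last_blocks_def)
      then have "used_by P D (Suc l) d"
        by (force simp: used_by_def)
      ultimately show ?thesis using Suc by simp
    next
      case False
      with Suc refilled[of l] have "refilled l d = cap I" by simp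
      then have lev: "level I P D (Suc l) d = cap I - sum (del_cost I) (served P D (Suc l) d)"
        by (simp only: level_Suc)
      moreover have "served P D (Suc l) d = {}" if "\<not> used_by P D (Suc l) d"
        using that by (force simp: used_by_def served_def)
      ultimately show ?thesis
        using sum_served[OF l, of d] by (auto simp del: level.simps)
    qed
  qed
  then show "0 \<le> level I P D l d" "level I P D l d \<le> cap I"
    "\<not> used_by P D l d \<Longrightarrow> level I P D l d = cap I"
    "l \<le> num_st I \<Longrightarrow> d \<notin> last_drone I P D l \<Longrightarrow> refilled l d = cap I"
    using refilled by auto
qed

text \<open>A drone that is not the last one of group \<open>l - 1\<close> enters group
  \<open>l\<close> full, so it is below \<open>cap I\<close> afterwards exactly if it gets a block
  there. The last drone of group \<open>l - 1\<close> has not charged since its block and is below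
  \<open>cap I\<close> anyway.\<close>

lemma charging_eq:
  assumes "l \<in> {1..num_st I}"
  shows "charging I P D l = (D l ` {..<length (P l)} \<union> last_drone I P D (l - 1)) - last_drone I P D l"
proof -
  from assms obtain k where k: "l = Suc k" "k \<le> num_st I" by (cases l) auto
  have l: "l \<in> {1..num_st I + 1}" using assms by simp
  have "d \<in> charging I P D l \<longleftrightarrow> (d \<in> D l ` {..<length (P l)} \<or> d \<in> last_drone I P D k) \<and> d \<notin> last_drone I P D l" for d
  proof (cases "d \<in> last_drone I P D l")
    case True
    then show ?thesis by (simp add: charging_def charges_def)
  next
    case nl: False
    have used: "used_by P D l d" if "d \<in> D l ` {..<length (P l)} \<or> d \<in> last_drone I P D k"
    proof -
      have "\<exists>m\<in>{1..l}. \<exists>i<length (P m). D m i = d"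
      proof (cases "d \<in> D l ` {..<length (P l)}")
        case True
        then show ?thesis using l by force
      next
        case False
        with that obtain i where "i \<in> last_blocks I P k" "D k i = d" by (auto simp: last_drone_def)
        moreover from this last_blocks_0[of I P] have "1 \<le> k" by (cases k) auto
        ultimately show ?thesis using k by (intro bexI[of _ k]) (auto simp: last_blocks_def)
      qed
      then show ?thesis by (simp add: used_by_def)
    qed
    have "level I P D l d < cap I \<longleftrightarrow> d \<in> D l ` {..<length (P l)} \<or> d \<in> last_drone I P D k"
    proof (cases "d \<in> last_drone I P D k")
      case True
      with last_blocks_0[of I P] have "1 \<le> k" by (cases k) (auto simp: last_drone_def)
      then obtain m where m: "k = Suc m" by (cases k) auto
      obtain i where i: "i < length (P k)" "d = D k i"
        using True by (auto simp: last_drone_def last_blocks_def)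
      have kr: "k \<in> {1..num_st I + 1}" using k \<open>1 \<le> k\<close> by simp
      \<comment> \<open>Not being the last drone of the group before, \<open>d\<close> entered group
        \<open>k\<close> full, and its nonempty block there left it below
        \<open>cap I\<close>.\<close>
      have "d \<notin> last_drone I P D m"
        using stageD(4)[OF stageP[OF kr] i(1)] i(2) m by simp
      then have "refilled m d = cap I"
        using level_bounds(4)[of m d] k m by simp
      then have "level I P D k d < cap I"
        unfolding m level_Suc using served_pos[OF kr i(1)] i(2) m by simp
      moreover have "level I P D l d = level I P D k d"
        using True last_drone_idle[OF k(2) True] k by (simp add: charges_def)
      ultimately show ?thesis using True by simp
    next
      case False
      then have "refilled k d = cap I"
        using level_bounds(4)[of k d] k by simp
      then have lev: "level I P D l d = cap I - sum (del_cost I) (served P D l d)"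
        unfolding k level_Suc by simp
      have "0 < sum (del_cost I) (served P D l d) \<longleftrightarrow> d \<in> D l ` {..<length (P l)}"
      proof (cases rule: served_cases[OF l, of d])
        case 1
        then show ?thesis by auto
      next
        case (2 i)
        then show ?thesis using served_pos[OF l, of i] by auto
      qed
      with lev False show ?thesis by auto
    qed
    with used nl assms show ?thesis by (auto simp: charging_def charges_def simp del: level.simps)
  qed
  then show ?thesis using k by auto
qed

text \<open>The critical case is a first block of group \<open>k + 1\<close>. The drones charging at
  station \<open>k\<close> either belong to group \<open>k\<close> or are the last drone of group
  \<open>k - 1\<close>, which rested meanwhile; the two requirements on the drone of a first block
  exclude both.\<close>

lemma charging_disjnt:
  assumes l: "l \<in> {1..num_st I + 1}" and j: "j \<in> served P D l d" and k: "d \<in> charging I P D k"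
  shows "disjnt (del_interval I j) (wait_interval I k)"
proof (rule ccontr)
  assume meets: "\<not> ?thesis"
  have kr: "k \<in> {1..num_st I}" and dk: "d \<notin> last_drone I P D k"
    using k by (auto simp: charging_def charges_def)
  have jl: "j \<in> group_nc I l" using served_subset[OF l] j by auto
  obtain i where i: "i < length (P l)" "D l i = d" "j \<in> P l ! i"
    using j by (auto simp: served_def)
  from meets_once[OF ddp jl kr meets] show False
  proof (elim disjE conjE)
    assume "k = l" "j \<in> last_dels I l"
    with i dk show False by (auto simp: last_drone_def last_blocks_def)
  next
    assume lk: "l = Suc k" and "j \<in> first_dels I l"
    with i have "i \<in> first_blocks I P l" by (auto simp: first_blocks_def)
    from stageD(2,3)[OF stageP[OF l] i(1) this] i lk have
      "d \<notin> last_drone I P D (k - 1)" "d \<notin> D k ` {..<length (P k)}" by (auto simp: numeral_2_eq_2)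
    with k charging_eq[OF kr] show False by auto
  qed
qed

section \<open>The event list of a drone\<close>

primrec battery_after :: "real \<Rightarrow> event list \<Rightarrow> real" where
  "battery_after b [] = b"
| "battery_after b (e # es) = battery_after
     (case e of Deliver j \<Rightarrow> b - del_cost I j | Charge l t' t'' \<Rightarrow> charge_to I l t' t'' b) es"

lemma battery_after_append: "battery_after b (es @ fs) = battery_after (battery_after b es) fs"
  by (induction es arbitrary: b) auto

lemma battery_ok_append:
  "battery_ok I b (es @ fs) \<longleftrightarrow> battery_ok I b es \<and> battery_ok I (battery_after b es) fs"
proof (induction es arbitrary: b)
  case (Cons e es)
  then show ?case by (cases e) auto
qed simp

text \<open>Since costs are positive, comparing the total with the level is enough: no partial sum
  exceeds it.\<close>

lemma battery_deliver:
  assumes "set js \<subseteq> {1..num_del I}" "sum_list (map (del_cost I) js) \<le> b"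
  shows "battery_ok I b (map Deliver js)"
    and "battery_after b (map Deliver js) = b - sum_list (map (del_cost I) js)"
proof -
  have "battery_ok I b (map Deliver js) \<and> battery_after b (map Deliver js) = b - sum_list (map (del_cost I) js)"
    using assms
  proof (induction js arbitrary: b)
    case (Cons j js)
    have "0 \<le> sum_list (map (del_cost I) js)"
      using Cons.prems by (intro sum_list_nonneg) (auto intro!: less_imp_le cost_pos)
    with Cons show ?case by (simp add: algebra_simps)
  qed simp
  then show "battery_ok I b (map Deliver js)"
    "battery_after b (map Deliver js) = b - sum_list (map (del_cost I) js)" by auto
qed

definition deliveries :: "nat \<Rightarrow> nat \<Rightarrow> nat list" where
  "deliveries l d = sort_key (del_start I) (sorted_list_of_set (served P D l d))"

text \<open>Charging at station \<open>l\<close> precedes all of group \<open>l + 1\<close>, whose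
  deliveries start no earlier than the station opens. For \<open>l = 0\<close> the set
  \<open>charging I P D l\<close> is empty.\<close>

primrec events :: "nat \<Rightarrow> nat \<Rightarrow> event list" where
  "events 0 d = []"
| "events (Suc l) d = events l d @
     (if d \<in> charging I P D l then [Charge l (st_start I l) (st_end I l)] else []) @
     map Deliver (deliveries (Suc l) d)"

lemma set_deliveries: "l \<in> {1..num_st I + 1} \<Longrightarrow> set (deliveries l d) = served P D l d"
  by (simp add: deliveries_def finite_served)

lemma sum_deliveries:
  "l \<in> {1..num_st I + 1} \<Longrightarrow> sum_list (map (del_cost I) (deliveries l d)) = sum (del_cost I) (served P D l d)"
  by (subst sum_list_distinct_conv_sum_set) (simp_all add: set_deliveries, simp add: deliveries_def)

lemma battery_events:
  assumes "l \<le> num_st I + 1"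
  shows "battery_ok I (cap I) (events l d) \<and> battery_after (cap I) (events l d) = level I P D l d"
  using assms
proof (induction l)
  case (Suc l)
  then have l: "Suc l \<in> {1..num_st I + 1}" by simp
  have sub: "set (deliveries (Suc l) d) \<subseteq> {1..num_del I}"
    using served_bound[OF l] by (simp only: set_deliveries[OF l])
  have "sum (del_cost I) (served P D (Suc l) d) \<le> refilled l d"
    using level_bounds(1)[OF Suc.prems, of d] by (simp only: level_Suc)
  then have "sum_list (map (del_cost I) (deliveries (Suc l) d)) \<le> refilled l d"
    by (simp only: sum_deliveries[OF l])
  note deliver = battery_deliver[OF sub this]
  have "battery_after (level I P D l d) (if d \<in> charging I P D l then [Charge l (st_start I l) (st_end I l)] else []) = refilled l d"
    by (simp add: refilled_def charging_def)
  moreover have "battery_ok I b (if d \<in> charging I P D l then [Charge l (st_start I l) (st_end I l)] else [])" for b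
    by simp
  ultimately show ?case
    using Suc deliver by (simp add: battery_ok_append battery_after_append sum_deliveries[OF l] level_Suc del: level.simps)
qed simp

lemma sorted_map_append:
  assumes "sorted (map f xs)" "sorted (map f ys)"
    and "\<And>x y. x \<in> set xs \<Longrightarrow> y \<in> set ys \<Longrightarrow> f x < (f y :: real)"
  shows "sorted (map f (xs @ ys))"
  using assms by (auto simp: sorted_append intro: less_imp_le)

lemma distinct_append_if:
  assumes "distinct xs" "distinct ys"
    and "\<And>x y. x \<in> set xs \<Longrightarrow> y \<in> set ys \<Longrightarrow> f x < (f y :: real)"
  shows "distinct (xs @ ys)"
  using assms by auto

text \<open>The bound by the start of the next station is carried along because it puts every
  extension strictly after what precedes it; sortedness and distinctness both follow from
  this.\<close>

lemma events_sorted: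
  assumes "l \<le> num_st I + 1"
  shows "sorted (map (event_start I) (events l d)) \<and> distinct (events l d) \<and>
    (l \<le> num_st I \<longrightarrow> (\<forall>e\<in>set (events l d). event_start I e < st_start I l)) \<and>
    set (events l d) = {Deliver j | j. \<exists>k\<in>{1..l}. j \<in> served P D k d} \<union>
      {Charge k (st_start I k) (st_end I k) | k. k < l \<and> d \<in> charging I P D k}"
  using assms
proof (induction l)
  case 0
  then show ?case by simp
next
  case (Suc l)
  then have l: "Suc l \<in> {1..num_st I + 1}" "l \<le> num_st I" by auto
  let ?c = "if d \<in> charging I P D l then [Charge l (st_start I l) (st_end I l)] else []"
  let ?ds = "map Deliver (deliveries (Suc l) d)"
  from l(2) have "l \<le> num_st I + 1" by simp
  note IH = Suc.IH[OF this]
  have IH_sorted: "sorted (map (event_start I) (events l d))" and IH_distinct: "distinct (events l d)"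
    and before: "\<And>e. e \<in> set (events l d) \<Longrightarrow> event_start I e < st_start I l"
    and IH_set: "set (events l d) = {Deliver j | j. \<exists>k\<in>{1..l}. j \<in> served P D k d} \<union>
      {Charge k (st_start I k) (st_end I k) | k. k < l \<and> d \<in> charging I P D k}"
    using IH l(2) by blast+
  have group: "j \<in> group_nc I (Suc l)" if "j \<in> set (deliveries (Suc l) d)" for j
    using that served_subset[OF l(1)] by (auto simp: set_deliveries[OF l(1)])
  have late: "st_start I l \<le> event_start I e" if "e \<in> set (?c @ ?ds)" "1 \<le> l" for e
    using that group by (auto simp: group_nc_def split: if_splits)
  have l1: "1 \<le> l" if "e \<in> set (events l d)" for e
    using that by (cases l) auto
  have sorted_ds: "sorted (map (event_start I) ?ds)"
    by (simp add: deliveries_def comp_def)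
  have c_charging: "1 \<le> l" if "d \<in> charging I P D l"
    using that by (auto simp: charging_def charges_def)
  have new_sorted: "sorted (map (event_start I) (?c @ ?ds))"
    using sorted_ds group c_charging by (auto simp: group_nc_def)
  \<comment> \<open>Group 1 has no lower bound on its start times, but no event precedes it;
    \<open>l1\<close> takes care of this.\<close>
  have apart: "event_start I e < event_start I e'"
    if "e \<in> set (events l d)" "e' \<in> set (?c @ ?ds)" for e e'
    using before[OF that(1)] late[OF that(2) l1[OF that(1)]] by linarith
  have "sorted (map (event_start I) (events (Suc l) d))"
    unfolding events.simps by (rule sorted_map_append[OF IH_sorted new_sorted apart])
  moreover have new_distinct: "distinct (?c @ ?ds)"
    by (auto simp: distinct_map inj_on_def deliveries_def)
  have "distinct (events (Suc l) d)"
    unfolding events.simps by (rule distinct_append_if[OF IH_distinct new_distinct apart])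
  moreover have "\<forall>e\<in>set (events (Suc l) d). event_start I e < st_start I (Suc l)" if "Suc l \<le> num_st I"
  proof
    fix e assume e: "e \<in> set (events (Suc l) d)"
    have mono: "st_start I l < st_start I (Suc l)" if "1 \<le> l"
      using st_less[OF ddp, of l] st_end_less[OF ddp, of l "Suc l"] that \<open>Suc l \<le> num_st I\<close> by simp
    from e consider "e \<in> set (events l d)" | "e \<in> set ?c" | "e \<in> set ?ds" by auto
    then show "event_start I e < st_start I (Suc l)"
    proof cases
      case 1
      then show ?thesis using before[OF 1] mono l1[OF 1] by simp
    next
      case 2
      then show ?thesis using mono c_charging by (auto split: if_splits)
    next
      case 3
      then show ?thesis using group that by (auto simp: group_nc_def)
    qed
  qed
  moreover have "set (events (Suc l) d) = {Deliver j | j. \<exists>k\<in>{1..Suc l}. j \<in> served P D k d} \<union>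
      {Charge k (st_start I k) (st_end I k) | k. k < Suc l \<and> d \<in> charging I P D k}"
  proof -
    have events: "set (events (Suc l) d) = set (events l d) \<union> set ?c \<union> Deliver ` served P D (Suc l) d"
      by (auto simp: set_deliveries[OF l(1)])
    have range: "{1..Suc l} = insert (Suc l) {1..l}"
      by auto
    have served: "{Deliver j | j. \<exists>k\<in>{1..Suc l}. j \<in> served P D k d} =
        Deliver ` served P D (Suc l) d \<union> {Deliver j | j. \<exists>k\<in>{1..l}. j \<in> served P D k d}"
      unfolding range bex_simps by (auto simp del: atLeastAtMost_iff)
    have charged: "{Charge k (st_start I k) (st_end I k) | k. k < Suc l \<and> d \<in> charging I P D k} =
        set ?c \<union> {Charge k (st_start I k) (st_end I k) | k. k < l \<and> d \<in> charging I P D k}"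
      by (auto simp: less_Suc_eq)
    show ?thesis
      unfolding events served charged IH_set by (simp only: Un_ac)
  qed
  ultimately show ?case by blast
qed

lemma set_events: "set (events (num_st I + 1) d) = schedule I P D d"
  using events_sorted[of "num_st I + 1" d]
  by (auto simp: schedule_def charging_def charges_def less_Suc_eq_le)

lemma schedule_cases:
  assumes "e \<in> schedule I P D d"
  obtains j l where "e = Deliver j" "l \<in> {1..num_st I + 1}" "j \<in> served P D l d"
  | l where "e = Charge l (st_start I l) (st_end I l)" "l \<in> {1..num_st I}" "d \<in> charging I P D l"
  using assms by (auto simp: schedule_def)

lemma feasible_schedule: "feasible I (schedule I P D d)"
  unfolding feasible_def
proof (intro conjI ballI impI)
  show "finite (schedule I P D d)"
    unfolding set_events[symmetric] by simp
  have del: "j \<in> {1..num_del I}" if "l \<in> {1..num_st I + 1}" "j \<in> served P D l d" for j l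
    using that served_bound[of l d] by blast
  show "valid_event I e" if "e \<in> schedule I P D d" for e
    using that
  proof (cases rule: schedule_cases)
    case (1 j l)
    then show ?thesis using del by simp
  next
    case (2 l)
    then show ?thesis using st_less[OF ddp, of l] by simp
  qed
  show "disjnt (event_interval I e) (event_interval I e')"
    if "e \<in> schedule I P D d" "e' \<in> schedule I P D d" "e \<noteq> e'" for e e'
    using that(1)
  proof (cases rule: schedule_cases)
    case e: (1 j l)
    from that(2) show ?thesis
    proof (cases rule: schedule_cases)
      case (1 j' l')
      with e that(3) del ddp_ncD(5)[OF ddp, of j j'] show ?thesis by auto
    next
      case (2 l')
      with e charging_disjnt[of l j d l'] show ?thesis by (simp add: wait_interval_def)
    qed
  next
    case e: (2 l)
    from that(2) show ?thesis
    proof (cases rule: schedule_cases)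
      case (1 j' l')
      with e charging_disjnt[of l' j' d l] show ?thesis by (simp add: wait_interval_def disjnt_sym)
    next
      case (2 l')
      have "disjnt {st_start I k..st_end I k} {st_start I m..st_end I m}"
        if "k \<in> {1..num_st I}" "m \<in> {1..num_st I}" "k < m" for k m
        using st_end_less[OF ddp, of k m] that by (auto simp: disjnt_iff)
      moreover have "l < l' \<or> l' < l"
        using that(3) e(1) 2(1) by (metis linorder_neqE_nat)
      ultimately show ?thesis
        using e 2 by (auto simp: disjnt_sym)
    qed
  qed
  show "\<exists>es. set es = schedule I P D d \<and> distinct es \<and> sorted (map (event_start I) es) \<and> battery_ok I (cap I) es"
    using set_events events_sorted[of "num_st I + 1" d] battery_events[of "num_st I + 1" d] by blast
qed

section \<open>Every delivery is served once, by one of the opened drones\<close>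

lemma Deliver_schedule:
  "Deliver j \<in> schedule I P D d \<longleftrightarrow> (\<exists>l\<in>{1..num_st I + 1}. j \<in> served P D l d)"
  by (auto simp: schedule_def)

lemma schedule_unique:
  assumes "j \<in> {1..num_del I}"
  shows "\<exists>!d. Deliver j \<in> schedule I P D d"
proof -
  obtain l where l: "l \<in> {1..num_st I + 1}" "j \<in> group_nc I l"
    using group_exists[OF assms] by blast
  then obtain i where i: "i < length (P l)" "j \<in> P l ! i"
    using ffd_group(2)[OF ddp ffdP l(1)] by (metis UnionE in_set_conv_nth)
  show ?thesis
  proof (rule ex1I[of _ "D l i"])
    show "Deliver j \<in> schedule I P D (D l i)"
      using l i by (auto simp: Deliver_schedule served_def)
  next
    fix d assume "Deliver j \<in> schedule I P D d"
    then obtain k where k: "k \<in> {1..num_st I + 1}" "j \<in> served P D k d"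
      by (auto simp: Deliver_schedule)
    then have "k = l"
      using served_subset[OF k(1)] l(2) group_unique[OF ddp] by blast
    with k obtain i' where "i' < length (P l)" "D l i' = d" "j \<in> P l ! i'"
      by (auto simp: served_def)
    then show "d = D l i"
      using packing_unique[OF ffd_group(1)[OF ddp ffdP l(1)]] i by blast
  qed
qed

lemma schedule_bound:
  assumes "schedule I P D d \<noteq> {}"
  shows "d < num_drones I P"
proof -
  obtain e where "e \<in> schedule I P D d" using assms by blast
  then have "\<exists>l\<in>{1..num_st I + 1}. \<exists>i<length (P l). D l i = d"
  proof (cases rule: schedule_cases)
    case (1 j l)
    then show ?thesis by (auto simp: served_def)
  next
    case (2 l)
    then obtain k i where "1 \<le> k" "k \<le> l" "i < length (P k)" "D k i = d"
      by (auto simp: charging_def charges_def used_by_def)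
    with 2(2) show ?thesis by (intro bexI[of _ k]) auto
  qed
  then show ?thesis using stageD(1)[OF stageP] by blast
qed

end

section \<open>Approximation ratio\<close>

text \<open>Up to the first charging the battery only decreases, and after it no delivery of
  \<open>G\<close> can follow, as station \<open>l\<close> has opened. The maximum with 0 allows for
  a negative \<open>b\<close>, where the empty sum still has to be bounded.\<close>

lemma sum_le_battery:
  assumes "battery_ok I b es" "sorted (map (event_start I) es)" "\<forall>e\<in>set es. valid_event I e"
    and "ddp_nc I" "finite G" "\<And>j. Deliver j \<in> set es \<Longrightarrow> j \<in> G \<Longrightarrow> \<not> past I l (del_start I j)"
    and "\<And>k t' t''. Charge k t' t'' \<in> set es \<Longrightarrow> past I l t'"
    and "distinct es"
  shows "sum (del_cost I) {j \<in> G. Deliver j \<in> set es} \<le> max 0 b"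
  using assms(1-3,6-8)
proof (induction es arbitrary: b)
  case (Cons e es)
  show ?case
  proof (cases e)
    case (Deliver j)
    have pos: "0 < del_cost I j"
      using Cons.prems(3) ddp_ncD(3)[OF assms(4)] Deliver by auto
    have b: "del_cost I j \<le> b" "battery_ok I (b - del_cost I j) es"
      using Cons.prems(1) Deliver by auto
    have IH: "sum (del_cost I) {j \<in> G. Deliver j \<in> set es} \<le> max 0 (b - del_cost I j)"
      using Cons.prems by (intro Cons.IH[OF b(2)]) auto
    \<comment> \<open>An inclusion only, as \<open>j\<close> may lie outside \<open>G\<close>; its
      positive cost can be added in either case.\<close>
    have sub: "{i \<in> G. Deliver i \<in> set (e # es)} \<subseteq> insert j {i \<in> G. Deliver i \<in> set es}"
      using Deliver by auto
    have "j \<notin> {i \<in> G. Deliver i \<in> set es}"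
      using Cons.prems(6) Deliver by auto
    moreover have "0 \<le> del_cost I i" if "i \<in> insert j {i \<in> G. Deliver i \<in> set es}" for i
      using that pos Cons.prems(3) ddp_ncD(3)[OF assms(4), of i] by force
    then have "sum (del_cost I) {i \<in> G. Deliver i \<in> set (e # es)} \<le>
        sum (del_cost I) (insert j {i \<in> G. Deliver i \<in> set es})"
      using assms(5) by (intro sum_mono2[OF _ sub]) auto
    ultimately have "sum (del_cost I) {i \<in> G. Deliver i \<in> set (e # es)} \<le>
        del_cost I j + sum (del_cost I) {j \<in> G. Deliver j \<in> set es}"
      using assms(5) by simp
    with IH b(1) pos show ?thesis by linarith
  next
    case (Charge k t' t'')
    then have "past I l t'" using Cons.prems(5) by auto
    moreover have "t' \<le> del_start I j" if "Deliver j \<in> set es" for j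
      using that Cons.prems(2) Charge by force
    ultimately have "past I l (del_start I j)" if "Deliver j \<in> set es" for j
      using that by (force simp: past_def)
    then have none: "{j \<in> G. Deliver j \<in> set (e # es)} = {}"
      using Cons.prems(4) Charge by auto
    show ?thesis unfolding none by simp
  qed
qed simp

text \<open>Events before the first delivery of \<open>G\<close> are discarded, since all they do is
  leave some level of at most \<open>cap I\<close>. From that delivery on, every charging happens
  past the start of station \<open>l\<close>, and \<open>sum_le_battery\<close> applies.\<close>

lemma sum_le_cap:
  assumes "battery_ok I b es" "b \<le> cap I" "sorted (map (event_start I) es)" "\<forall>e\<in>set es. valid_event I e"
    and "ddp_nc I" "finite G" "\<And>j. Deliver j \<in> set es \<Longrightarrow> j \<in> G \<Longrightarrow> \<not> past I l (del_start I j)"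
    and "\<And>j k t' t''. j \<in> G \<Longrightarrow> Deliver j \<in> set es \<Longrightarrow> Charge k t' t'' \<in> set es \<Longrightarrow> del_start I j \<le> t' \<Longrightarrow> past I l t'"
    and "distinct es"
  shows "sum (del_cost I) {j \<in> G. Deliver j \<in> set es} \<le> cap I"
  using assms(1-4,7-9)
proof (induction es arbitrary: b)
  case Nil
  then show ?case using ddp_ncD(1)[OF assms(5)] by simp
next
  case (Cons e es)
  show ?case
  proof (cases "\<exists>j\<in>G. e = Deliver j")
    case True
    then obtain j where j: "j \<in> G" "e = Deliver j" by blast
    have "past I l t'" if "Charge k t' t'' \<in> set (e # es)" for k t' t''
    proof (rule Cons.prems(6)[OF j(1) _ that])
      show "del_start I j \<le> t'" using that Cons.prems(3) j(2) by force
    qed (simp add: j)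
    then have "sum (del_cost I) {j \<in> G. Deliver j \<in> set (e # es)} \<le> max 0 b"
      using Cons.prems assms(5,6) by (intro sum_le_battery[of I b "e # es" G l]) blast+
    then show ?thesis using Cons.prems(2) ddp_ncD(1)[OF assms(5)] by simp
  next
    case False
    then have same: "{j \<in> G. Deliver j \<in> set (e # es)} = {j \<in> G. Deliver j \<in> set es}" by auto
    obtain b' where "battery_ok I b' es" "b' \<le> cap I"
    proof (cases e)
      case (Deliver j)
      then have "0 < del_cost I j" using Cons.prems(4) ddp_ncD(3)[OF assms(5)] by auto
      then show thesis using Deliver Cons.prems that[of "b - del_cost I j"] by auto
    next
      case (Charge k t' t'')
      then have "charge_to I k t' t'' b \<le> cap I"
        using Cons.prems(2,4) by (intro ddp_ncD(10)[OF assms(5)]) auto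
      then show thesis using Charge Cons.prems that[of "charge_to I k t' t'' b"] by auto
    qed
    from this show ?thesis
      unfolding same
    proof (rule Cons.IH)
      show "sorted (map (event_start I) es)" "\<forall>e\<in>set es. valid_event I e" "distinct es"
        using Cons.prems by auto
      show "\<not> past I l (del_start I j)" if "Deliver j \<in> set es" "j \<in> G" for j
        using that Cons.prems(5) by simp
      show "past I l t'" if "j \<in> G" "Deliver j \<in> set es" "Charge k t' t'' \<in> set es" "del_start I j \<le> t'"
        for j k t' t''
        using that Cons.prems(6)[of j k t' t''] by simp
    qed
  qed
qed

text \<open>
  Charging at station \<open>l - 1\<close> can only precede the first delivery of group \<open>l\<close>, since a delivery
  that starts within a waiting interval lasts longer than it.
\<close>

lemma charge_after_group:
  assumes ddp: "ddp_nc I" and j: "j \<in> group_nc I l" and valid: "valid_event I (Charge k t' t'')"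
    and disj: "disjnt (del_interval I j) {t'..t''}" and start: "del_start I j \<le> t'"
  shows "past I l t'"
proof -
  note b = group_bound[OF j]
  have "\<not> k < l"
  proof
    assume "k < l"
    then have early: "st_start I (l - 1) \<le> del_start I j"
      using j valid by (auto simp: group_nc_def)
    show False
    proof (cases "k = l - 1")
      case True
      have "\<not> del_interval I j \<subseteq> wait_interval I k"
        using valid b by (intro ddp_ncD(8)[OF ddp]) auto
      then have "t' \<le> del_end I j"
        using early start valid True by (auto simp: del_interval_def wait_interval_def)
      then have "t' \<in> del_interval I j" "t' \<in> {t'..t''}"
        using start valid by (auto simp: del_interval_def)
      with disj show False by (auto simp: disjnt_iff)
    next
      case False
      then have "st_end I k < st_start I (l - 1)"
        using \<open>k < l\<close> b valid by (intro st_end_less[OF ddp]) auto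
      with early start valid show False by auto
    qed
  qed
  then have "l \<le> k" "k \<le> num_st I" "st_start I k \<le> t'" using valid by auto
  moreover from this have "st_start I l \<le> st_start I k"
    using b by (intro st_start_mono[OF ddp]) auto
  ultimately show ?thesis by (simp add: past_def)
qed

lemma feasible_group:
  assumes ddp: "ddp_nc I" and S: "feasible I S"
  shows "sum (del_cost I) {j \<in> group_nc I l. Deliver j \<in> S} \<le> cap I"
proof -
  obtain es where es: "set es = S" "distinct es" "sorted (map (event_start I) es)" "battery_ok I (cap I) es"
    using S by (auto simp: feasible_def)
  have valid: "\<forall>e\<in>S. valid_event I e"
    and disj: "\<And>e e'. e \<in> S \<Longrightarrow> e' \<in> S \<Longrightarrow> e \<noteq> e' \<Longrightarrow> disjnt (event_interval I e) (event_interval I e')"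
    using S by (auto simp: feasible_def)
  have "sum (del_cost I) {j \<in> group_nc I l. Deliver j \<in> set es} \<le> cap I"
  proof (rule sum_le_cap[OF es(4) order_refl es(3) _ ddp, where l = l])
    show "\<forall>e\<in>set es. valid_event I e" using valid es(1) by simp
    show "finite (group_nc I l)" by (auto simp: group_nc_def)
    show "\<not> past I l (del_start I j)" if "j \<in> group_nc I l" for j
      using that by (auto simp: past_def group_nc_def)
    show "past I l t'" if "j \<in> group_nc I l" "Deliver j \<in> set es" "Charge k t' t'' \<in> set es" "del_start I j \<le> t'"
      for j k t' t''
    proof (rule charge_after_group[OF ddp that(1) _ _ that(4)])
      show "valid_event I (Charge k t' t'')" using valid that(3) es(1) by blast
      show "disjnt (del_interval I j) {t'..t''}"
        using disj[of "Deliver j" "Charge k t' t''"] that(2,3) es(1) by simp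
    qed
    show "distinct es" by (rule es(2))
  qed
  then show ?thesis by (simp add: es(1))
qed

section \<open>Comparison with the optimum\<close>

lemma opt_nc_witness:
  assumes "ddp_nc I"
  shows "\<exists>S. (\<forall>d<opt_nc I. feasible I (S d)) \<and>
    (\<forall>j\<in>{1..num_del I}. \<exists>!d. d < opt_nc I \<and> Deliver j \<in> S d)"
proof -
  let ?Q = "\<lambda>k. \<exists>S. (\<forall>d<k. feasible I (S d)) \<and>
     (\<forall>j\<in>{1..num_del I}. \<exists>!d. d < k \<and> Deliver j \<in> S d)"
  have "?Q (num_del I)"
  proof (intro exI[of _ "\<lambda>d. {Deliver (Suc d)}"] conjI allI impI ballI)
    fix d assume "d < num_del I"
    then show "feasible I {Deliver (Suc d)}"
      using ddp_ncD(4)[OF assms, of "Suc d"]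
      by (auto simp: feasible_def intro!: exI[of _ "[Deliver (Suc d)]"])
  next
    fix j assume "j \<in> {1..num_del I}"
    then show "\<exists>!d. d < num_del I \<and> Deliver j \<in> {Deliver (Suc d)}"
      by (intro ex1I[of _ "j - 1"]) auto
  qed
  then show ?thesis unfolding opt_nc_def by (rule LeastI)
qed

lemma opt_bins_group_le:
  assumes ddp: "ddp_nc I"
  shows "opt_bins (cap I) (del_cost I) (group_nc I l) \<le> opt_nc I"
proof -
  obtain S where S: "\<forall>d<opt_nc I. feasible I (S d)"
    "\<forall>j\<in>{1..num_del I}. \<exists>!d. d < opt_nc I \<and> Deliver j \<in> S d"
    using opt_nc_witness[OF ddp] by blast
  then have "\<forall>j\<in>{1..num_del I}. \<exists>d. d < opt_nc I \<and> Deliver j \<in> S d"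
    by (intro ballI ex1_implies_ex) (rule bspec)
  from bchoice[OF this] obtain f where f: "\<forall>j\<in>{1..num_del I}. f j < opt_nc I \<and> Deliver j \<in> S (f j)" ..
  have "sum (del_cost I) {x \<in> group_nc I l. f x = i} \<le> cap I" if "i < opt_nc I" for i
  proof -
    have "sum (del_cost I) {x \<in> group_nc I l. f x = i} \<le> sum (del_cost I) {j \<in> group_nc I l. Deliver j \<in> S i}"
    proof (rule sum_mono2)
      show "finite {j \<in> group_nc I l. Deliver j \<in> S i}"
        by (simp add: group_nc_def)
      show "{x \<in> group_nc I l. f x = i} \<subseteq> {j \<in> group_nc I l. Deliver j \<in> S i}"
        using f group_bound by blast
      show "0 \<le> del_cost I j" if "j \<in> {j \<in> group_nc I l. Deliver j \<in> S i} - {x \<in> group_nc I l. f x = i}" for j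
        using that group_bound[of j I l] ddp_ncD(3)[OF ddp, of j] by simp
    qed
    also have "\<dots> \<le> cap I"
      using S(1) that by (intro feasible_group[OF ddp]) simp
    finally show ?thesis .
  qed
  moreover have "\<forall>x\<in>group_nc I l. f x < opt_nc I"
    using f group_bound by blast
  ultimately show ?thesis
    unfolding opt_bins_def by (intro Least_le exI[of _ f] conjI allI impI)
qed

lemma ffd_ratioD:
  assumes "ffd_ratio B \<alpha>" "finite X" "\<forall>x\<in>X. 0 < c x \<and> c x \<le> B" "ffd B c X bs"
  shows "real (length bs) \<le> \<alpha> * real (opt_bins B c X)"
  using assms(1)[unfolded ffd_ratio_def, rule_format, of X c bs] assms(2-4) by blast

text \<open>One item of cost \<open>B\<close> needs a block, so the ratio cannot be zero or
  negative. The sign is needed for multiplying an inequality between optima by \<alpha>.\<close>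

lemma ffd_ratio_pos:
  assumes "ffd_ratio B \<alpha>" "0 < B"
  shows "0 < \<alpha>"
proof -
  have "ffd B (\<lambda>_. B) {0} [{0}]"
    unfolding ffd_def by (intro exI[of _ "[0]"]) simp
  from ffd_ratioD[OF assms(1) _ _ this] assms(2)
  have "real (length [{0 :: nat}]) \<le> \<alpha> * real (opt_bins B (\<lambda>_. B) {0})"
    by simp
  then have "0 < \<alpha> * real (opt_bins B (\<lambda>_. B) {0})" by simp
  then show ?thesis by (simp add: zero_less_mult_iff)
qed

lemma num_drones_ratio:
  assumes ddp: "ddp_nc I" and ratio: "ffd_ratio (cap I) \<alpha>" and P: "ffd_partition I P"
  shows "real (num_drones I P) \<le> \<alpha> * real (opt_nc I) + 2"
proof -
  have "Max ((\<lambda>l. length (P l)) ` {1..num_st I + 1}) \<in> (\<lambda>l. length (P l)) ` {1..num_st I + 1}"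
    by (intro Max_in) auto
  then obtain l where l: "l \<in> {1..num_st I + 1}" "num_drones I P = length (P l) + 2"
    unfolding num_drones_def by (elim imageE) simp
  have "ffd (cap I) (del_cost I) (group_nc I l) (P l)"
    using P l(1) by (auto simp: ffd_partition_def)
  moreover have "finite (group_nc I l)" "\<forall>x\<in>group_nc I l. 0 < del_cost I x \<and> del_cost I x \<le> cap I"
    using ddp_ncD(3,4)[OF ddp] by (auto simp: group_nc_def)
  ultimately have "real (length (P l)) \<le> \<alpha> * real (opt_bins (cap I) (del_cost I) (group_nc I l))"
    by (intro ffd_ratioD[OF ratio])
  also have "\<dots> \<le> \<alpha> * real (opt_nc I)"
    using ffd_ratio_pos[OF ratio ddp_ncD(1)[OF ddp]] opt_bins_group_le[OF ddp] by (intro mult_left_mono) auto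
  finally show ?thesis by (simp add: l(2))
qed

section \<open>Numbering drones around two forbidden values\<close>

fun nth_free :: "nat \<Rightarrow> nat \<Rightarrow> nat \<Rightarrow> nat \<Rightarrow> nat" where
  "nth_free a f k 0 = skip a f k"
| "nth_free a f k (Suc i) = nth_free a f (Suc (skip a f k)) i"

lemma skip_ge: "k \<le> skip a f k"
  by (auto simp: skip_def step_drone_def)

lemma nth_free_ge: "k \<le> nth_free a f k i"
  by (induction i arbitrary: k) (auto intro: skip_ge order_trans[OF le_SucI[OF skip_ge]])

lemma nth_free_notin: "nth_free a f k i \<notin> {a, f}"
  by (induction i arbitrary: k) (auto simp: skip_def step_drone_def)

lemma nth_free_inj: "nth_free a f k i = nth_free a f k j \<Longrightarrow> i = j"
proof (induction i arbitrary: j k)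
  case 0
  then show ?case
    using nth_free_ge[of "Suc (skip a f k)" a f "j - 1"] by (cases j) auto
next
  case (Suc i)
  then show ?case
    using nth_free_ge[of "Suc (skip a f k)" a f i] by (cases j) auto
qed

text \<open>A forbidden number delays the enumeration by at most one, and only if it has not been
  passed yet; hence the two indicator terms.\<close>

lemma nth_free_le: "nth_free a f k i \<le> k + i + of_bool (k \<le> a) + of_bool (k \<le> f)"
proof (induction i arbitrary: k)
  case 0
  show ?case by (auto simp: skip_def step_drone_def)
next
  case (Suc i)
  have "skip a f k + of_bool (Suc (skip a f k) \<le> a) + of_bool (Suc (skip a f k) \<le> f) \<le>
      k + of_bool (k \<le> a) + of_bool (k \<le> f)"
    by (auto simp: skip_def step_drone_def)
  with Suc[of "Suc (skip a f k)"] show ?case by simp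
qed

lemma nth_free_bound: "nth_free a f 0 i \<le> i + 2"
  using nth_free_le[of a f 0 i] by simp

text \<open>Shared by the existence proof and by the program, which differ only in how they find the
  drone \<open>f\<close>.\<close>

lemma stage_nth_free:
  assumes ddp: "ddp_nc I" and P: "ffd_partition I P" and l: "l \<in> {1..num_st I + 1}"
    and D: "\<And>i. i < length (P l) \<Longrightarrow> D l i = (if i \<in> first_blocks I P l then f else nth_free a f 0 i)"
    and f: "first_blocks I P l \<noteq> {} \<Longrightarrow> f < num_drones I P \<and> f \<notin> last_drone I P D (l - 2) \<and>
      f \<notin> D (l - 1) ` {..<length (P (l - 1))}"
    and a: "last_drone I P D (l - 1) \<subseteq> {a}"
  shows "stage I P D l"
  unfolding stage_def
proof (intro conjI allI ballI impI)
  have bound: "i < length (P l)" if "i \<in> first_blocks I P l" for i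
    using that by (simp add: first_blocks_def)
  show "D l i < num_drones I P" if "i < length (P l)" for i
    using that D[OF that] f nth_free_bound[of a f i] num_drones_le[OF l, of P] by auto
  show "D l i \<notin> last_drone I P D (l - 2)" "D l i \<notin> D (l - 1) ` {..<length (P (l - 1))}"
    if "i \<in> first_blocks I P l" for i
    using that D[OF bound[OF that]] f by auto
  show "D l i \<notin> last_drone I P D (l - 1)" if "i \<in> {..<length (P l)} - first_blocks I P l" for i
    using that D a nth_free_notin[of a f 0 i] by auto
  show "D l i \<notin> first_drone I P D l" if "i \<in> {..<length (P l)} - first_blocks I P l" for i
  proof -
    have "D l i \<noteq> f" using that D nth_free_notin[of a f 0 i] by auto
    moreover have "first_drone I P D l \<subseteq> {f}"
      using D bound by (auto simp: first_drone_def)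
    ultimately show ?thesis by blast
  qed
  show "inj_on (D l) ({..<length (P l)} - first_blocks I P l)"
    using D by (auto intro!: inj_onI dest: nth_free_inj)
qed

lemma subset_singleton:
  assumes "\<And>x y. x \<in> A \<Longrightarrow> y \<in> A \<Longrightarrow> x = y"
  obtains a where "A \<subseteq> {a}"
  using assms by blast

lemma last_drone_unique:
  assumes "ddp_nc I" "ffd_partition I P" "d \<in> last_drone I P D l" "e \<in> last_drone I P D l"
  shows "d = e"
  using assms(3,4) last_blocks_unique[OF assms(1,2)] by (auto simp: last_drone_def)

text \<open>A first block has to avoid at most \<open>length (P (l - 1))\<close> drones of the
  previous group and one earlier last drone, fewer than \<open>num_drones I P\<close> in total. The
  other blocks are numbered by \<open>nth_free\<close>.\<close>

lemma stage_exists: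
  assumes ddp: "ddp_nc I" and P: "ffd_partition I P" and l: "l \<in> {1..num_st I + 1}"
  shows "\<exists>ds. stage I P (D(l := ds)) l"
proof -
  obtain a where a: "last_drone I P D (l - 1) \<subseteq> {a}"
    using last_drone_unique[OF ddp P] by (rule subset_singleton)
  have "\<exists>f. first_blocks I P l \<noteq> {} \<longrightarrow> f < num_drones I P \<and> f \<notin> last_drone I P D (l - 2) \<and>
      f \<notin> D (l - 1) ` {..<length (P (l - 1))}"
  proof (cases "first_blocks I P l = {}")
    case False
    then have "2 \<le> l" using first_blocks_1[of l I P] by fastforce
    obtain b where b: "last_drone I P D (l - 2) \<subseteq> {b}"
      using last_drone_unique[OF ddp P] by (rule subset_singleton)
    let ?A = "insert b (D (l - 1) ` {..<length (P (l - 1))})"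
    have "card ?A \<le> Suc (card (D (l - 1) ` {..<length (P (l - 1))}))"
      by (rule card_insert_le_m1) auto
    also have "\<dots> \<le> Suc (length (P (l - 1)))"
      using card_image_le[of "{..<length (P (l - 1))}" "D (l - 1)"] by simp
    also have "\<dots> < num_drones I P"
    proof -
      have "l - 1 \<in> {1..num_st I + 1}" using l \<open>2 \<le> l\<close> by auto
      from num_drones_le[OF this, of P] show ?thesis by linarith
    qed
    finally have "\<not> {..<num_drones I P} \<subseteq> ?A"
      using card_mono[of ?A "{..<num_drones I P}"] by auto
    with b show ?thesis by blast
  qed simp
  then obtain f where f: "first_blocks I P l \<noteq> {} \<Longrightarrow> f < num_drones I P \<and> f \<notin> last_drone I P D (l - 2) \<and>
      f \<notin> D (l - 1) ` {..<length (P (l - 1))}" by blast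
  have other: "last_drone I P (D(l := ds)) k = last_drone I P D k" if "k \<noteq> l" for ds k
    using that by (simp add: last_drone_def)
  \<comment> \<open>Even with truncated subtraction, \<open>l - 1\<close> and \<open>l - 2\<close>
    differ from \<open>l\<close>, which is at least 1, so the update does not affect them.\<close>
  have other0: "last_drone I P (D(l := ds)) (l - 2) = last_drone I P D (l - 2)"
    "last_drone I P (D(l := ds)) (l - 1) = last_drone I P D (l - 1)" for ds
    using l by (auto intro!: other)
  show ?thesis
    by (rule exI[of _ "\<lambda>i. if i \<in> first_blocks I P l then f else nth_free a f 0 i"],
        rule stage_nth_free[OF ddp P l, of _ f a]) (use l f a in \<open>auto simp: other0[unfolded One_nat_def]\<close>)
qed

section \<open>The drones chosen by the program\<close>

definition blocks :: "instance_nc \<Rightarrow> nat \<Rightarrow> nat set list" where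
  "blocks I l = map set (bins I l)"

definition drone :: "instance_nc \<Rightarrow> nat \<Rightarrow> nat \<Rightarrow> nat" where
  "drone I l i = drone_list I l ! i"

lemma distinct_sorted_dels: "distinct (sorted_dels I)"
  by (simp add: sorted_dels_def)

lemma set_group_list [simp]: "set (group_list I l) = group_nc I l"
  by (auto simp: group_list_def group_nc_def)

lemma distinct_group_list: "distinct (group_list I l)"
  by (simp add: group_list_def distinct_sorted_dels)

lemma set_concat_bins: "set (concat (bins I l)) = group_nc I l"
  using mset_eq_setD[OF mset_concat_pack[of I "group_list I l"]] by (simp only: bins_def set_group_list)

lemma bins_subset: "b \<in> set (bins I l) \<Longrightarrow> set b \<subseteq> group_nc I l"
  using set_concat_bins[of I l] by auto

lemma length_blocks [simp]: "length (blocks I l) = length (bins I l)"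
  by (simp add: blocks_def)

lemma blocks_nth [simp]: "i < length (bins I l) \<Longrightarrow> blocks I l ! i = set (bins I l ! i)"
  by (simp add: blocks_def)

lemma ffd_partition_blocks: "ffd_partition I (blocks I)"
  unfolding ffd_partition_def
proof
  fix l
  let ?xs = "sort_by (\<lambda>j. - del_cost I j) (group_list I l)"
  have "sorted_wrt (\<lambda>x y. del_cost I x \<ge> del_cost I y) ?xs"
    using sorted_sort_by[of "\<lambda>j. - del_cost I j" "group_list I l"] by (simp add: sorted_wrt_map)
  moreover have "blocks I l = fold (place (cap I) (del_cost I)) ?xs []"
    using map_set_fold_put[of "[]" ?xs "cap I" "del_cost I"]
    by (simp add: blocks_def bins_def pack_def distinct_group_list)
  ultimately show "ffd (cap I) (del_cost I) (group_nc I l) (blocks I l)"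
    unfolding ffd_def by (intro exI[of _ ?xs]) (simp add: distinct_group_list)
qed

lemma first_blocks_eq:
  assumes "ddp_nc I"
  shows "first_blocks I (blocks I) l = {i. i < length (bins I l) \<and> first_bin I l (bins I l ! i)}"
proof -
  have "set (bins I l ! i) \<inter> first_dels I l \<noteq> {} \<longleftrightarrow> first_bin I l (bins I l ! i)"
    if "i < length (bins I l)" for i
    using bins_subset[OF nth_mem[OF that]] first_dels_iff_early[OF assms, of _ l]
    unfolding first_bin_def by (simp add: disjoint_iff) (meson subsetD)
  then show ?thesis
    unfolding first_blocks_def by (intro Collect_cong conj_cong) simp_all
qed

lemma last_blocks_eq: "last_blocks I (blocks I) l = {i. i < length (bins I l) \<and> last_bin I l (bins I l ! i)}"
proof -
  have "set (bins I l ! i) \<inter> last_dels I l \<noteq> {} \<longleftrightarrow> last_bin I l (bins I l ! i)"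
    if "i < length (bins I l)" for i
    using bins_subset[OF nth_mem[OF that]] last_dels_iff_past[of _ I l]
    unfolding last_bin_def by (simp add: disjoint_iff) (meson subsetD)
  then show ?thesis
    unfolding last_blocks_def by (intro Collect_cong conj_cong) simp_all
qed

lemma length_drones [simp]: "length (drones F a f k bs) = length bs"
  by (induction bs arbitrary: k) auto

lemma drones_nth:
  "i < length bs \<Longrightarrow> drones F a f k bs ! i = (if F (bs ! i) then f else nth_free a f k i)"
proof (induction bs arbitrary: i k)
  case (Cons b bs)
  then show ?case by (cases i) auto
qed simp

lemma length_drone_list [simp]: "length (drone_list I l) = length (bins I l)"
  by (simp add: drone_list_def)

lemma next_first_none: "\<forall>b\<in>set bs. \<not> F b \<Longrightarrow> next_first F a f k g bs = g"
  by (induction bs arbitrary: k g) auto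

lemma next_first_unique:
  assumes "i < length bs" "F (bs ! i)" "\<And>j. j < length bs \<Longrightarrow> F (bs ! j) \<Longrightarrow> j = i"
  shows "next_first F a f k g bs = nth_free a f k i"
  using assms
proof (induction bs arbitrary: i k g)
  case (Cons b bs)
  show ?case
  proof (cases i)
    case 0
    have "\<not> F (bs ! j)" if "j < length bs" for j
    proof
      assume "F (bs ! j)"
      with that have "Suc j = i" by (intro Cons.prems(3)) simp_all
      with 0 show False by simp
    qed
    then have "\<forall>c\<in>set bs. \<not> F c" by (simp add: all_set_conv_all_nth)
    then show ?thesis using 0 Cons.prems(2) by (simp add: next_first_none)
  next
    case (Suc m)
    have "\<not> F b"
    proof
      assume "F b"
      then have "0 = i" by (intro Cons.prems(3)) simp_all
      with Suc show False by simp
    qed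
    moreover have "next_first F a f (Suc (skip a f k)) g bs = nth_free a f (Suc (skip a f k)) m"
    proof (rule Cons.IH)
      show "j = m" if "j < length bs" "F (bs ! j)" for j
      proof -
        have "Suc j = i" using that by (intro Cons.prems(3)) simp_all
        with Suc show ?thesis by simp
      qed
    qed (use Cons.prems(1,2) Suc in simp_all)
    ultimately show ?thesis using Suc by simp
  qed
qed simp

lemma filter_zip_set:
  assumes "length bs = length ds"
  shows "set (map snd (filter (\<lambda>z. Q (fst z)) (zip bs ds))) = (\<lambda>i. ds ! i) ` {i. i < length bs \<and> Q (bs ! i)}"
proof -
  have "set (zip bs ds) = (\<lambda>i. (bs ! i, ds ! i)) ` {..<length bs}"
    using assms by (auto simp: set_zip)
  then have "{z \<in> set (zip bs ds). Q (fst z)} = (\<lambda>i. (bs ! i, ds ! i)) ` {i. i < length bs \<and> Q (bs ! i)}"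
    by auto
  then show ?thesis by (simp add: image_image)
qed

lemma distinct_filter_zip:
  assumes "distinct ds"
  shows "distinct (map snd (filter Q (zip bs ds)))"
proof -
  have "distinct (map snd (zip bs ds))"
    using assms by (simp add: map_snd_zip_take)
  then show ?thesis by (rule distinct_map_filter)
qed

context
  fixes I :: instance_nc
  assumes ddp: "ddp_nc I"
begin

lemma drone_eq:
  assumes "i < length (bins I l)"
  shows "drone I l i = (if i \<in> first_blocks I (blocks I) l then spare I l
    else nth_free (head_or (spare I l) (prev_last I l)) (spare I l) 0 i)"
  using assms by (simp add: drone_def drone_list_def drones_nth first_blocks_eq[OF ddp])

lemma set_prev_last_Suc:
  assumes "1 \<le> l"
  shows "set (prev_last I (Suc l)) = last_drone I (blocks I) (drone I) l"
  unfolding state_step(2)[OF assms] set_rev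
  by (subst filter_zip_set) (simp_all add: last_drone_def last_blocks_eq drone_def)

text \<open>If \<open>la\<close> is empty there is no last drone, and whatever default
  \<open>head_or\<close> returns is correct.\<close>

lemma last_drone_hd:
  assumes "set la = last_drone I (blocks I) D l"
  shows "last_drone I (blocks I) D l \<subseteq> {head_or f la}"
  using last_drone_unique[OF ddp ffd_partition_blocks, of _ D l] assms
  by (cases la) (auto simp: head_or_def)

text \<open>The reserved drone meets the requirements on a first block of group \<open>l\<close>
  whether or not such a block exists, so it can be fixed before group \<open>l\<close> is
  packed.\<close>

lemma stage_drone:
  assumes "l \<in> {1..num_st I + 1}"
  shows "stage I (blocks I) (drone I) l \<and>
    spare I l < num_drones I (blocks I) \<and>
    set (prev_last I l) = last_drone I (blocks I) (drone I) (l - 1) \<and>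
    spare I l \<notin> last_drone I (blocks I) (drone I) (l - 2) \<and>
    (2 \<le> l \<longrightarrow> spare I l \<notin> drone I (l - 1) ` {..<length (bins I (l - 1))})"
  using assms
proof (induction l)
  case (Suc l)
  let ?D = "drone I" and ?P = "blocks I" and ?N = "num_drones I (blocks I)"
  have inv: "spare I (Suc l) < ?N \<and>
    set (prev_last I (Suc l)) = last_drone I ?P ?D l \<and>
    spare I (Suc l) \<notin> last_drone I ?P ?D (l - 1) \<and>
    (1 \<le> l \<longrightarrow> spare I (Suc l) \<notin> ?D l ` {..<length (bins I l)})"
  proof (cases "l = 0")
    case True
    then show ?thesis
      by (simp add: spare_def prev_last_def last_drone_def last_blocks_0 num_drones_def)
  next
    case False
    then have l: "l \<in> {1..num_st I + 1}" "1 \<le> l" using Suc.prems by auto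
    define f a where "f = spare I l" and "a = head_or f (prev_last I l)"
    note IH = Suc.IH[OF l(1)]
    have a: "last_drone I ?P ?D (l - 1) \<subseteq> {a}"
      unfolding a_def using IH by (intro last_drone_hd) blast
    have D: "?D l i = (if i \<in> first_blocks I ?P l then f else nth_free a f 0 i)" if "i < length (bins I l)" for i
      using drone_eq[OF that] by (simp add: f_def a_def)
    have spare: "spare I (Suc l) = next_first (first_bin I l) a f 0 f (bins I l)"
      unfolding state_step(1)[OF l(2)] f_def a_def ..
    have "spare I (Suc l) < ?N \<and> spare I (Suc l) \<notin> last_drone I ?P ?D (l - 1) \<and>
      spare I (Suc l) \<notin> ?D l ` {..<length (bins I l)}"
    proof (cases "first_blocks I ?P l = {}")
      case True
      then have "spare I (Suc l) = f"
        unfolding spare using first_blocks_eq[OF ddp, of l]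
        by (intro next_first_none) (auto simp: in_set_conv_nth)
      moreover have "f \<notin> ?D l ` {..<length (bins I l)}"
      proof
        assume "f \<in> ?D l ` {..<length (bins I l)}"
        then obtain i where "f = nth_free a f 0 i" using D True by auto
        with nth_free_notin[of a f 0 i] show False by (metis insertCI)
      qed
      moreover have "f \<notin> last_drone I ?P ?D (l - 1)"
      proof (cases "2 \<le> l")
        case True
        with IH last_drone_subset[of I ?P ?D "l - 1"] show ?thesis by (auto simp: f_def)
      next
        case False
        with l have "l = 1" by simp
        then show ?thesis by (simp add: last_drone_def last_blocks_0)
      qed
      ultimately show ?thesis using IH by (simp add: f_def)
    next
      \<comment> \<open>The number passed over for the first block differs from \<open>f\<close>,
        the drone of that block; from \<open>a\<close>, which covers the last drone of group
        \<open>l - 1\<close>; and by injectivity from all other drones of group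
        \<open>l\<close>.\<close>
      case False
      then obtain i where i: "i \<in> first_blocks I ?P l" by blast
      have i': "i < length (bins I l)" "first_bin I l (bins I l ! i)"
        using i first_blocks_eq[OF ddp, of l] by auto
      have unique: "j = i" if "j \<in> first_blocks I ?P l" for j
        using first_blocks_unique[OF ddp ffd_partition_blocks l(1) that i] .
      have new: "spare I (Suc l) = nth_free a f 0 i"
        unfolding spare
      proof (rule next_first_unique[where F = "first_bin I l" and i = i, OF i'])
        show "j = i" if "j < length (bins I l)" "first_bin I l (bins I l ! j)" for j
          using that by (intro unique) (simp add: first_blocks_eq[OF ddp])
      qed
      have "nth_free a f 0 i < ?N"
        using nth_free_bound[of a f i] num_drones_le[OF l(1), of ?P] i'(1) by simp
      moreover have "nth_free a f 0 i \<notin> last_drone I ?P ?D (l - 1)"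
        using a nth_free_notin[of a f 0 i] by blast
      moreover have "nth_free a f 0 i \<noteq> ?D l j" if "j < length (bins I l)" for j
      proof (cases "j = i")
        case True
        with D[OF that] i nth_free_notin[of a f 0 i] show ?thesis by simp
      next
        case False
        then have "j \<notin> first_blocks I ?P l" using unique by blast
        with D[OF that] False nth_free_inj[of a f 0 i j] show ?thesis by simp metis
      qed
      ultimately show ?thesis unfolding new by blast
    qed
    with set_prev_last_Suc[OF l(2)] show ?thesis by blast
  qed
  have "stage I ?P ?D (Suc l)"
  proof (rule stage_nth_free[OF ddp ffd_partition_blocks Suc.prems])
    show "?D (Suc l) i = (if i \<in> first_blocks I ?P (Suc l) then spare I (Suc l)
        else nth_free (head_or (spare I (Suc l)) (prev_last I (Suc l))) (spare I (Suc l)) 0 i)"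
      if "i < length (?P (Suc l))" for i
      using that by (intro drone_eq) simp
    show "last_drone I ?P ?D (Suc l - 1) \<subseteq> {head_or (spare I (Suc l)) (prev_last I (Suc l))}"
      using inv by (intro last_drone_hd) simp
    show "spare I (Suc l) < ?N \<and> spare I (Suc l) \<notin> last_drone I ?P ?D (Suc l - 2) \<and>
        spare I (Suc l) \<notin> ?D (Suc l - 1) ` {..<length (?P (Suc l - 1))}"
      if "first_blocks I ?P (Suc l) \<noteq> {}"
    proof -
      have "1 \<le> l" using that first_blocks_1[of "Suc l" I ?P] by fastforce
      with inv show ?thesis by (simp add: numeral_2_eq_2)
    qed
  qed
  with inv show ?case by (simp add: numeral_2_eq_2)
qed simp

lemma algo_run_drone: "algo_run I (blocks I) (drone I)"
  using stage_drone ffd_partition_blocks by (simp add: algo_run_def)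

lemma distinct_drone_list:
  assumes "l \<in> {1..num_st I + 1}"
  shows "distinct (drone_list I l)"
  using stage_inj[OF ddp ffd_partition_blocks _ assms] stage_drone[OF assms]
  by (auto simp: distinct_conv_nth drone_def)

text \<open>Matches the list with \<open>charging_eq\<close>. Its two parts are disjoint because the
  last drone of the previous group is idle in this one.\<close>

lemma charge_list:
  assumes l: "l \<in> {1..num_st I}"
  shows "set (charge_list I l) = charging I (blocks I) (drone I) l" "distinct (charge_list I l)"
proof -
  let ?D = "drone I" and ?P = "blocks I"
  have lr: "l \<in> {1..num_st I + 1}" using l by simp
  note stage = stage_drone[OF lr]
  let ?new = "map snd (filter (\<lambda>z. \<not> last_bin I l (fst z)) (zip (bins I l) (drone_list I l)))"
  have "set ?new = ?D l ` {i. i < length (bins I l) \<and> \<not> last_bin I l (bins I l ! i)}"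
    by (subst filter_zip_set) (simp_all add: drone_def)
  also have "\<dots> = ?D l ` ({..<length (?P l)} - last_blocks I ?P l)"
    by (intro arg_cong[of _ _ "image (?D l)"]) (auto simp: last_blocks_eq)
  also have "\<dots> = ?D l ` {..<length (?P l)} - ?D l ` last_blocks I ?P l"
  proof (rule inj_on_image_set_diff)
    show "inj_on (?D l) {..<length (?P l)}"
      using stage_inj[OF ddp ffd_partition_blocks _ lr] stage by (auto intro!: inj_onI)
  qed (auto simp: last_blocks_def)
  finally have new: "set ?new = ?D l ` {..<length (?P l)} - last_drone I ?P ?D l"
    by (simp add: last_drone_def)
  have idle: "last_drone I ?P ?D (l - 1) \<inter> ?D l ` {..<length (?P l)} = {}"
    using stageD(4)[of I ?P ?D l] stage by auto
  have prev: "set (prev_last I l) = last_drone I ?P ?D (l - 1)"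
    using stage by blast
  show "set (charge_list I l) = charging I ?P ?D l"
    unfolding charging_eq[OF ddp algo_run_drone l] charge_list_def set_append set_rev new prev
    using idle last_drone_subset[of I ?P ?D l] by blast
  have "distinct (prev_last I l)"
  proof (cases "l = 1")
    case True
    then show ?thesis by (simp add: prev_last_def)
  next
    case False
    then obtain k where "l = Suc k" "1 \<le> k" using l by (cases l) auto
    then show ?thesis
      using distinct_drone_list[of k] l state_step(2)[of k I] by (simp add: distinct_filter_zip)
  qed
  moreover have "distinct ?new"
    using distinct_drone_list[OF lr] by (rule distinct_filter_zip)
  moreover have "set ?new \<inter> set (prev_last I l) = {}"
    unfolding new prev using idle by blast
  ultimately show "distinct (charge_list I l)"
    unfolding charge_list_def by simp
qed

lemma set_emitted: "set (emitted zs) = {(j, d). \<exists>js. (js, d) \<in> set zs \<and> j \<in> set js}"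
  by (induction zs rule: emitted.induct) auto

lemma mset_emitted: "mset (map fst (emitted zs)) = mset (concat (map fst zs))"
  by (induction zs rule: emitted.induct) (auto simp: multiset.map_comp comp_def)

lemma emitted_served:
  "(j, d) \<in> set (emitted (zip (bins I l) (drone_list I l))) \<longleftrightarrow> j \<in> served (blocks I) (drone I) l d"
  by (auto simp: set_emitted set_zip served_def drone_def)

lemma set_emitted_from:
  "set (emitted_from I 1) = {(j, d). Deliver j \<in> schedule I (blocks I) (drone I) d}"
proof -
  have "(j, d) \<in> set (emitted_from I 1) \<longleftrightarrow> (\<exists>l\<in>{1..num_st I + 1}. j \<in> served (blocks I) (drone I) l d)" for j d
  proof -
    have "set (rev [1..<num_st I + 2]) = {1..num_st I + 1}"
      by (auto simp del: upt_Suc)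
    then have "set (emitted_from I 1) = (\<Union>l\<in>{1..num_st I + 1}. set (emitted (zip (bins I l) (drone_list I l))))"
      by (simp only: emitted_from_def set_concat set_map image_image)
    then show ?thesis
      unfolding emitted_served[symmetric] by blast
  qed
  then show ?thesis by (auto simp: Deliver_schedule[OF ddp algo_run_drone])
qed

text \<open>Even the deliveries alone are distinct: each group is emitted once and the groups are
  disjoint. The induction therefore records from which groups the pairs stem.\<close>

lemma distinct_emitted_from: "distinct (emitted_from I 1)"
proof -
  let ?e = "\<lambda>l. emitted (zip (bins I l) (drone_list I l))"
  have mset: "mset (map fst (?e l)) = mset (group_list I l)" for l
    using mset_concat_pack[of I "group_list I l"] by (simp only: mset_emitted) (simp add: bins_def)
  have distinct: "distinct (map fst (?e l))" for l
    by (rule iffD2[OF mset_eq_imp_distinct_iff[OF mset] distinct_group_list])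
  have group: "set (map fst (?e l)) = group_nc I l" for l
    using mset_eq_setD[OF mset[of l]] by (simp only: set_group_list)
  have "distinct (map fst (emitted_from I l)) \<and>
      set (map fst (emitted_from I l)) \<subseteq> (\<Union>k\<in>{l..num_st I + 1}. group_nc I k)"
    if "l \<le> num_st I + 2" for l
    using that
  proof (induction rule: inc_induct)
    case base
    show ?case by (simp add: emitted_from_Nil[simplified])
  next
    case (step l)
    then have l: "l \<le> num_st I + 1" by simp
    have IH: "distinct (map fst (emitted_from I (Suc l)))"
      "set (map fst (emitted_from I (Suc l))) \<subseteq> (\<Union>k\<in>{Suc l..num_st I + 1}. group_nc I k)"
      using step.IH by blast+
    have "x \<notin> group_nc I l" if "x \<in> (\<Union>k\<in>{Suc l..num_st I + 1}. group_nc I k)" for x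
    proof
      assume x: "x \<in> group_nc I l"
      from that obtain k where "Suc l \<le> k" "x \<in> group_nc I k" by auto
      with group_unique[OF ddp x] show False by fastforce
    qed
    with IH(2) have "set (map fst (emitted_from I (Suc l))) \<inter> set (map fst (?e l)) = {}"
      unfolding group by blast
    then have "distinct (map fst (emitted_from I l))"
      unfolding emitted_from_Suc[OF l] map_append distinct_append using IH(1) distinct[of l] by blast
    moreover have sub: "group_nc I l \<subseteq> (\<Union>k\<in>{l..num_st I + 1}. group_nc I k)"
      "(\<Union>k\<in>{Suc l..num_st I + 1}. group_nc I k) \<subseteq> (\<Union>k\<in>{l..num_st I + 1}. group_nc I k)"
      using l by (intro UN_upper, simp) (intro UN_mono, auto)
    then have "set (map fst (emitted_from I l)) \<subseteq> (\<Union>k\<in>{l..num_st I + 1}. group_nc I k)"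
      unfolding emitted_from_Suc[OF l] map_append set_append group using IH(2) sub by (intro Un_least) (rule order_trans)
    ultimately show ?case by blast
  qed
  then have "distinct (map fst (emitted_from I 1))" by simp
  then show ?thesis by (simp add: distinct_map)
qed

lemma output_val_main:
  "output_val I (blocks I) (drone I)
    (VPair (VNum (real (Max ((\<lambda>l. length (bins I l)) ` {1..num_st I + 1}) + 2)))
      (VPair (val_list (map pair_val (emitted_from I 1)))
        (val_list (map (\<lambda>l. num_vals (charge_list I l)) [1..<num_st I + 1]))))"
  unfolding output_val_def
proof (intro exI conjI ballI)
  let ?cs = "map (charge_list I) [1..<num_st I + 1]"
  show "distinct (emitted_from I 1)" by (rule distinct_emitted_from)
  show "set (emitted_from I 1) = {(j, d). Deliver j \<in> schedule I (blocks I) (drone I) d}"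
    by (rule set_emitted_from)
  show "length ?cs = num_st I" by simp
  show "distinct (?cs ! (l - 1))" "set (?cs ! (l - 1)) = charging I (blocks I) (drone I) l"
    if l: "l \<in> {1..num_st I}" for l
  proof -
    have "?cs ! (l - 1) = charge_list I l"
      using l by (subst nth_map) (auto simp del: upt_Suc)
    then show "distinct (?cs ! (l - 1))" "set (?cs ! (l - 1)) = charging I (blocks I) (drone I) l"
      using charge_list[OF l] by simp_all
  qed
  have "num_drones I (blocks I) = Max ((\<lambda>l. length (bins I l)) ` {1..num_st I + 1}) + 2"
    by (simp add: num_drones_def)
  moreover have "pair_val = (\<lambda>(j, d). VPair (VNum (real j)) (VNum (real d)))"
    by (auto simp: pair_val_def)
  ultimately show "VPair (VNum (real (Max ((\<lambda>l. length (bins I l)) ` {1..num_st I + 1}) + 2)))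
      (VPair (val_list (map pair_val (emitted_from I 1)))
        (val_list (map (\<lambda>l. num_vals (charge_list I l)) [1..<num_st I + 1]))) =
    VPair (VNum (real (num_drones I (blocks I))))
      (VPair (val_list (map (\<lambda>(j, d). VPair (VNum (real j)) (VNum (real d))) (emitted_from I 1)))
        (val_list (map (\<lambda>ds. val_list (map (\<lambda>d. VNum (real d)) ds)) ?cs)))"
    by (simp only: map_map comp_def num_vals_def)
qed

end

theorem algo_in_time: algo_in_time_n_log_n_plus_r
  unfolding algo_in_time_n_log_n_plus_r_def
proof (rule exI[of _ program], rule exI[of _ main_e], rule exI[of _ 4000], intro allI impI)
  fix I assume ddp: "ddp_nc I"
  obtain v where v: "output_val I (blocks I) (drone I) v"
    "\<And>K. num_del I \<le> 2 ^ K \<Longrightarrow> \<exists>t. run program [input_val I] main_e = Some (v, t) \<and>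
      t \<le> 220 * num_del I * K + 1300 * num_del I + 800 * num_st I + 1000"
    using output_val_main[OF ddp] run_main[OF ddp] by metis
  \<comment> \<open>Any admissible exponent exhibits the run. Since \<open>run\<close> is a
    function, the bounds for all other exponents concern the same \<open>t\<close>.\<close>
  have "num_del I \<le> 2 ^ num_del I" by (simp add: less_imp_le)
  from v(2)[OF this] obtain t where t: "run program [input_val I] main_e = Some (v, t)" by blast
  have "evaluates program [input_val I] main_e v t"
    using evaluates_if_run[OF t] by simp
  moreover have "real t \<le> 4000 * (real (num_del I) * log 2 (real (num_del I)) + real (num_st I))"
    if "2 \<le> num_del I \<or> 1 \<le> num_st I"
    using v(2) t by (intro time_bound[OF _ that]) fastforce
  ultimately show "\<exists>P D v t. algo_run I P D \<and> output_val I P D v \<and> evaluates program [input_val I] main_e v t \<and>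
      (2 \<le> num_del I \<or> 1 \<le> num_st I \<longrightarrow>
        real t \<le> 4000 * (real (num_del I) * log 2 (real (num_del I)) + real (num_st I)))"
    using algo_run_drone[OF ddp] v(1) by blast
qed

theorem theorem2:
  shows "algo_in_time_n_log_n_plus_r \<and>
    (\<forall>I \<alpha>. ddp_nc I \<and> ffd_ratio (cap I) \<alpha> \<longrightarrow>
       (\<forall>P D l. ffd_partition I P \<and> l \<in> {1..num_st I + 1} \<and> (\<forall>k\<in>{1..<l}. stage I P D k) \<longrightarrow>
          (\<exists>ds. stage I P (D(l := ds)) l)) \<and>
       (\<forall>P D. algo_run I P D \<longrightarrow>
          (\<forall>j\<in>{1..num_del I}. \<exists>!d. Deliver j \<in> schedule I P D d) \<and>
          (\<forall>d. schedule I P D d \<noteq> {} \<longrightarrow> d < num_drones I P) \<and>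
          (\<forall>d<num_drones I P. feasible I (schedule I P D d)) \<and>
          real (num_drones I P) \<le> \<alpha> * real (opt_nc I) + 2))"
proof (intro conjI allI impI ballI)
  show algo_in_time_n_log_n_plus_r by (rule algo_in_time)
next
  fix I \<alpha> P D l
  assume "ddp_nc I \<and> ffd_ratio (cap I) \<alpha>"
    and "ffd_partition I P \<and> l \<in> {1..num_st I + 1} \<and> (\<forall>k\<in>{1..<l}. stage I P D k)"
  then show "\<exists>ds. stage I P (D(l := ds)) l" by (intro stage_exists) simp_all
next
  fix I \<alpha> P D
  assume I: "ddp_nc I \<and> ffd_ratio (cap I) \<alpha>" and algo: "algo_run I P D"
  note run = conjunct1[OF I] algo
  show "\<exists>!d. Deliver j \<in> schedule I P D d" if "j \<in> {1..num_del I}" for j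
    by (rule schedule_unique[OF run that])
  show "d < num_drones I P" if "schedule I P D d \<noteq> {}" for d
    by (rule schedule_bound[OF run that])
  show "feasible I (schedule I P D d)" for d
    by (rule feasible_schedule[OF run])
  show "real (num_drones I P) \<le> \<alpha> * real (opt_nc I) + 2"
    using I ffdP[OF run] by (intro num_drones_ratio) simp_all
qed

end
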